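(* If $\mathcal{A}\cap C^\infty([0,L]^2)\neq\emptyset$, then $\mathcal{A}\cup\{g\}\subset C^\infty([0,L]^2)$.
   Context: Setting: 2D incompressible Navier–Stokes equations on $\Omega=[0,L]^2$ with periodic boundary conditions, viscosity $\nu>0$. $H$ is the closure in $L^2(\Omega)^2$ of the $\mathbb{R}^2$-valued trigonometric polynomials $v$ with $\nabla\cdot v=0$ and $\int_\Omega v\,dx=0$. $A=-\Delta$ is the Stokes operator on $H$, $B(u,v)=\mathcal{P}((u\cdot\nabla)v)$ with $\mathcal{P}$ the Leray projection, and $g\in H$ is a fixed time-independent force. The NSE is $\frac{du}{dt}+\nu Au+B(u,u)=g$. The global attractor $\mathcal{A}$ is the set of all $u_0\in H$ for which there is a solution $u(t)$ of the NSE for all $t\in\mathbb{R}$ with $u(0)=u_0$ and $\sup_t|u(t)|<\infty$. *)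

theory Defs
  imports "HOL-Analysis.Analysis"
begin

text \<open>Periodic 2D NSE on [0,L]^2, written in Fourier variables.
  An element u of H is represented by its Fourier coefficients
  u k (k in Z^2), u k in C^2, with respect to the basis exp(2 pi i k.x / L),
  i.e. u k = L^-2 times the integral over [0,L]^2 of u(x) exp(-2 pi i k.x/L).\<close>

definition kvec :: "int \<times> int \<Rightarrow> complex ^ 2" where
  "kvec k = (\<chi> i. if i = 1 then of_int (fst k) else of_int (snd k))"

definition dotc :: "complex ^ 2 \<Rightarrow> complex ^ 2 \<Rightarrow> complex" where
  "dotc v w = v $ 1 * w $ 1 + v $ 2 * w $ 2"

definition ksq :: "int \<times> int \<Rightarrow> real" where
  "ksq k = real_of_int ((fst k)^2 + (snd k)^2)"

text \<open>Membership in H: mean zero, divergence free, real valued, square integrable.\<close>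
definition in_H :: "(int \<times> int \<Rightarrow> complex ^ 2) \<Rightarrow> bool" where
  "in_H c \<longleftrightarrow> c (0, 0) = 0
     \<and> (\<forall>k. dotc (kvec k) (c k) = 0)
     \<and> (\<forall>k. c (- fst k, - snd k) = (\<chi> i. cnj (c k $ i)))
     \<and> (\<lambda>k. (norm (c k))^2) summable_on UNIV"

definition in_V :: "(int \<times> int \<Rightarrow> complex ^ 2) \<Rightarrow> bool" where
  "in_V c \<longleftrightarrow> in_H c \<and> (\<lambda>k. ksq k * (norm (c k))^2) summable_on UNIV"

definition leray :: "int \<times> int \<Rightarrow> complex ^ 2 \<Rightarrow> complex ^ 2" where
  "leray k w = (if k = (0, 0) then 0
               else w - (dotc (kvec k) w / of_real (ksq k)) *s kvec k)"

text \<open>k-th Fourier coefficient of B(u,v) = P((u . grad) v).\<close>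
definition nonlin :: "real \<Rightarrow> (int \<times> int \<Rightarrow> complex ^ 2) \<Rightarrow> (int \<times> int \<Rightarrow> complex ^ 2)
    \<Rightarrow> int \<times> int \<Rightarrow> complex ^ 2" where
  "nonlin L u v k = leray k (infsum (\<lambda>j.
      (\<i> * of_real (2 * pi / L) * dotc (u j) (kvec (fst k - fst j, snd k - snd j)))
        *s v (fst k - fst j, snd k - snd j)) UNIV)"

definition nse_solution :: "real \<Rightarrow> real \<Rightarrow> (int \<times> int \<Rightarrow> complex ^ 2)
    \<Rightarrow> (real \<Rightarrow> int \<times> int \<Rightarrow> complex ^ 2) \<Rightarrow> bool" where
  "nse_solution \<nu> L g u \<longleftrightarrow>
     (\<forall>t. in_V (u t)) \<and>
     (\<forall>t k. ((\<lambda>s. u s k) has_vector_derivative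
        (g k - of_real (\<nu> * (2 * pi / L)^2 * ksq k) *s u t k - nonlin L (u t) (u t) k)) (at t))"

definition attractor :: "real \<Rightarrow> real \<Rightarrow> (int \<times> int \<Rightarrow> complex ^ 2)
    \<Rightarrow> (int \<times> int \<Rightarrow> complex ^ 2) set" where
  "attractor \<nu> L g = {u0. \<exists>u. nse_solution \<nu> L g u \<and> u 0 = u0 \<and>
      (\<exists>M. \<forall>t. infsum (\<lambda>k. (norm (u t k))^2) UNIV \<le> M)}"

fun Ck :: "nat \<Rightarrow> ('a::euclidean_space \<Rightarrow> 'b::real_normed_vector) \<Rightarrow> bool" where
  "Ck 0 f = continuous_on UNIV f"
| "Ck (Suc n) f = ((\<forall>x. f differentiable at x) \<and>
      (\<forall>i\<in>Basis. Ck n (\<lambda>x. frechet_derivative f (at x) i)))"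

definition smooth_fn :: "('a::euclidean_space \<Rightarrow> 'b::real_normed_vector) \<Rightarrow> bool" where
  "smooth_fn f \<longleftrightarrow> (\<forall>n. Ck n f)"

definition periodic_box :: "real \<Rightarrow> (real ^ 2 \<Rightarrow> 'b) \<Rightarrow> bool" where
  "periodic_box L f \<longleftrightarrow> (\<forall>x. \<forall>b\<in>Basis. f (x + L *\<^sub>R b) = f x)"

definition fourier_coeff :: "real \<Rightarrow> (real ^ 2 \<Rightarrow> real ^ 2) \<Rightarrow> int \<times> int \<Rightarrow> complex ^ 2" where
  "fourier_coeff L \<phi> k = of_real (1 / L^2) *s integral (cbox 0 (\<chi> i. L))
     (\<lambda>x. exp (- (\<i> * of_real (2 * pi / L)) * of_real (x $ 1 * of_int (fst k) + x $ 2 * of_int (snd k)))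
          *s (\<chi> i. complex_of_real (\<phi> x $ i)))"

definition smooth_H :: "real \<Rightarrow> (int \<times> int \<Rightarrow> complex ^ 2) \<Rightarrow> bool" where
  "smooth_H L c \<longleftrightarrow> (\<exists>\<phi>::real ^ 2 \<Rightarrow> real ^ 2.
      smooth_fn \<phi> \<and> periodic_box L \<phi> \<and> (\<forall>k. fourier_coeff L \<phi> k = c k))"

end

theory Submission
  imports Defs
begin

text \<open>
  Let \<open>u\<close> be a complete trajectory that is bounded in \<open>H\<close>. It is bounded in \<open>V\<close>, so its nonlinear term
  is bounded in each frequency, uniformly in time. Variation of constants from time
  \<open>-\<infinity>\<close> gives \<open>\<bar>u\<^sub>k(t) - g\<^sub>k/\<mu>\<^sub>k\<bar> \<le> sup\<^sub>s \<bar>B(u,u)\<^sub>k(s)\<bar>/\<mu>\<^sub>k\<close> with \<open>\<mu>\<^sub>k = \<nu>(2\<pi>/L)\<^sup>2|k|\<^sup>2\<close>.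
  Read as a bound for \<open>u\<close>, it shows that \<open>u\<close> decays two orders better than \<open>g\<close>, and then \<open>B(u,u)\<close>
  decays half an order better than \<open>g\<close>. Read as a bound for \<open>g\<close> at a time at which \<open>u\<close> is smooth, it
  shows that \<open>g\<close> decays at least as fast as \<open>B(u,u)\<close>. Iterating, \<open>g\<close> decays faster than any power, hence so does
  every trajectory in the attractor.
\<close>

section \<open>Lattice sums\<close>

text \<open>In half-orders of |k|, inverting the Stokes operator gains four, while the nonlinear
  term costs two for its derivative and one for a logarithm; so each round of the iteration nets
  one. The obstacle is boundedness in V. A solution lies in V at each single time and its
  coefficients solve their equations, but this does not by itself make the enstrophy integrable in
  time, and the energy balance over infinitely many modes passes to the limit only under such a
  majorant. Integrability is drawn from local boundedness, and local boundedness from a category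
  argument combined with a growth estimate. After that the bound is the uniform Gronwall lemma of
  the two-dimensional theory: the growth rate of the enstrophy is linear in it, with a coefficient
  whose integral over unit time is controlled by the energy. Boundedness over the whole past is what
  erases the initial value in the variation of constants. Hence the nonlinear term is always
  estimated uniformly in time, although smoothness is given at a single time.\<close>

definition kn :: "int \<times> int \<Rightarrow> real" where
  "kn k = sqrt (ksq k)"

lemma kn_cmod: "kn k = cmod (Complex (of_int (fst k)) (of_int (snd k)))"
  by (simp add: kn_def ksq_def cmod_def)

lemma kn_nonneg [simp]: "0 \<le> kn k"
  by (simp add: kn_cmod)

lemma kn_sq: "(kn k)\<^sup>2 = ksq k"
  by (simp add: kn_def ksq_def)

lemma ksq_nonneg [simp]: "0 \<le> ksq k"
  by (simp add: ksq_def)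

lemma kn_0 [simp]: "kn 0 = 0"
  by (simp add: kn_def ksq_def)

lemma kn_triangle: "kn (j + k) \<le> kn j + kn k"
proof -
  have "kn (j + k) = cmod (Complex (of_int (fst j)) (of_int (snd j)) + Complex (of_int (fst k)) (of_int (snd k)))"
    by (simp add: kn_cmod complex_add)
  then show ?thesis
    by (metis kn_cmod norm_triangle_ineq)
qed

text \<open>The sup norm as a natural number: its level sets are square rings with O(n) points, and
  its balls are the finite boxes that exhaust the lattice.\<close>

definition mx :: "int \<times> int \<Rightarrow> nat" where
  "mx k = nat (max \<bar>fst k\<bar> \<bar>snd k\<bar>)"

lemma mx_le_kn: "real (mx k) \<le> kn k"
proof -
  have "\<bar>real_of_int (fst k)\<bar> \<le> kn k" "\<bar>real_of_int (snd k)\<bar> \<le> kn k"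
    using abs_Re_le_cmod[of "Complex (of_int (fst k)) (of_int (snd k))"]
      abs_Im_le_cmod[of "Complex (of_int (fst k)) (of_int (snd k))"] by (simp_all add: kn_cmod)
  then show ?thesis
    by (auto simp: mx_def max_def)
qed

lemma mx_pos: "k \<noteq> 0 \<Longrightarrow> 1 \<le> mx k"
  by (cases k) (auto simp: mx_def zero_prod_def)

lemma kn_ge_1: "k \<noteq> 0 \<Longrightarrow> 1 \<le> kn k"
  using mx_pos[of k] mx_le_kn[of k] by linarith

lemma kn_pos: "k \<noteq> 0 \<Longrightarrow> 0 < kn k"
  using kn_ge_1[of k] by linarith

definition sq_box :: "nat \<Rightarrow> (int \<times> int) set" where
  "sq_box n = {- int n..int n} \<times> {- int n..int n}"

lemma finite_sq_box [simp]: "finite (sq_box n)"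
  by (simp add: sq_box_def)

lemma mem_sq_box: "k \<in> sq_box n \<longleftrightarrow> mx k \<le> n"
  by (cases k) (auto simp: sq_box_def mx_def)

text \<open>Infinite sums are limits along all finite sets, whereas monotone and dominated
  convergence speak of sequences; the boxes mediate.\<close>

lemma sq_box_at_top: "filterlim sq_box (finite_subsets_at_top UNIV) sequentially"
  unfolding filterlim_def le_filter_def eventually_filtermap
proof (intro allI impI)
  fix P :: "(int \<times> int) set \<Rightarrow> bool"
  assume "eventually P (finite_subsets_at_top UNIV)"
  then obtain X where X: "finite X" "\<And>Y. finite Y \<Longrightarrow> X \<subseteq> Y \<Longrightarrow> P Y"
    by (auto simp: eventually_finite_subsets_at_top)
  have "P (sq_box n)" if "Max (insert 0 (mx ` X)) \<le> n" for n
  proof (rule X(2))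
    show "X \<subseteq> sq_box n"
    proof
      fix k assume "k \<in> X"
      then have "mx k \<le> Max (insert 0 (mx ` X))"
        using X(1) by simp
      then show "k \<in> sq_box n"
        using that by (simp add: mem_sq_box)
    qed
  qed simp
  then show "\<forall>\<^sub>F n in sequentially. P (sq_box n)"
    by (rule eventually_sequentiallyI)
qed

lemma has_sum_sq_box:
  fixes f :: "int \<times> int \<Rightarrow> 'a::{topological_space, comm_monoid_add}"
  assumes "(f has_sum S) UNIV"
  shows "(\<lambda>n. sum f (sq_box n)) \<longlonglongrightarrow> S"
  using filterlim_compose[OF assms[unfolded has_sum_def] sq_box_at_top] .

lemma card_ring:
  assumes "1 \<le> n"
  shows "finite {k. mx k = n}" "card {k. mx k = n} \<le> 12 * n"
proof -
  let ?I = "{- int n..int n}"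
  have sub: "{k. mx k = n} \<subseteq> {int n, - int n} \<times> ?I \<union> ?I \<times> {int n, - int n}"
    by (auto simp: mx_def max_def split: if_splits)
  then show fin: "finite {k. mx k = n}"
    by (rule finite_subset) auto
  have "card {k. mx k = n} \<le> card ({int n, - int n} \<times> ?I \<union> ?I \<times> {int n, - int n})"
    using sub by (intro card_mono) auto
  also have "\<dots> \<le> card ({int n, - int n} \<times> ?I) + card (?I \<times> {int n, - int n})"
    by (rule card_Un_le)
  \<comment> \<open>Each pair of opposite sides has 2 * (2n + 1) points, and 8n + 4 \<le> 12n for n
    \<ge> 1.\<close>
  also have "\<dots> \<le> 12 * n"
    using assms by (simp add: card_cartesian_product card_insert_if)
  finally show "card {k. mx k = n} \<le> 12 * n" .
qed

lemma sum_over_rings_le: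
  fixes f :: "nat \<Rightarrow> real"
  assumes "finite F" "0 \<notin> F" "\<And>k. k \<in> F \<Longrightarrow> mx k \<le> N" "\<And>n. 0 \<le> f n"
  shows "(\<Sum>k\<in>F. f (mx k)) \<le> (\<Sum>n=1..N. 12 * real n * f n)"
proof -
  have "mx ` F \<subseteq> {1..N}"
  proof
    fix n assume "n \<in> mx ` F"
    then obtain k where "k \<in> F" "n = mx k" by blast
    moreover from this have "k \<noteq> 0" using assms(2) by metis
    ultimately show "n \<in> {1..N}"
      using assms(3) mx_pos by auto
  qed
  then have "(\<Sum>k\<in>F. f (mx k)) = (\<Sum>n=1..N. \<Sum>k\<in>{k\<in>F. mx k = n}. f (mx k))"
    using assms(1) by (subst sum.group) auto
  also have "\<dots> \<le> (\<Sum>n=1..N. 12 * real n * f n)"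
  proof (rule sum_mono)
    fix n assume n: "n \<in> {1..N}"
    have "card {k\<in>F. mx k = n} \<le> card {k. mx k = n}"
      using n card_ring(1)[of n] by (intro card_mono) auto
    then have "real (card {k\<in>F. mx k = n}) \<le> 12 * real n"
      using n card_ring(2)[of n] by auto
    then show "(\<Sum>k\<in>{k\<in>F. mx k = n}. f (mx k)) \<le> 12 * real n * f n"
      using assms(4)[of n] by (simp add: mult_right_mono)
  qed
  finally show ?thesis .
qed

text \<open>In dimension two 1/|l| has mass linear in the radius: the ring of sup norm n has at most
  12n points, each contributing at most 1/n.\<close>

lemma sum_inverse_kn_le:
  assumes "finite F" "0 \<le> \<rho>"
  shows "(\<Sum>l\<in>{l\<in>F. l \<noteq> 0 \<and> kn l \<le> \<rho>}. 1 / kn l) \<le> 12 * \<rho>"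
proof -
  let ?G = "{l\<in>F. l \<noteq> 0 \<and> kn l \<le> \<rho>}"
  have "(\<Sum>l\<in>?G. 1 / kn l) \<le> (\<Sum>l\<in>?G. 1 / real (mx l))"
    using mx_le_kn mx_pos by (intro sum_mono divide_left_mono) (auto intro!: mult_pos_pos simp: kn_pos Suc_le_eq)
  also have "\<dots> \<le> (\<Sum>n=1..nat \<lfloor>\<rho>\<rfloor>. 12 * real n * (1 / real n))"
  proof (rule sum_over_rings_le[of ?G "nat \<lfloor>\<rho>\<rfloor>" "\<lambda>n. 1 / real n"])
    fix k assume "k \<in> ?G"
    then have "real (mx k) \<le> \<rho>"
      using mx_le_kn[of k] by auto
    then show "mx k \<le> nat \<lfloor>\<rho>\<rfloor>"
      using le_nat_floor by blast
  qed (use assms in auto)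
  also have "\<dots> = (\<Sum>n=1..nat \<lfloor>\<rho>\<rfloor>. 12)"
    by (intro sum.cong) auto
  also have "\<dots> \<le> 12 * \<rho>"
    using assms(2) by simp
  finally show ?thesis .
qed

text \<open>Decay is measured in powers of \<open>|k|\<^sup>1\<^sup>/\<^sup>2\<close>: convolving two sequences of order \<open>|k|\<^sup>-\<^sup>2\<close> costs a
  logarithm, which is absorbed by giving up half an order.\<close>

definition qn :: "int \<times> int \<Rightarrow> real" where
  "qn k = sqrt (kn k)"

lemma qn_nonneg [simp]: "0 \<le> qn k"
  by (simp add: qn_def)

lemma qn_0 [simp]: "qn 0 = 0"
  by (simp add: qn_def)

lemma qn_ge_1: "k \<noteq> 0 \<Longrightarrow> 1 \<le> qn k"
  using kn_ge_1[of k] by (simp add: qn_def)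

lemma qn_pow2: "qn k ^ 2 = kn k"
  by (simp add: qn_def)

lemma qn_pow4: "qn k ^ 4 = ksq k"
  using kn_sq[of k] qn_pow2[of k] by (metis numeral_Bit0 power_add power2_eq_square)

text \<open>The decay order 5/2 exceeds the dimension 2: ring n contributes O(n^(-3/2)).\<close>

lemma sum_inverse_qn_bounded:
  obtains Z where "0 \<le> Z" "\<And>F. finite F \<Longrightarrow> (\<Sum>l\<in>F. 1 / qn l ^ 5) \<le> Z"
proof -
  define f where "f n = real n powr (-5/2)" for n :: nat
  have "summable (\<lambda>n. real n powr (-3/2))"
    by (simp add: summable_real_powr_iff)
  then have smm: "summable (\<lambda>n. 12 * real n powr (-3/2))"
    by (rule summable_mult)
  define Z where "Z = (\<Sum>n. 12 * real n powr (-3/2))"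
  have "(\<Sum>l\<in>F. 1 / qn l ^ 5) \<le> Z" if "finite F" for F
  proof -
    have "(\<Sum>l\<in>F. 1 / qn l ^ 5) = (\<Sum>l\<in>F - {0}. 1 / qn l ^ 5)"
      using that by (intro sum.mono_neutral_right) auto
    also have "\<dots> \<le> (\<Sum>l\<in>F - {0}. f (mx l))"
    proof (rule sum_mono)
      fix l assume "l \<in> F - {0}"
      then have l: "1 \<le> real (mx l)" "0 < kn l"
        using mx_pos[of l] kn_pos[of l] by auto
      have "qn l ^ 5 = kn l powr (5/2)"
        using l by (simp add: qn_def powr_half_sqrt[symmetric] powr_powr flip: powr_numeral)
      also have "\<dots> \<ge> real (mx l) powr (5/2)"
        using l mx_le_kn[of l] by (intro powr_mono2) auto
      finally have "1 / qn l ^ 5 \<le> 1 / real (mx l) powr (5/2)"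
        using l by (intro divide_left_mono) (auto simp: qn_def)
      also have "\<dots> = f (mx l)"
        using l by (simp add: f_def powr_minus_divide)
      finally show "1 / qn l ^ 5 \<le> f (mx l)" .
    qed
    also have "\<dots> \<le> (\<Sum>n=1..Max (insert 0 (mx ` F)). 12 * real n * f n)"
      by (rule sum_over_rings_le) (use that in \<open>auto simp: f_def\<close>)
    also have "\<dots> = (\<Sum>n=1..Max (insert 0 (mx ` F)). 12 * real n powr (-3/2))"
    proof (rule sum.cong)
      fix n :: nat assume "n \<in> {1..Max (insert 0 (mx ` F))}"
      then have "real n * real n powr (-5/2) = real n powr (1 + (-5/2))"
        by (subst powr_add) auto
      then show "12 * real n * f n = 12 * real n powr (-3/2)"
        by (simp add: f_def)
    qed auto
    also have "\<dots> \<le> Z"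
      unfolding Z_def by (intro sum_le_suminf smm) auto
    finally show ?thesis .
  qed
  moreover have "0 \<le> Z"
    unfolding Z_def by (intro suminf_nonneg smm) auto
  ultimately show thesis
    using that by blast
qed

section \<open>Convolutions on the lattice\<close>

lemma sum_shift_le:
  fixes h :: "int \<times> int \<Rightarrow> real"
  assumes "finite H" "\<And>F. finite F \<Longrightarrow> sum h F \<le> \<beta>"
  shows "(\<Sum>j\<in>H. h (k - j)) \<le> \<beta>"
proof -
  have "(\<Sum>j\<in>H. h (k - j)) = sum h ((\<lambda>j. k - j) ` H)"
    by (subst sum.reindex) (auto simp: inj_on_def)
  then show ?thesis
    using assms by simp
qed

text \<open>The endpoint case of the Ladyzhenskaya inequality. Only pairs in which the first index is the
  larger one occur, so Cauchy-Schwarz with the weight \<open>1 / kn (k - j)\<close> costs just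
  \<open>\<Sum>0 < |l| \<le> |j|. 1/|l|\<close>, which is of order \<open>|j|\<close>.\<close>

lemma sum_half_convolution_sq_le:
  fixes A B :: "int \<times> int \<Rightarrow> real"
  assumes fin: "finite F" "finite J" and B0: "B 0 = 0"
    and \<alpha>: "\<And>F. finite F \<Longrightarrow> (\<Sum>j\<in>F. kn j * (A j)\<^sup>2) \<le> \<alpha>"
    and \<beta>: "\<And>F. finite F \<Longrightarrow> (\<Sum>j\<in>F. kn j * (B j)\<^sup>2) \<le> \<beta>"
  shows "(\<Sum>k\<in>F. (\<Sum>j\<in>{j\<in>J. kn (k - j) \<le> kn j}. A j * B (k - j))\<^sup>2) \<le> 12 * \<alpha> * \<beta>"
proof -
  have \<beta>0: "0 \<le> \<beta>"
    using \<beta>[of "{}"] by simp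
  define H where "H k = {j\<in>J. kn (k - j) \<le> kn j \<and> k - j \<noteq> 0}" for k
  have finH: "finite (H k)" for k
    using fin by (simp add: H_def)
  have 1: "(\<Sum>j\<in>{j\<in>J. kn (k - j) \<le> kn j}. A j * B (k - j))\<^sup>2 \<le> (\<Sum>j\<in>H k. (A j)\<^sup>2 * (1 / kn (k - j))) * \<beta>" for k
  proof -
    have pos: "0 < kn (k - j)" if "j \<in> H k" for j
      using that by (auto simp: H_def intro: kn_pos)
    have "(\<Sum>j\<in>{j\<in>J. kn (k - j) \<le> kn j}. A j * B (k - j)) = (\<Sum>j\<in>H k. A j * B (k - j))"
      using fin B0 by (intro sum.mono_neutral_right) (auto simp: H_def)
    also have "\<dots> = (\<Sum>j\<in>H k. (A j / qn (k - j)) * (qn (k - j) * B (k - j)))"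
      by (intro sum.cong refl) (use pos in \<open>force simp: qn_def\<close>)
    also have "\<dots>\<^sup>2 \<le> (\<Sum>j\<in>H k. (A j / qn (k - j))\<^sup>2) * (\<Sum>j\<in>H k. (qn (k - j) * B (k - j))\<^sup>2)"
      by (rule Cauchy_Schwarz_ineq_sum)
    also have "\<dots> = (\<Sum>j\<in>H k. (A j)\<^sup>2 * (1 / kn (k - j))) * (\<Sum>j\<in>H k. kn (k - j) * (B (k - j))\<^sup>2)"
      by (simp add: power_mult_distrib power_divide qn_pow2)
    also have "\<dots> \<le> (\<Sum>j\<in>H k. (A j)\<^sup>2 * (1 / kn (k - j))) * \<beta>"
      by (intro mult_left_mono sum_shift_le[of "H k" "\<lambda>l. kn l * (B l)\<^sup>2"] \<beta> finH sum_nonneg) auto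
    finally show ?thesis .
  qed
  have "(\<Sum>k\<in>F. \<Sum>j\<in>H k. (A j)\<^sup>2 * (1 / kn (k - j)))
      = (\<Sum>k\<in>F. \<Sum>j\<in>J. if kn (k - j) \<le> kn j \<and> k - j \<noteq> 0 then (A j)\<^sup>2 * (1 / kn (k - j)) else 0)"
    unfolding H_def by (rule sum.cong[OF refl], rule sum.inter_filter[OF fin(2)])
  also have "\<dots> = (\<Sum>j\<in>J. \<Sum>k\<in>F. if kn (k - j) \<le> kn j \<and> k - j \<noteq> 0 then (A j)\<^sup>2 * (1 / kn (k - j)) else 0)"
    by (rule sum.swap)
  also have "\<dots> \<le> (\<Sum>j\<in>J. (A j)\<^sup>2 * (12 * kn j))"
  proof (rule sum_mono)
    fix j
    let ?G = "{k\<in>F. kn (k - j) \<le> kn j \<and> k - j \<noteq> 0}"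
    have "(\<Sum>k\<in>F. if kn (k - j) \<le> kn j \<and> k - j \<noteq> 0 then (A j)\<^sup>2 * (1 / kn (k - j)) else 0)
        = (A j)\<^sup>2 * (\<Sum>k\<in>?G. 1 / kn (k - j))"
      using fin by (simp add: sum.inter_filter[symmetric] sum_distrib_left)
    also have "(\<Sum>k\<in>?G. 1 / kn (k - j)) = (\<Sum>l\<in>(\<lambda>k. k - j) ` ?G. 1 / kn l)"
      by (subst sum.reindex) (auto simp: inj_on_def)
    also have "(\<lambda>k. k - j) ` ?G = {l\<in>(\<lambda>k. k - j) ` F. l \<noteq> 0 \<and> kn l \<le> kn j}"
      by auto
    also have "(\<Sum>l\<in>{l\<in>(\<lambda>k. k - j) ` F. l \<noteq> 0 \<and> kn l \<le> kn j}. 1 / kn l) \<le> 12 * kn j"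
      using fin by (intro sum_inverse_kn_le) auto
    finally show "(\<Sum>k\<in>F. if kn (k - j) \<le> kn j \<and> k - j \<noteq> 0 then (A j)\<^sup>2 * (1 / kn (k - j)) else 0)
        \<le> (A j)\<^sup>2 * (12 * kn j)"
      by (simp add: mult_left_mono)
  qed
  also have "\<dots> = 12 * (\<Sum>j\<in>J. kn j * (A j)\<^sup>2)"
    by (simp add: sum_distrib_left mult_ac)
  also have "\<dots> \<le> 12 * \<alpha>"
    using \<alpha> fin by simp
  finally have 2: "(\<Sum>k\<in>F. \<Sum>j\<in>H k. (A j)\<^sup>2 * (1 / kn (k - j))) \<le> 12 * \<alpha>" .
  have "(\<Sum>k\<in>F. (\<Sum>j\<in>{j\<in>J. kn (k - j) \<le> kn j}. A j * B (k - j))\<^sup>2)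
      \<le> (\<Sum>k\<in>F. (\<Sum>j\<in>H k. (A j)\<^sup>2 * (1 / kn (k - j))) * \<beta>)"
    using 1 by (rule sum_mono)
  also have "\<dots> = (\<Sum>k\<in>F. \<Sum>j\<in>H k. (A j)\<^sup>2 * (1 / kn (k - j))) * \<beta>"
    by (rule sum_distrib_right[symmetric])
  also have "\<dots> \<le> 12 * \<alpha> * \<beta>"
    using 2 \<beta>0 by (rule mult_right_mono)
  finally show ?thesis .
qed

section \<open>Self-convolutions: mean-square, pointwise and decay estimates\<close>

definition conv :: "(int \<times> int \<Rightarrow> real) \<Rightarrow> int \<times> int \<Rightarrow> real" where
  "conv a k = infsum (\<lambda>j. a j * a (k - j)) UNIV"

text \<open>Both factors of a convolution are treated alike, so it suffices to sum over the
  half of the indices where the first factor carries the larger frequency.\<close>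

lemma sum_convolution_le_half:
  fixes a :: "int \<times> int \<Rightarrow> real"
  assumes "\<And>k. 0 \<le> a k" "finite J" "J \<union> (\<lambda>j. k - j) ` J \<subseteq> J'" "finite J'"
  shows "(\<Sum>j\<in>J. a j * a (k - j)) \<le> 2 * (\<Sum>j\<in>{j\<in>J'. kn (k - j) \<le> kn j}. a j * a (k - j))"
proof -
  have nn: "0 \<le> a j * a (k - j)" for j
    using assms(1) by simp
  have "(\<Sum>j\<in>J. a j * a (k - j)) \<le> (\<Sum>j\<in>{j\<in>J. kn (k - j) \<le> kn j} \<union> {j\<in>J. kn j \<le> kn (k - j)}. a j * a (k - j))"
    using assms(2) nn by (intro sum_mono2) auto
  also have "\<dots> \<le> (\<Sum>j\<in>{j\<in>J. kn (k - j) \<le> kn j}. a j * a (k - j)) + (\<Sum>j\<in>{j\<in>J. kn j \<le> kn (k - j)}. a j * a (k - j))"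
    using assms(2) nn by (subst sum_Un) (auto intro: sum_nonneg)
  also have "(\<Sum>j\<in>{j\<in>J. kn j \<le> kn (k - j)}. a j * a (k - j))
      = (\<Sum>j\<in>(\<lambda>j. k - j) ` {j\<in>J. kn j \<le> kn (k - j)}. a j * a (k - j))"
    by (subst sum.reindex) (auto simp: inj_on_def mult.commute)
  also have "\<dots> \<le> (\<Sum>j\<in>{j\<in>J'. kn (k - j) \<le> kn j}. a j * a (k - j))"
    using assms(3,4) nn by (intro sum_mono2) auto
  also have "(\<Sum>j\<in>{j\<in>J. kn (k - j) \<le> kn j}. a j * a (k - j)) \<le> (\<Sum>j\<in>{j\<in>J'. kn (k - j) \<le> kn j}. a j * a (k - j))"
    using assms(3,4) nn by (intro sum_mono2) auto
  finally show ?thesis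
    by simp
qed

lemma infsum_le_finite:
  fixes f :: "'a \<Rightarrow> real"
  assumes "\<And>x. 0 \<le> f x" "\<And>F. finite F \<Longrightarrow> sum f F \<le> C"
  shows "f summable_on UNIV" "infsum f UNIV \<le> C"
proof -
  show "f summable_on UNIV"
    using assms by (intro nonneg_bdd_above_summable_on) (auto simp: bdd_above_def)
  then show "infsum f UNIV \<le> C"
    using assms(2) by (intro infsum_le_finite_sums) auto
qed

lemma finite_sum_le_infsum_UNIV:
  fixes f :: "'a \<Rightarrow> real"
  assumes "f summable_on UNIV" "\<And>x. 0 \<le> f x" "finite F"
  shows "sum f F \<le> infsum f UNIV"
  using assms by (intro finite_sum_le_infsum) auto

lemma Cauchy_Schwarz_sqrt_sum:
  fixes f g :: "'a \<Rightarrow> real"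
  assumes "(\<Sum>i\<in>F. (f i)\<^sup>2) \<le> P" "(\<Sum>i\<in>F. (g i)\<^sup>2) \<le> Q"
  shows "(\<Sum>i\<in>F. f i * g i) \<le> sqrt P * sqrt Q"
proof -
  have "(\<Sum>i\<in>F. f i * g i)\<^sup>2 \<le> (\<Sum>i\<in>F. (f i)\<^sup>2) * (\<Sum>i\<in>F. (g i)\<^sup>2)"
    by (rule Cauchy_Schwarz_ineq_sum)
  also have "\<dots> \<le> P * Q"
    using assms by (intro mult_mono sum_nonneg) (auto intro: order_trans[OF sum_nonneg assms(1)])
  finally show ?thesis
    by (metis real_le_rsqrt real_sqrt_mult)
qed

lemma summable_conv:
  fixes a :: "int \<times> int \<Rightarrow> real"
  assumes "(\<lambda>k. (a k)\<^sup>2) summable_on UNIV" "\<And>k. 0 \<le> a k"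
  shows "(\<lambda>j. a j * a (k - j)) summable_on UNIV"
proof (rule infsum_le_finite(1))
  fix F :: "(int \<times> int) set" assume F: "finite F"
  show "(\<Sum>j\<in>F. a j * a (k - j)) \<le> sqrt (infsum (\<lambda>k. (a k)\<^sup>2) UNIV) * sqrt (infsum (\<lambda>k. (a k)\<^sup>2) UNIV)"
    by (intro Cauchy_Schwarz_sqrt_sum finite_sum_le_infsum_UNIV assms(1) F
        sum_shift_le[of F "\<lambda>k. (a k)\<^sup>2"]) auto
qed (use assms in auto)

lemma conv_le:
  assumes "\<And>k. 0 \<le> a k" "\<And>F. finite F \<Longrightarrow> (\<Sum>j\<in>F. a j * a (k - j)) \<le> C"
  shows "conv a k \<le> C"
  unfolding conv_def using assms by (intro infsum_le_finite) auto

lemma kn_le_twice: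
  assumes "kn (k - j) \<le> kn j"
  shows "kn k \<le> 2 * kn j"
  using kn_triangle[of "k - j" j] assms by simp

text \<open>A weight that at most doubles when the frequency does can be moved from the output onto
  the larger input frequency. The factor 192 is 12 from the half convolution times 16 = (2 * 2)^2,
  one 2 from symmetrising and one from moving the weight.\<close>

lemma sum_weighted_conv_sq_le:
  fixes a w :: "int \<times> int \<Rightarrow> real"
  assumes a: "(\<lambda>k. (a k)\<^sup>2) summable_on UNIV" "\<And>k. 0 \<le> a k" "a 0 = 0"
    and w: "\<And>k. 0 \<le> w k" "\<And>j k. kn k \<le> 2 * kn j \<Longrightarrow> w k \<le> 2 * w j"
    and \<alpha>: "\<And>F. finite F \<Longrightarrow> (\<Sum>j\<in>F. kn j * (w j * a j)\<^sup>2) \<le> \<alpha>"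
    and \<beta>: "\<And>F. finite F \<Longrightarrow> (\<Sum>j\<in>F. kn j * (a j)\<^sup>2) \<le> \<beta>"
    and F: "finite F"
  shows "(\<Sum>k\<in>F. (w k * conv a k)\<^sup>2) \<le> 192 * \<alpha> * \<beta>"
proof -
  have fs: "(\<Sum>k\<in>F. (w k * (\<Sum>j\<in>J. a j * a (k - j)))\<^sup>2) \<le> 192 * \<alpha> * \<beta>" if J: "finite J" for J
  proof -
    \<comment> \<open>A single finite set containing the reflections of \<open>J\<close> for all
      \<open>k\<close> in \<open>F\<close> at once, since the half-convolution estimate sums over
      \<open>k\<close> with a fixed index set.\<close>
    define J' where "J' = J \<union> (\<Union>k\<in>F. (\<lambda>j. k - j) ` J)"
    have J': "finite J'"
      using F J by (simp add: J'_def)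
    have "(w k * (\<Sum>j\<in>J. a j * a (k - j)))\<^sup>2
        \<le> 16 * (\<Sum>j\<in>{j\<in>J'. kn (k - j) \<le> kn j}. (w j * a j) * a (k - j))\<^sup>2" if k: "k \<in> F" for k
    proof -
      have "w k * (\<Sum>j\<in>J. a j * a (k - j)) \<le> w k * (2 * (\<Sum>j\<in>{j\<in>J'. kn (k - j) \<le> kn j}. a j * a (k - j)))"
        using k by (intro mult_left_mono w(1) sum_convolution_le_half a(2) J J') (auto simp: J'_def)
      also have "\<dots> = 2 * (\<Sum>j\<in>{j\<in>J'. kn (k - j) \<le> kn j}. w k * a j * a (k - j))"
        by (simp add: sum_distrib_left mult_ac)
      also have "\<dots> \<le> 2 * (\<Sum>j\<in>{j\<in>J'. kn (k - j) \<le> kn j}. 2 * w j * a j * a (k - j))"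
        by (intro mult_left_mono sum_mono mult_right_mono w(2) a(2) kn_le_twice) auto
      also have "\<dots> = 4 * (\<Sum>j\<in>{j\<in>J'. kn (k - j) \<le> kn j}. (w j * a j) * a (k - j))"
        by (simp add: sum_distrib_left mult_ac)
      finally have "(w k * (\<Sum>j\<in>J. a j * a (k - j)))\<^sup>2
          \<le> (4 * (\<Sum>j\<in>{j\<in>J'. kn (k - j) \<le> kn j}. (w j * a j) * a (k - j)))\<^sup>2"
        by (intro power_mono mult_nonneg_nonneg w(1) sum_nonneg a(2)) auto
      then show ?thesis
        by (simp add: power_mult_distrib)
    qed
    then have "(\<Sum>k\<in>F. (w k * (\<Sum>j\<in>J. a j * a (k - j)))\<^sup>2)
        \<le> (\<Sum>k\<in>F. 16 * (\<Sum>j\<in>{j\<in>J'. kn (k - j) \<le> kn j}. (w j * a j) * a (k - j))\<^sup>2)"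
      by (rule sum_mono)
    also have "\<dots> \<le> 16 * (12 * \<alpha> * \<beta>)"
      unfolding sum_distrib_left[symmetric]
      by (intro mult_left_mono sum_half_convolution_sq_le F J' \<alpha> \<beta> a(3)) auto
    finally show ?thesis by simp
  qed
  have "((\<lambda>J. \<Sum>k\<in>F. (w k * (\<Sum>j\<in>J. a j * a (k - j)))\<^sup>2) \<longlongrightarrow> (\<Sum>k\<in>F. (w k * conv a k)\<^sup>2))
      (finite_subsets_at_top UNIV)"
    unfolding conv_def
    by (intro tendsto_intros infsum_tendsto summable_conv a)
  then show ?thesis
  proof (rule tendsto_upperbound)
    show "\<forall>\<^sub>F J in finite_subsets_at_top UNIV. (\<Sum>k\<in>F. (w k * (\<Sum>j\<in>J. a j * a (k - j)))\<^sup>2) \<le> 192 * \<alpha> * \<beta>"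
      using fs by (intro eventually_finite_subsets_at_top_weakI) auto
  qed simp
qed

text \<open>The derivative falls on the larger frequency and Cauchy-Schwarz does the rest. Hence
  each coefficient of the nonlinear term is controlled by the norms of V and H.\<close>

lemma kn_conv_le:
  assumes a: "\<And>k. 0 \<le> a k"
    and e: "\<And>F. finite F \<Longrightarrow> (\<Sum>j\<in>F. (a j)\<^sup>2) \<le> e"
    and y: "\<And>F. finite F \<Longrightarrow> (\<Sum>j\<in>F. (kn j * a j)\<^sup>2) \<le> y"
  shows "kn k * conv a k \<le> 4 * sqrt y * sqrt e"
proof (cases "k = 0")
  case True
  then show ?thesis
    using e[of "{}"] y[of "{}"] by simp
next
  case False
  then have k: "0 < kn k" by (rule kn_pos)
  have "(\<Sum>j\<in>J. a j * a (k - j)) \<le> 4 * sqrt y * sqrt e / kn k" if J: "finite J" for J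
  proof -
    define J' where "J' = J \<union> (\<lambda>j. k - j) ` J"
    have J': "finite J'"
      using J by (simp add: J'_def)
    have "kn k * (\<Sum>j\<in>J. a j * a (k - j)) \<le> kn k * (2 * (\<Sum>j\<in>{j\<in>J'. kn (k - j) \<le> kn j}. a j * a (k - j)))"
      by (intro mult_left_mono sum_convolution_le_half a J J') (auto simp: J'_def)
    also have "\<dots> = 2 * (\<Sum>j\<in>{j\<in>J'. kn (k - j) \<le> kn j}. kn k * a j * a (k - j))"
      by (simp add: sum_distrib_left mult_ac)
    also have "\<dots> \<le> 2 * (\<Sum>j\<in>{j\<in>J'. kn (k - j) \<le> kn j}. 2 * kn j * a j * a (k - j))"
      by (intro mult_left_mono sum_mono mult_right_mono a kn_le_twice) auto
    also have "\<dots> = 4 * (\<Sum>j\<in>{j\<in>J'. kn (k - j) \<le> kn j}. (kn j * a j) * a (k - j))"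
      by (simp add: sum_distrib_left mult_ac)
    also have "\<dots> \<le> 4 * (sqrt y * sqrt e)"
      using J' by (intro mult_left_mono Cauchy_Schwarz_sqrt_sum y
          sum_shift_le[of _ "\<lambda>k. (a k)\<^sup>2"] e) auto
    finally show ?thesis
      using k by (simp add: field_simps)
  qed
  then have "conv a k \<le> 4 * sqrt y * sqrt e / kn k"
    using a by (intro conv_le)
  then show ?thesis
    using k by (simp add: field_simps)
qed

text \<open>Of the \<open>p\<close> half-orders of the larger index, one is handed to the smaller
  index. That index then decays with exponent 5 in \<open>qn\<close>, which is summable over the
  lattice, and \<open>p - 1\<close> remain for the output. \<open>Z\<close> depends on the lattice
  alone.\<close>

lemma conv_decay:
  "\<exists>Z. \<forall>a p A k. (\<forall>k. 0 \<le> a k) \<longrightarrow> a 0 = 0 \<longrightarrow> 4 \<le> p \<longrightarrow> (\<forall>k. qn k ^ p * a k \<le> A)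
      \<longrightarrow> qn k ^ (p - 1) * conv a k \<le> Z * 2 ^ p * A\<^sup>2"
proof -
  obtain Z where Z: "0 \<le> Z" "\<And>F. finite F \<Longrightarrow> (\<Sum>l\<in>F. 1 / qn l ^ 5) \<le> Z"
    by (rule sum_inverse_qn_bounded) blast
  have main: "qn k ^ (p - 1) * conv a k \<le> Z * 2 ^ p * A\<^sup>2"
    if a: "\<And>k. 0 \<le> a k" "a 0 = 0" and p: "4 \<le> p" and A: "\<And>k. qn k ^ p * a k \<le> A"
    for a :: "int \<times> int \<Rightarrow> real" and p A k
  proof (cases "k = 0")
    case True
    then show ?thesis
      using p Z(1) by (simp add: power_0_left)
  next
    case False
    then have k: "0 < qn k ^ (p - 1)"
      using qn_ge_1[of k] by (intro zero_less_power) linarith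
    have tm: "qn k ^ (p - 1) * (a j * a (k - j)) \<le> 2 ^ (p - 1) * A\<^sup>2 * (1 / qn (k - j) ^ 5)"
      if jk: "kn (k - j) \<le> kn j" for j
    proof (cases "j = 0 \<or> k - j = 0")
      case True
      then show ?thesis
        using a(2) by (auto simp: power2_eq_square)
    next
      case False
      define q r where "q = qn j" and "r = qn (k - j)"
      have qr: "1 \<le> q" "1 \<le> r" "r \<le> q"
        using False qn_ge_1 jk by (auto simp: q_def r_def qn_def)
      have "qn k \<le> 2 * q"
      proof -
        have "kn k \<le> 4 * kn j"
          using kn_le_twice[OF jk] kn_nonneg[of j] by linarith
        then show ?thesis
          unfolding q_def qn_def by (intro real_le_lsqrt) (simp_all add: power_mult_distrib)
      qed
      then have "qn k ^ (p - 1) \<le> (2 * q) ^ (p - 1)"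
        by (intro power_mono) auto
      also have "\<dots> = 2 ^ (p - 1) * q ^ (p - 1)"
        by (rule power_mult_distrib)
      finally have 1: "qn k ^ (p - 1) \<le> 2 ^ (p - 1) * q ^ (p - 1)" .
      have A0: "0 \<le> A"
        using A[of 0] p a(2) by simp
      have "q ^ (p - 1) * a j * r \<le> q ^ (p - 1) * a j * q"
        using qr a by (intro mult_left_mono) auto
      also have "\<dots> = q ^ p * a j"
        using p by (cases p) auto
      also have "\<dots> \<le> A"
        using A by (simp add: q_def)
      finally have 2: "q ^ (p - 1) * a j * r \<le> A" .
      have "r ^ 4 * a (k - j) \<le> r ^ p * a (k - j)"
        using qr p a by (intro mult_right_mono power_increasing) auto
      also have "\<dots> \<le> A"
        using A by (simp add: r_def)
      finally have 3: "r ^ 4 * a (k - j) \<le> A" .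
      have "(q ^ (p - 1) * a j * r) * (r ^ 4 * a (k - j)) \<le> A * A"
        using 2 3 A0 qr a by (intro mult_mono) auto
      then have "q ^ (p - 1) * (a j * a (k - j)) * r ^ 5 \<le> A\<^sup>2"
        by (simp add: power2_eq_square eval_nat_numeral mult_ac)
      then have 4: "q ^ (p - 1) * (a j * a (k - j)) \<le> A\<^sup>2 * (1 / r ^ 5)"
        using qr by (simp add: field_simps)
      have "qn k ^ (p - 1) * (a j * a (k - j)) \<le> 2 ^ (p - 1) * q ^ (p - 1) * (a j * a (k - j))"
        using 1 a by (intro mult_right_mono) auto
      also have "\<dots> \<le> 2 ^ (p - 1) * (A\<^sup>2 * (1 / r ^ 5))"
        unfolding mult.assoc using 4 by (intro mult_left_mono) (auto simp: mult_ac)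
      finally show ?thesis
        by (simp add: r_def)
    qed
    have "(\<Sum>j\<in>J. a j * a (k - j)) \<le> Z * 2 ^ p * A\<^sup>2 / qn k ^ (p - 1)" if J: "finite J" for J
    proof -
      define J' where "J' = J \<union> (\<lambda>j. k - j) ` J"
      have J': "finite J'"
        using J by (simp add: J'_def)
      have "qn k ^ (p - 1) * (\<Sum>j\<in>J. a j * a (k - j))
          \<le> qn k ^ (p - 1) * (2 * (\<Sum>j\<in>{j\<in>J'. kn (k - j) \<le> kn j}. a j * a (k - j)))"
        by (intro mult_left_mono sum_convolution_le_half a J J') (auto simp: J'_def)
      also have "\<dots> = 2 * (\<Sum>j\<in>{j\<in>J'. kn (k - j) \<le> kn j}. qn k ^ (p - 1) * (a j * a (k - j)))"
        by (simp add: sum_distrib_left mult_ac)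
      also have "\<dots> \<le> 2 * (\<Sum>j\<in>{j\<in>J'. kn (k - j) \<le> kn j}. 2 ^ (p - 1) * A\<^sup>2 * (1 / qn (k - j) ^ 5))"
        by (intro mult_left_mono sum_mono tm) auto
      also have "\<dots> = 2 * (2 ^ (p - 1) * A\<^sup>2 * (\<Sum>j\<in>{j\<in>J'. kn (k - j) \<le> kn j}. 1 / qn (k - j) ^ 5))"
        by (simp add: sum_distrib_left)
      also have "\<dots> \<le> 2 * (2 ^ (p - 1) * A\<^sup>2 * Z)"
        using J' by (intro mult_left_mono sum_shift_le[of _ "\<lambda>l. 1 / qn l ^ 5"] Z) auto
      also have "\<dots> = Z * 2 ^ p * A\<^sup>2"
        using p by (cases p) auto
      finally show ?thesis
        using k by (simp add: field_simps)
    qed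
    then have "conv a k \<le> Z * 2 ^ p * A\<^sup>2 / qn k ^ (p - 1)"
      using a(1) by (intro conv_le)
    then show ?thesis
      using k by (simp add: field_simps)
  qed
  then show ?thesis
    by (intro exI[of _ Z] allI impI) (rule main, blast+)
qed

section \<open>The nonlinear term\<close>

lemma norm_smult_vec: "norm (c *s v) = cmod c * norm (v :: complex ^ 2)"
proof -
  have "c *s v = (\<chi> i. c * v $ i)"
    by (simp add: vec_eq_iff)
  then show ?thesis
    by (simp add: norm_vec_def L2_set_def sum_2 norm_mult power_mult_distrib real_sqrt_mult
        flip: distrib_left)
qed

lemma norm_kvec: "norm (kvec k) = kn k"
  by (simp add: norm_vec_def L2_set_def sum_2 kvec_def kn_def ksq_def)

lemma norm_dotc_le: "cmod (dotc v w) \<le> norm v * norm w"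
proof -
  have "cmod (dotc v w) \<le> (\<Sum>i\<in>UNIV. \<bar>norm (v $ i)\<bar> * \<bar>norm (w $ i)\<bar>)"
    by (simp add: dotc_def sum_2 norm_triangle_le norm_mult)
  also have "\<dots> \<le> norm v * norm w"
    unfolding norm_vec_def by (rule L2_set_mult_ineq)
  finally show ?thesis .
qed

lemma dotc_commute: "dotc v w = dotc w v"
  by (simp add: dotc_def mult.commute)

lemma dotc_kvec_diff: "dotc v (kvec (k - j)) = dotc v (kvec k) - dotc v (kvec j)"
  by (simp add: dotc_def kvec_def algebra_simps)

lemma inner_vec2: "(v :: complex ^ 2) \<bullet> w = Re (v $ 1 * cnj (w $ 1) + v $ 2 * cnj (w $ 2))"
  by (simp add: inner_vec_def sum_2 inner_complex_def)

text \<open>The projection is orthogonal, so 1 would be sharp; the triangle inequality gives 2,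
  which only enters constants.\<close>

lemma norm_leray_le: "norm (leray k w) \<le> 2 * norm w"
proof (cases "k = 0")
  case True
  then show ?thesis by (simp add: leray_def zero_prod_def)
next
  case False
  then have k: "0 < kn k" by (rule kn_pos)
  have "norm ((dotc (kvec k) w / of_real (ksq k)) *s kvec k) = cmod (dotc (kvec k) w) / ksq k * kn k"
    by (simp add: norm_smult_vec norm_kvec norm_divide)
  also have "\<dots> = cmod (dotc (kvec k) w) / kn k"
    using k by (simp add: kn_sq[symmetric] power2_eq_square)
  also have "\<dots> \<le> norm w"
    using k norm_dotc_le[of "kvec k" w] by (simp add: norm_kvec field_simps)
  finally show ?thesis
    using False norm_triangle_ineq4[of w "(dotc (kvec k) w / of_real (ksq k)) *s kvec k"]
    by (simp add: leray_def zero_prod_def)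
qed

text \<open>As \<open>kvec k\<close> is real, the bilinear condition on \<open>v\<close> is also
  real orthogonality to all complex multiples of \<open>kvec k\<close>, and \<open>leray\<close>
  subtracts such a multiple.\<close>

lemma inner_leray:
  assumes "dotc (kvec k) v = 0" "k \<noteq> 0"
  shows "v \<bullet> leray k w = v \<bullet> w"
proof -
  define \<alpha> where "\<alpha> = dotc (kvec k) w / of_real (ksq k)"
  have "v \<bullet> (\<alpha> *s kvec k) = Re (cnj \<alpha> * dotc (kvec k) v)"
    by (simp add: inner_vec2 dotc_def kvec_def algebra_simps)
  then show ?thesis
    using assms by (simp add: leray_def \<alpha>_def zero_prod_def inner_diff_right)
qed

lemma in_H_0: "in_H c \<Longrightarrow> c 0 = 0"
  by (simp add: in_H_def zero_prod_def)

lemma in_H_divfree: "in_H c \<Longrightarrow> dotc (kvec k) (c k) = 0"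
  unfolding in_H_def by blast

lemma in_H_uminus: "in_H c \<Longrightarrow> c (- k) = (\<chi> i. cnj (c k $ i))"
  by (cases k) (auto simp: in_H_def)

lemma in_H_summable: "in_H c \<Longrightarrow> (\<lambda>k. (norm (c k))\<^sup>2) summable_on UNIV"
  by (simp add: in_H_def)

text \<open>The divergence form of the advection: \<open>c j\<close> is paired with the output
  frequency \<open>k\<close>, not with \<open>k - j\<close> as in \<open>nonlin\<close>.\<close>

definition advection_term :: "real \<Rightarrow> (int \<times> int \<Rightarrow> complex ^ 2) \<Rightarrow> int \<times> int \<Rightarrow> int \<times> int \<Rightarrow> complex ^ 2" where
  "advection_term L c k j = (\<i> * of_real (2 * pi / L) * dotc (c j) (kvec k)) *s c (k - j)"

text \<open>Incompressibility puts the derivative on the output frequency.\<close>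

lemma nonlin_eq:
  assumes "in_H c"
  shows "nonlin L c c k = leray k (infsum (advection_term L c k) UNIV)"
proof -
  have "dotc (c j) (kvec (k - j)) = dotc (c j) (kvec k)" for j
    using in_H_divfree[OF assms, of j] by (simp add: dotc_kvec_diff dotc_commute)
  moreover have "(fst k - fst j, snd k - snd j) = k - j" for j :: "int \<times> int"
    by (simp add: prod_eq_iff)
  ultimately show ?thesis
    by (simp add: nonlin_def advection_term_def[abs_def])
qed

lemma norm_advection_term_le:
  assumes "L > 0"
  shows "norm (advection_term L c k j) \<le> (2 * pi / L) * kn k * (norm (c j) * norm (c (k - j)))"
proof -
  have "norm (advection_term L c k j) = (2 * pi / L) * cmod (dotc (c j) (kvec k)) * norm (c (k - j))"
    using assms by (simp add: advection_term_def norm_smult_vec norm_mult norm_divide)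
  also have "\<dots> \<le> (2 * pi / L) * (norm (c j) * kn k) * norm (c (k - j))"
    using assms norm_dotc_le[of "c j" "kvec k"]
    by (intro mult_right_mono mult_left_mono) (auto simp: norm_kvec)
  finally show ?thesis
    by (simp add: mult_ac)
qed

lemma abs_summable_advection_term:
  assumes "L > 0" "in_H c"
  shows "(\<lambda>j. norm (advection_term L c k j)) summable_on UNIV"
proof (rule summable_on_comparison_test)
  show "(\<lambda>j. (2 * pi / L) * kn k * (norm (c j) * norm (c (k - j)))) summable_on UNIV"
    by (intro summable_on_cmult_right summable_conv[of "\<lambda>k. norm (c k)"] in_H_summable assms) auto
qed (use norm_advection_term_le[OF assms(1)] in auto)

lemma norm_nonlin_le:
  assumes "L > 0" "in_H c"
  shows "norm (nonlin L c c k) \<le> (4 * pi / L) * (kn k * conv (\<lambda>k. norm (c k)) k)"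
proof -
  note abs = abs_summable_advection_term[OF assms, of k]
  have "norm (nonlin L c c k) \<le> 2 * norm (infsum (advection_term L c k) UNIV)"
    by (simp add: nonlin_eq[OF assms(2)] norm_leray_le)
  also have "norm (infsum (advection_term L c k) UNIV) \<le> infsum (\<lambda>j. norm (advection_term L c k j)) UNIV"
    by (rule norm_infsum_bound[OF abs])
  also have "\<dots> \<le> infsum (\<lambda>j. (2 * pi / L) * kn k * (norm (c j) * norm (c (k - j)))) UNIV"
    by (intro infsum_mono abs summable_on_cmult_right summable_conv[of "\<lambda>k. norm (c k)"] in_H_summable
        assms norm_advection_term_le) auto
  also have "\<dots> = (2 * pi / L) * kn k * conv (\<lambda>k. norm (c k)) k"
    unfolding conv_def by (rule infsum_cmult_right')
  finally show ?thesis
    by (simp add: mult_ac)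
qed

text \<open>The convolution estimate asks for half a derivative on each factor, and Cauchy-Schwarz
  interpolates it between \<open>E\<close> and \<open>D\<close> and between \<open>e\<close> and
  \<open>y\<close>. The total power of the dissipation \<open>D\<close> is 3/4, so viscosity can
  absorb the result.\<close>

lemma sum_weighted_nonlin_le:
  fixes w :: "int \<times> int \<Rightarrow> real"
  assumes L: "L > 0" and c: "in_H c"
    and w: "\<And>k. 0 \<le> w k" "\<And>j k. kn k \<le> 2 * kn j \<Longrightarrow> w k \<le> 2 * w j"
    and E: "\<And>F. finite F \<Longrightarrow> (\<Sum>k\<in>F. (w k * norm (c k))\<^sup>2) \<le> E"
    and D: "\<And>F. finite F \<Longrightarrow> (\<Sum>k\<in>F. (kn k * (w k * norm (c k)))\<^sup>2) \<le> D"
    and e: "\<And>F. finite F \<Longrightarrow> (\<Sum>k\<in>F. (norm (c k))\<^sup>2) \<le> e"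
    and y: "\<And>F. finite F \<Longrightarrow> (\<Sum>k\<in>F. (kn k * norm (c k))\<^sup>2) \<le> y"
    and F: "finite F"
  shows "(\<Sum>k\<in>F. (w k)\<^sup>2 * (norm (c k) * norm (nonlin L c c k)))
    \<le> (4 * pi / L) * (sqrt D * sqrt (192 * (sqrt E * sqrt D) * (sqrt e * sqrt y)))"
proof -
  let ?a = "\<lambda>k. norm (c k)"
  have 1: "(\<Sum>k\<in>G. kn k * (w k * ?a k)\<^sup>2) \<le> sqrt E * sqrt D" if "finite G" for G
    using Cauchy_Schwarz_sqrt_sum[OF E[OF that] D[OF that]] by (simp add: power2_eq_square mult_ac)
  have 2: "(\<Sum>k\<in>G. kn k * (?a k)\<^sup>2) \<le> sqrt e * sqrt y" if "finite G" for G
    using Cauchy_Schwarz_sqrt_sum[OF e[OF that] y[OF that]] by (simp add: power2_eq_square mult_ac)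
  have 3: "(\<Sum>k\<in>F. (w k * conv ?a k)\<^sup>2) \<le> 192 * (sqrt E * sqrt D) * (sqrt e * sqrt y)"
    by (intro sum_weighted_conv_sq_le 1 2 in_H_summable c w F) (auto simp: in_H_0[OF c])
  have "(\<Sum>k\<in>F. (w k)\<^sup>2 * (?a k * norm (nonlin L c c k)))
      \<le> (\<Sum>k\<in>F. (w k)\<^sup>2 * (?a k * ((4 * pi / L) * (kn k * conv ?a k))))"
    by (intro sum_mono mult_left_mono norm_nonlin_le L c) auto
  also have "\<dots> = (4 * pi / L) * (\<Sum>k\<in>F. (kn k * (w k * ?a k)) * (w k * conv ?a k))"
    by (simp add: sum_distrib_left power2_eq_square mult_ac)
  also have "\<dots> \<le> (4 * pi / L) * (sqrt D * sqrt (192 * (sqrt E * sqrt D) * (sqrt e * sqrt y)))"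
    using L by (intro mult_left_mono Cauchy_Schwarz_sqrt_sum D F 3) auto
  finally show ?thesis .
qed

text \<open>For unit weight the bound is linear in the enstrophy. This makes \<open>ens\<close>,
  once integrable, a majorant in time for the energy balances.\<close>

lemma sum_nonlin_le:
  assumes L: "L > 0" and c: "in_H c"
    and e: "\<And>F. finite F \<Longrightarrow> (\<Sum>k\<in>F. (norm (c k))\<^sup>2) \<le> e"
    and y: "\<And>F. finite F \<Longrightarrow> (\<Sum>k\<in>F. (kn k * norm (c k))\<^sup>2) \<le> y"
    and F: "finite F"
  shows "(\<Sum>k\<in>F. norm (c k) * norm (nonlin L c c k)) \<le> (4 * pi / L) * (sqrt (192 * e) * y)"
proof -
  have nn: "0 \<le> e" "0 \<le> y"
    using e[of "{}"] y[of "{}"] by auto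
  have "sqrt y * sqrt (192 * (sqrt e * sqrt y) * (sqrt e * sqrt y)) = sqrt (192 * e) * (sqrt y * sqrt y)"
    using nn by (simp add: real_sqrt_mult mult_ac)
  then have "sqrt y * sqrt (192 * (sqrt e * sqrt y) * (sqrt e * sqrt y)) = sqrt (192 * e) * y"
    using nn by simp
  then show ?thesis
    using sum_weighted_nonlin_le[of L c "\<lambda>_. 1" e y e y F] assms by simp
qed

text \<open>The involution \<open>(k, j) \<mapsto> (j - k, j)\<close> exchanges the two arguments other than the
  advecting field and reverses the sign of each term of the trilinear form.\<close>

lemma infsum_inner_nonlin_eq_0:
  assumes L: "L > 0" and c: "in_H c"
    and y: "\<And>F. finite F \<Longrightarrow> (\<Sum>k\<in>F. (kn k * norm (c k))\<^sup>2) \<le> y"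
  shows "infsum (\<lambda>k. c k \<bullet> nonlin L c c k) UNIV = 0"
proof -
  define \<tau> where "\<tau> = (\<lambda>(k, j). c k \<bullet> advection_term L c k j)"
  let ?a = "\<lambda>k. norm (c k)"
  define e where "e = infsum (\<lambda>k. (?a k)\<^sup>2) UNIV"
  have e: "(\<Sum>k\<in>F. (?a k)\<^sup>2) \<le> e" if "finite F" for F
    unfolding e_def using that by (intro finite_sum_le_infsum_UNIV in_H_summable c) auto
  have 2: "(\<Sum>k\<in>G. kn k * (?a k)\<^sup>2) \<le> sqrt e * sqrt y" if "finite G" for G
    using Cauchy_Schwarz_sqrt_sum[OF e[OF that] y[OF that]] by (simp add: power2_eq_square mult_ac)
  define C where "C = (2 * pi / L) * (sqrt y * sqrt (192 * (sqrt e * sqrt y) * (sqrt e * sqrt y)))"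
  \<comment> \<open>Absolute convergence of the double series licenses both the reindexing by the
    involution and the summation over \<open>j\<close> first; this is where membership in V
    enters.\<close>
  have bnd: "(\<Sum>k\<in>F. \<Sum>j\<in>J. \<bar>\<tau> (k, j)\<bar>) \<le> C" if F: "finite F" "finite J" for F J
  proof -
    have "(\<Sum>k\<in>F. \<Sum>j\<in>J. \<bar>\<tau> (k, j)\<bar>) \<le> (\<Sum>k\<in>F. \<Sum>j\<in>J. ?a k * ((2 * pi / L) * kn k * (?a j * ?a (k - j))))"
    proof (intro sum_mono)
      fix k j
      have "\<bar>\<tau> (k, j)\<bar> \<le> ?a k * norm (advection_term L c k j)"
        by (simp add: \<tau>_def Cauchy_Schwarz_ineq2)
      also have "\<dots> \<le> ?a k * ((2 * pi / L) * kn k * (?a j * ?a (k - j)))"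
        by (intro mult_left_mono norm_advection_term_le L) auto
      finally show "\<bar>\<tau> (k, j)\<bar> \<le> ?a k * ((2 * pi / L) * kn k * (?a j * ?a (k - j)))" .
    qed
    also have "\<dots> = (2 * pi / L) * (\<Sum>k\<in>F. (kn k * ?a k) * (\<Sum>j\<in>J. ?a j * ?a (k - j)))"
      by (simp add: sum_distrib_left mult_ac)
    also have "\<dots> \<le> (2 * pi / L) * (\<Sum>k\<in>F. (kn k * ?a k) * (1 * conv ?a k))"
    proof (intro mult_left_mono sum_mono)
      show "(\<Sum>j\<in>J. ?a j * ?a (k - j)) \<le> 1 * conv ?a k" for k
        unfolding conv_def mult_1 using F
        by (intro finite_sum_le_infsum_UNIV summable_conv in_H_summable c) auto
    qed (use L in auto)
    also have "\<dots> \<le> C"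
    proof -
      have "(\<Sum>k\<in>F. (1 * conv ?a k)\<^sup>2) \<le> 192 * (sqrt e * sqrt y) * (sqrt e * sqrt y)"
        by (rule sum_weighted_conv_sq_le[OF in_H_summable[OF c]])
           (simp_all add: in_H_0[OF c] 2 F)
      then show ?thesis
        unfolding C_def using L by (intro mult_left_mono Cauchy_Schwarz_sqrt_sum y F) auto
    qed
    finally show ?thesis .
  qed
  have "(\<lambda>x. \<bar>\<tau> x\<bar>) summable_on UNIV"
  proof (rule infsum_le_finite(1))
    fix P :: "((int \<times> int) \<times> (int \<times> int)) set" assume P: "finite P"
    have "(\<Sum>x\<in>P. \<bar>\<tau> x\<bar>) \<le> (\<Sum>x\<in>fst ` P \<times> snd ` P. \<bar>\<tau> x\<bar>)"
      using P by (intro sum_mono2 subset_fst_snd) auto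
    also have "\<dots> = (\<Sum>k\<in>fst ` P. \<Sum>j\<in>snd ` P. \<bar>\<tau> (k, j)\<bar>)"
      by (simp add: sum.cartesian_product)
    also have "\<dots> \<le> C"
      using P by (intro bnd) auto
    finally show "(\<Sum>x\<in>P. \<bar>\<tau> x\<bar>) \<le> C" .
  qed simp
  then have smm: "\<tau> summable_on UNIV"
    using summable_on_iff_abs_summable_on_real by fastforce
  define \<sigma> :: "(int \<times> int) \<times> (int \<times> int) \<Rightarrow> (int \<times> int) \<times> (int \<times> int)"
    where "\<sigma> = (\<lambda>(k, j). (j - k, j))"
  have "\<sigma> (\<sigma> x) = x" for x
    by (cases x) (simp add: \<sigma>_def)
  then have bij: "bij_betw \<sigma> UNIV UNIV"
    by (metis bijI')
  have anti: "\<tau> (\<sigma> x) = - \<tau> x" for x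
  proof -
    obtain k j where x: "x = (k, j)" by (rule prod.exhaust)
    have 1: "c (j - k) = (\<chi> i. cnj (c (k - j) $ i))"
      using in_H_uminus[OF c, of "k - j"] by simp
    have 2: "c (j - k - j) = (\<chi> i. cnj (c k $ i))"
      using in_H_uminus[OF c, of k] by simp
    have 3: "dotc (c j) (kvec (j - k)) = - dotc (c j) (kvec k)"
      using in_H_divfree[OF c, of j] by (simp add: dotc_kvec_diff dotc_commute)
    define \<theta> where "\<theta> = 2 * pi / L"
    show ?thesis
      unfolding x \<sigma>_def \<tau>_def split_conv advection_term_def 2 unfolding 1 3 \<theta>_def[symmetric]
      by (simp add: inner_vec2 algebra_simps)
  qed
  have "infsum \<tau> UNIV = infsum (\<lambda>x. \<tau> (\<sigma> x)) UNIV"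
    using infsum_reindex_bij_betw[OF bij, of \<tau>] by simp
  also have "\<dots> = - infsum \<tau> UNIV"
    by (simp add: anti infsum_uminus)
  finally have 0: "infsum \<tau> UNIV = 0"
    by simp
  have "infsum \<tau> (UNIV \<times> UNIV) = infsum (\<lambda>k. infsum (\<lambda>j. \<tau> (k, j)) UNIV) UNIV"
    by (rule infsum_Sigma_banach[symmetric]) (use smm in simp)
  moreover have "infsum (\<lambda>j. \<tau> (k, j)) UNIV = c k \<bullet> nonlin L c c k" for k
  proof (cases "k = 0")
    case True
    then show ?thesis
      by (simp add: \<tau>_def in_H_0[OF c])
  next
    case False
    have "infsum (\<lambda>j. \<tau> (k, j)) UNIV = c k \<bullet> infsum (advection_term L c k) UNIV"
      unfolding \<tau>_def split_conv
      by (rule infsumI[OF has_sum_bounded_linear[OF bounded_linear_inner_right has_sum_infsum[OF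
          abs_summable_summable[OF abs_summable_advection_term[OF L c]]]]])
    then show ?thesis
      by (simp add: nonlin_eq[OF c] inner_leray[OF in_H_divfree[OF c] False])
  qed
  ultimately show ?thesis
    using 0 by simp
qed

section \<open>Weighted energy identities\<close>

locale bounded_solution =
  fixes \<nu> L M :: real and g :: "int \<times> int \<Rightarrow> complex ^ 2"
    and u :: "real \<Rightarrow> int \<times> int \<Rightarrow> complex ^ 2"
  assumes nu: "\<nu> > 0" and L: "L > 0" and g: "in_H g"
    and sol: "nse_solution \<nu> L g u"
    and energy_le: "\<And>t. infsum (\<lambda>k. (norm (u t k))\<^sup>2) UNIV \<le> M"
begin

definition "\<kappa> = \<nu> * (2 * pi / L)\<^sup>2"

definition "rhs t k = g k - of_real (\<kappa> * ksq k) *s u t k - nonlin L (u t) (u t) k"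

text \<open>The enstrophy up to the factor (2 * pi)^2.\<close>

definition "ens t = infsum (\<lambda>k. (kn k * norm (u t k))\<^sup>2) UNIV"

definition "wen w t = infsum (\<lambda>k. (w k * norm (u t k))\<^sup>2) UNIV"

text \<open>The rate of change of \<open>(w k * norm (u t k))^2\<close>; see
  \<open>deriv_sq\<close>.\<close>

definition "pow w t k = 2 * (w k)\<^sup>2 * (u t k \<bullet> rhs t k)"

definition "g2 = infsum (\<lambda>k. (norm (g k))\<^sup>2) UNIV"

lemma kappa_pos: "0 < \<kappa>"
  using nu L by (simp add: \<kappa>_def)

lemma u_in_H: "in_H (u t)"
  using sol by (simp add: nse_solution_def in_V_def)

lemma sum_sq_le: "finite F \<Longrightarrow> (\<Sum>k\<in>F. (norm (u t k))\<^sup>2) \<le> M"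
  using finite_sum_le_infsum_UNIV[OF in_H_summable[OF u_in_H[of t]], of F] energy_le[of t] by simp

lemma M_nonneg: "0 \<le> M"
  using sum_sq_le[of "{}"] by simp

lemma norm_u_le: "norm (u t k) \<le> sqrt M"
  using sum_sq_le[of "{k}" t] by (simp add: real_le_rsqrt)

lemma summable_ens: "(\<lambda>k. (kn k * norm (u t k))\<^sup>2) summable_on UNIV"
  using sol by (simp add: nse_solution_def in_V_def power_mult_distrib kn_sq)

lemma ens_nonneg: "0 \<le> ens t"
  by (auto simp: ens_def intro!: infsum_nonneg)

lemma sum_le_ens: "finite F \<Longrightarrow> (\<Sum>k\<in>F. (kn k * norm (u t k))\<^sup>2) \<le> ens t"
  unfolding ens_def by (intro finite_sum_le_infsum_UNIV summable_ens) auto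

lemma ens_le: "(\<And>F. finite F \<Longrightarrow> (\<Sum>k\<in>F. (kn k * norm (u t k))\<^sup>2) \<le> B) \<Longrightarrow> ens t \<le> B"
  unfolding ens_def by (intro infsum_le_finite) auto

lemma sum_g_le: "finite F \<Longrightarrow> (\<Sum>k\<in>F. (norm (g k))\<^sup>2) \<le> g2"
  unfolding g2_def by (intro finite_sum_le_infsum_UNIV in_H_summable g) auto

lemma g2_nonneg: "0 \<le> g2"
  using sum_g_le[of "{}"] by simp

lemma deriv_u: "((\<lambda>s. u s k) has_vector_derivative rhs t k) (at t)"
  using sol unfolding nse_solution_def rhs_def \<kappa>_def by blast

lemma continuous_u: "continuous_on S (\<lambda>t. u t k)"
  using has_vector_derivative_continuous[OF deriv_u] by (intro continuous_at_imp_continuous_on) auto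

lemma deriv_sq: "((\<lambda>s. (w k * norm (u s k))\<^sup>2) has_vector_derivative pow w t k) (at t within S)"
proof -
  have "((\<lambda>s. u s k) has_derivative (\<lambda>h. h *\<^sub>R rhs t k)) (at t within S)"
    using deriv_u[of k t] has_derivative_at_withinI unfolding has_vector_derivative_def by blast
  from has_derivative_inner[OF this this]
  have "((\<lambda>s. (w k)\<^sup>2 * (u s k \<bullet> u s k)) has_derivative
      (\<lambda>h. (w k)\<^sup>2 * (u t k \<bullet> (h *\<^sub>R rhs t k) + (h *\<^sub>R rhs t k) \<bullet> u t k))) (at t within S)"
    by (rule has_derivative_mult_right)
  moreover have "(\<lambda>s. (w k * norm (u s k))\<^sup>2) = (\<lambda>s. (w k)\<^sup>2 * (u s k \<bullet> u s k))"
    by (simp add: power_mult_distrib power2_norm_eq_inner)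
  moreover have "(\<lambda>h. h *\<^sub>R pow w t k)
      = (\<lambda>h. (w k)\<^sup>2 * (u t k \<bullet> (h *\<^sub>R rhs t k) + (h *\<^sub>R rhs t k) \<bullet> u t k))"
    by (simp add: pow_def inner_commute algebra_simps)
  ultimately show ?thesis
    unfolding has_vector_derivative_def by simp
qed

lemma inner_rhs:
  "u t k \<bullet> rhs t k = u t k \<bullet> g k - \<kappa> * (kn k * norm (u t k))\<^sup>2 - u t k \<bullet> nonlin L (u t) (u t) k"
proof -
  have "u t k \<bullet> (of_real (\<kappa> * ksq k) *s u t k) = \<kappa> * ksq k * (u t k \<bullet> u t k)"
    by (simp add: inner_vec2 algebra_simps)
  then show ?thesis
    by (simp add: rhs_def inner_diff_right power_mult_distrib kn_sq power2_norm_eq_inner)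
qed

text \<open>The bound is uniform over finite sets and depends on time only through
  \<open>ens t\<close>, as a majorant for dominated convergence should.\<close>

lemma sum_abs_pow_le:
  assumes w: "\<And>k. 0 \<le> w k" "\<And>k. w k \<le> R" and F: "finite F"
  shows "(\<Sum>k\<in>F. \<bar>pow w t k\<bar>) \<le> R\<^sup>2 * (M + g2 + (2 * \<kappa> + 2 * ((4 * pi / L) * sqrt (192 * M))) * ens t)"
proof -
  let ?a = "\<lambda>k. norm (u t k)" and ?N = "\<lambda>k. norm (nonlin L (u t) (u t) k)"
  have "(\<Sum>k\<in>F. \<bar>pow w t k\<bar>) \<le> (\<Sum>k\<in>F. R\<^sup>2 * ((?a k)\<^sup>2 + (norm (g k))\<^sup>2 + 2 * \<kappa> * (kn k * ?a k)\<^sup>2 + 2 * (?a k * ?N k)))"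
  proof (rule sum_mono)
    fix k
    have "\<bar>u t k \<bullet> rhs t k\<bar> \<le> ?a k * norm (g k) + \<kappa> * (kn k * ?a k)\<^sup>2 + ?a k * ?N k"
      unfolding inner_rhs using Cauchy_Schwarz_ineq2[of "u t k" "g k"]
        Cauchy_Schwarz_ineq2[of "u t k" "nonlin L (u t) (u t) k"] kappa_pos
        mult_nonneg_nonneg[OF less_imp_le[OF kappa_pos] zero_le_power2[of "kn k * ?a k"]]
      by linarith
    moreover have "2 * (?a k * norm (g k)) \<le> (?a k)\<^sup>2 + (norm (g k))\<^sup>2"
      using sum_squares_bound[of "?a k" "norm (g k)"] by simp
    ultimately have 1: "2 * \<bar>u t k \<bullet> rhs t k\<bar> \<le> (?a k)\<^sup>2 + (norm (g k))\<^sup>2 + 2 * \<kappa> * (kn k * ?a k)\<^sup>2 + 2 * (?a k * ?N k)"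
      by linarith
    have "\<bar>pow w t k\<bar> = (w k)\<^sup>2 * (2 * \<bar>u t k \<bullet> rhs t k\<bar>)"
      by (simp add: pow_def abs_mult)
    also have "\<dots> \<le> R\<^sup>2 * ((?a k)\<^sup>2 + (norm (g k))\<^sup>2 + 2 * \<kappa> * (kn k * ?a k)\<^sup>2 + 2 * (?a k * ?N k))"
      using w[of k] 1 by (intro mult_mono power_mono) auto
    finally show "\<bar>pow w t k\<bar> \<le> R\<^sup>2 * ((?a k)\<^sup>2 + (norm (g k))\<^sup>2 + 2 * \<kappa> * (kn k * ?a k)\<^sup>2 + 2 * (?a k * ?N k))" .
  qed
  also have "\<dots> = R\<^sup>2 * ((\<Sum>k\<in>F. (?a k)\<^sup>2) + (\<Sum>k\<in>F. (norm (g k))\<^sup>2) + 2 * \<kappa> * (\<Sum>k\<in>F. (kn k * ?a k)\<^sup>2)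
      + 2 * (\<Sum>k\<in>F. ?a k * ?N k))"
    by (simp only: sum_distrib_left[symmetric] sum.distrib)
  also have "\<dots> \<le> R\<^sup>2 * (M + g2 + 2 * \<kappa> * ens t + 2 * ((4 * pi / L) * (sqrt (192 * M) * ens t)))"
    using kappa_pos
    by (intro mult_left_mono add_mono sum_sq_le sum_g_le sum_le_ens F
        sum_nonlin_le[OF L u_in_H]) auto
  finally show ?thesis
    by (simp add: algebra_simps)
qed

lemma summable_pow:
  assumes "\<And>k. 0 \<le> w k" "\<And>k. w k \<le> R"
  shows "pow w t summable_on UNIV"
proof -
  have "(\<lambda>k. \<bar>pow w t k\<bar>) summable_on UNIV"
    by (rule infsum_le_finite(1)[OF _ sum_abs_pow_le[OF assms]]) auto
  then show ?thesis
    using summable_on_iff_abs_summable_on_real by fastforce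
qed

lemma summable_wen:
  assumes "\<And>k. 0 \<le> w k" "\<And>k. w k \<le> R"
  shows "(\<lambda>k. (w k * norm (u t k))\<^sup>2) summable_on UNIV"
proof (rule summable_on_comparison_test)
  show "(\<lambda>k. R\<^sup>2 * (norm (u t k))\<^sup>2) summable_on UNIV"
    by (intro summable_on_cmult_right in_H_summable u_in_H)
  show "(w k * norm (u t k))\<^sup>2 \<le> R\<^sup>2 * (norm (u t k))\<^sup>2" for k
    unfolding power_mult_distrib using assms[of k] by (intro mult_right_mono power_mono) auto
qed auto

lemma wen_nonneg: "0 \<le> wen w t"
  by (auto simp: wen_def intro!: infsum_nonneg)

text \<open>On a finite box this is the fundamental theorem of calculus, mode by mode. Dominated
  convergence carries it to all modes, which is why the weights are bounded and \<open>ens\<close>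
  is assumed integrable.\<close>

lemma energy_identity:
  assumes w: "\<And>k. 0 \<le> w k" "\<And>k. w k \<le> R" and int: "ens integrable_on {s..t}" and "s \<le> t"
  shows "((\<lambda>r. infsum (pow w r) UNIV) has_integral (wen w t - wen w s)) {s..t}"
proof -
  let ?f = "\<lambda>n r. \<Sum>k\<in>sq_box n. pow w r k"
  let ?e = "\<lambda>n r. \<Sum>k\<in>sq_box n. (w k * norm (u r k))\<^sup>2"
  let ?h = "\<lambda>r. R\<^sup>2 * (M + g2 + (2 * \<kappa> + 2 * ((4 * pi / L) * sqrt (192 * M))) * ens r)"
  have ftc: "(?f n has_integral (?e n t - ?e n s)) {s..t}" for n
  proof (rule fundamental_theorem_of_calculus[OF \<open>s \<le> t\<close>])
    show "(?e n has_vector_derivative ?f n r) (at r within {s..t})" for r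
      by (intro has_vector_derivative_sum deriv_sq)
  qed
  have lim_f: "(\<lambda>n. ?f n r) \<longlonglongrightarrow> infsum (pow w r) UNIV" for r
    by (intro has_sum_sq_box has_sum_infsum summable_pow[OF w])
  have bnd: "norm (?f n r) \<le> ?h r" for n r
  proof -
    have "norm (?f n r) \<le> (\<Sum>k\<in>sq_box n. \<bar>pow w r k\<bar>)"
      using norm_sum[of "pow w r" "sq_box n"] by simp
    also have "\<dots> \<le> ?h r"
      by (intro sum_abs_pow_le w) auto
    finally show ?thesis .
  qed
  have h: "?h integrable_on {s..t}"
    by (intro integrable_on_mult_right Henstock_Kurzweil_Integration.integrable_add integrable_const_ivl int)
  have dom: "(\<lambda>r. infsum (pow w r) UNIV) integrable_on {s..t}"
    "(\<lambda>n. integral {s..t} (?f n)) \<longlonglongrightarrow> integral {s..t} (\<lambda>r. infsum (pow w r) UNIV)"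
    by (rule dominated_convergence[OF has_integral_integrable[OF ftc] h bnd lim_f])+
  have "(\<lambda>n. ?e n t - ?e n s) \<longlonglongrightarrow> wen w t - wen w s"
    unfolding wen_def by (intro tendsto_diff has_sum_sq_box has_sum_infsum summable_wen[OF w])
  then have "integral {s..t} (\<lambda>r. infsum (pow w r) UNIV) = wen w t - wen w s"
    using dom(2) unfolding integral_unique[OF ftc] by (rule LIMSEQ_unique[rotated])
  then show ?thesis
    using dom(1) by (simp add: has_integral_integral)
qed

text \<open>Orthogonality removes the nonlinear term, and twice the work of the force is at most
  |u|^2 + |g|^2 summed over the modes.\<close>

lemma infsum_pow_1_le: "infsum (pow (\<lambda>_. 1) t) UNIV \<le> M + g2 - 2 * \<kappa> * ens t"
proof -
  let ?a = "\<lambda>k. norm (u t k)" and ?N = "\<lambda>k. nonlin L (u t) (u t) k"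
  have smN: "(\<lambda>k. u t k \<bullet> ?N k) summable_on UNIV"
  proof (rule abs_summable_summable[OF Infinite_Sum.abs_summable_on_comparison_test'])
    show "(\<lambda>k. ?a k * norm (?N k)) summable_on UNIV"
      by (rule infsum_le_finite(1)[OF _ sum_nonlin_le[OF L u_in_H sum_sq_le sum_le_ens]]) auto
    show "norm (u t k \<bullet> ?N k) \<le> ?a k * norm (?N k)" for k
      by (simp add: Cauchy_Schwarz_ineq2)
  qed
  have N0: "infsum (\<lambda>k. u t k \<bullet> ?N k) UNIV = 0"
    by (rule infsum_inner_nonlin_eq_0[OF L u_in_H sum_le_ens])
  have s1: "(\<lambda>k. (?a k)\<^sup>2) summable_on UNIV" "(\<lambda>k. (norm (g k))\<^sup>2) summable_on UNIV"
    by (intro in_H_summable u_in_H g)+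
  have s2: "(\<lambda>k. - (2 * \<kappa>) * (kn k * ?a k)\<^sup>2) summable_on UNIV" "(\<lambda>k. - 2 * (u t k \<bullet> ?N k)) summable_on UNIV"
    by (intro summable_on_cmult_right summable_ens smN)+
  let ?r = "\<lambda>k. ((?a k)\<^sup>2 + (norm (g k))\<^sup>2) + (- (2 * \<kappa>) * (kn k * ?a k)\<^sup>2 + - 2 * (u t k \<bullet> ?N k))"
  have "infsum (pow (\<lambda>_. 1) t) UNIV \<le> infsum ?r UNIV"
  proof (rule infsum_mono)
    show "pow (\<lambda>_. 1) t summable_on UNIV"
      by (rule summable_pow[of _ 1]) auto
    show "?r summable_on UNIV"
      by (intro summable_on_add s1 s2)
    fix k
    have "2 * (u t k \<bullet> g k) \<le> 2 * (?a k * norm (g k))"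
      using norm_cauchy_schwarz[of "u t k" "g k"] by simp
    also have "\<dots> \<le> (?a k)\<^sup>2 + (norm (g k))\<^sup>2"
      using sum_squares_bound[of "?a k" "norm (g k)"] by simp
    finally show "pow (\<lambda>_. 1) t k \<le> ?r k"
      by (simp add: pow_def inner_rhs)
  qed
  also have "\<dots> = (infsum (\<lambda>k. (?a k)\<^sup>2) UNIV + g2) + (- (2 * \<kappa>) * ens t + - 2 * infsum (\<lambda>k. u t k \<bullet> ?N k) UNIV)"
    unfolding ens_def g2_def
    by (simp only: infsum_add[OF summable_on_add[OF s1] summable_on_add[OF s2]] infsum_add[OF s1]
        infsum_add[OF s2] infsum_cmult_right')
  also have "\<dots> \<le> M + g2 - 2 * \<kappa> * ens t"
    using energy_le[of t] by (simp add: N0)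
  finally show ?thesis .
qed

text \<open>Dissipation is paid for by the energy at time \<open>s\<close> and the work of the
  force. The bound sees only the length of the interval, not the size of \<open>ens\<close>.\<close>

lemma integral_ens_le:
  assumes "ens integrable_on {s..t}" "s \<le> t"
  shows "2 * \<kappa> * integral {s..t} ens \<le> M + (M + g2) * (t - s)"
proof -
  have "((\<lambda>r. infsum (pow (\<lambda>_. 1) r) UNIV) has_integral (wen (\<lambda>_. 1) t - wen (\<lambda>_. 1) s)) {s..t}"
    by (rule energy_identity[of _ 1]) (use assms in auto)
  moreover have "((\<lambda>r. M + g2 - 2 * \<kappa> * ens r) has_integral ((M + g2) * (t - s) - 2 * \<kappa> * integral {s..t} ens)) {s..t}"
    using assms has_integral_const_real[of "M + g2" s t]
    by (intro has_integral_diff has_integral_mult_right integrable_integral) (auto simp: mult.commute)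
  ultimately have "wen (\<lambda>_. 1) t - wen (\<lambda>_. 1) s \<le> (M + g2) * (t - s) - 2 * \<kappa> * integral {s..t} ens"
    by (rule has_integral_le) (rule infsum_pow_1_le)
  moreover have "wen (\<lambda>_. 1) s \<le> M"
    using energy_le[of s] by (simp add: wen_def)
  ultimately show ?thesis
    using wen_nonneg[of "\<lambda>_. 1" t] by linarith
qed

text \<open>What remains in \<open>infsum_pow_min_le\<close> after Young's inequality, used once for
  the force and twice for the nonlinear term; 384 = 4 * 192 / 2.\<close>

definition "cg = g2 / \<kappa> + (384 * (4 * pi / L)\<^sup>2 / \<kappa>)\<^sup>2 * M / (2 * \<kappa>)"

lemma cg_nonneg: "0 \<le> cg"
  using kappa_pos M_nonneg g2_nonneg by (simp add: cg_def)

text \<open>The enstrophy inequality of the two-dimensional theory for a truncated weight.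
  Truncation at \<open>R\<close> makes the weight bounded, as \<open>energy_identity\<close>
  requires, and keeps the doubling property. The constant does not involve \<open>R\<close>, so
  \<open>R\<close> can be removed at the end.\<close>

lemma infsum_pow_min_le:
  assumes "0 \<le> R"
  defines "w \<equiv> \<lambda>k. min (kn k) R"
  shows "infsum (pow w t) UNIV \<le> cg * (1 + ens t) * (1 + wen w t)"
proof -
  let ?a = "\<lambda>k. norm (u t k)" and ?N = "\<lambda>k. nonlin L (u t) (u t) k"
  have w: "0 \<le> w k" "w k \<le> R" "w k \<le> kn k" for k
    using assms by (auto simp: w_def)
  have w2: "w k \<le> 2 * w j" if "kn k \<le> 2 * kn j" for j k
    using that assms by (auto simp: w_def min_def)
  define E where "E = wen w t"
  define D where "D = infsum (\<lambda>k. (kn k * (w k * ?a k))\<^sup>2) UNIV"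
  have smD: "(\<lambda>k. (kn k * (w k * ?a k))\<^sup>2) summable_on UNIV"
  proof (rule summable_on_comparison_test)
    show "(\<lambda>k. R\<^sup>2 * (kn k * ?a k)\<^sup>2) summable_on UNIV"
      by (intro summable_on_cmult_right summable_ens)
    show "(kn k * (w k * ?a k))\<^sup>2 \<le> R\<^sup>2 * (kn k * ?a k)\<^sup>2" for k
    proof -
      have "(kn k * (w k * ?a k))\<^sup>2 = (w k)\<^sup>2 * (kn k * ?a k)\<^sup>2"
        by (simp add: power_mult_distrib)
      also have "\<dots> \<le> R\<^sup>2 * (kn k * ?a k)\<^sup>2"
        using w[of k] by (intro mult_right_mono power_mono) auto
      finally show ?thesis .
    qed
  qed auto
  have sD: "(\<Sum>k\<in>F. (kn k * (w k * ?a k))\<^sup>2) \<le> D" if "finite F" for F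
    unfolding D_def by (intro finite_sum_le_infsum_UNIV smD that) auto
  have sE: "(\<Sum>k\<in>F. (w k * ?a k)\<^sup>2) \<le> E" if "finite F" for F
    unfolding E_def wen_def by (intro finite_sum_le_infsum_UNIV summable_wen[OF w(1,2)] that) auto
  have nn: "0 \<le> D" "0 \<le> E" "0 \<le> ens t"
    using sD[of "{}"] sE[of "{}"] ens_nonneg by auto
  \<comment> \<open>In these terms the nonlinear contribution is a multiple of
    \<open>x * sqrt (x * z)\<close>, of degree 3/2 in \<open>x\<close>, against a dissipation of
    degree 2.\<close>
  define x z where "x = sqrt D" and "z = sqrt E * (sqrt M * sqrt (ens t))"
  have xz: "0 \<le> x" "0 \<le> z" "x\<^sup>2 = D" "z\<^sup>2 = M * (ens t * E)"
    using nn M_nonneg by (auto simp: x_def z_def power_mult_distrib)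
  define c0 where "c0 = 4 * pi / L"
  have c0: "0 < c0"
    using L by (simp add: c0_def)
  have fin: "(\<Sum>k\<in>F. pow w t k) \<le> 2 * (x * sqrt g2) + 2 * (c0 * (x * sqrt (192 * x * z)))
      - 2 * \<kappa> * (\<Sum>k\<in>F. (kn k * (w k * ?a k))\<^sup>2)" if F: "finite F" for F
  proof -
    have "(\<Sum>k\<in>F. pow w t k) \<le> (\<Sum>k\<in>F. 2 * ((kn k * (w k * ?a k)) * norm (g k))
        + 2 * ((w k)\<^sup>2 * (?a k * norm (?N k))) - 2 * \<kappa> * (kn k * (w k * ?a k))\<^sup>2)"
    proof (rule sum_mono)
      fix k
      have "(w k)\<^sup>2 * (u t k \<bullet> g k) \<le> (w k)\<^sup>2 * (?a k * norm (g k))"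
        by (intro mult_left_mono norm_cauchy_schwarz) auto
      also have "\<dots> = w k * (w k * ?a k * norm (g k))"
        by (simp add: power2_eq_square)
      also have "\<dots> \<le> kn k * (w k * ?a k * norm (g k))"
        using w[of k] by (intro mult_right_mono) auto
      finally have 1: "(w k)\<^sup>2 * (u t k \<bullet> g k) \<le> kn k * (w k * ?a k) * norm (g k)"
        by (simp add: mult_ac)
      have "(w k)\<^sup>2 * (- (u t k \<bullet> ?N k)) \<le> (w k)\<^sup>2 * (?a k * norm (?N k))"
        using Cauchy_Schwarz_ineq2[of "u t k" "?N k"] by (intro mult_left_mono) (auto simp: abs_le_iff)
      moreover have "pow w t k = 2 * ((w k)\<^sup>2 * (u t k \<bullet> g k)) + 2 * ((w k)\<^sup>2 * (- (u t k \<bullet> ?N k)))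
          - 2 * \<kappa> * (kn k * (w k * ?a k))\<^sup>2"
        by (simp add: pow_def inner_rhs power_mult_distrib algebra_simps)
      ultimately show "pow w t k \<le> 2 * ((kn k * (w k * ?a k)) * norm (g k))
          + 2 * ((w k)\<^sup>2 * (?a k * norm (?N k))) - 2 * \<kappa> * (kn k * (w k * ?a k))\<^sup>2"
        using 1 by linarith
    qed
    also have "\<dots> = 2 * (\<Sum>k\<in>F. (kn k * (w k * ?a k)) * norm (g k))
        + 2 * (\<Sum>k\<in>F. (w k)\<^sup>2 * (?a k * norm (?N k))) - 2 * \<kappa> * (\<Sum>k\<in>F. (kn k * (w k * ?a k))\<^sup>2)"
      by (simp only: sum_distrib_left[symmetric] sum.distrib sum_subtractf)
    also have "\<dots> \<le> 2 * (x * sqrt g2) + 2 * (c0 * (x * sqrt (192 * x * z)))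
        - 2 * \<kappa> * (\<Sum>k\<in>F. (kn k * (w k * ?a k))\<^sup>2)"
    proof -
      have "(\<Sum>k\<in>F. (kn k * (w k * ?a k)) * norm (g k)) \<le> x * sqrt g2"
        unfolding x_def by (intro Cauchy_Schwarz_sqrt_sum sD sum_g_le F)
      moreover have "(\<Sum>k\<in>F. (w k)\<^sup>2 * (?a k * norm (?N k)))
          \<le> (4 * pi / L) * (sqrt D * sqrt (192 * (sqrt E * sqrt D) * (sqrt M * sqrt (ens t))))"
        by (rule sum_weighted_nonlin_le[OF L u_in_H w(1) w2 sE sD sum_sq_le sum_le_ens F])
      moreover have "192 * (sqrt E * sqrt D) * (sqrt M * sqrt (ens t)) = 192 * x * z"
        by (simp add: x_def z_def mult_ac)
      ultimately show ?thesis
        unfolding x_def[symmetric] c0_def[symmetric] by simp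
    qed
    finally show ?thesis .
  qed
  \<comment> \<open>The dissipation carries a minus sign and its partial sums lie below
    \<open>D\<close>, so it can be replaced by \<open>D\<close> only in the limit.\<close>
  have "(\<lambda>n. \<Sum>k\<in>sq_box n. (kn k * (w k * ?a k))\<^sup>2) \<longlonglongrightarrow> D"
    unfolding D_def by (intro has_sum_sq_box has_sum_infsum smD)
  then have lim1: "(\<lambda>n. 2 * (x * sqrt g2) + 2 * (c0 * (x * sqrt (192 * x * z)))
      - 2 * \<kappa> * (\<Sum>k\<in>sq_box n. (kn k * (w k * ?a k))\<^sup>2))
      \<longlonglongrightarrow> 2 * (x * sqrt g2) + 2 * (c0 * (x * sqrt (192 * x * z))) - 2 * \<kappa> * D"
    by (intro tendsto_intros)
  have lim2: "(\<lambda>n. \<Sum>k\<in>sq_box n. pow w t k) \<longlonglongrightarrow> infsum (pow w t) UNIV"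
    by (intro has_sum_sq_box has_sum_infsum summable_pow[OF w(1,2)])
  have 1: "infsum (pow w t) UNIV \<le> 2 * (x * sqrt g2) + 2 * (c0 * (x * sqrt (192 * x * z))) - 2 * \<kappa> * D"
    by (rule LIMSEQ_le[OF lim2 lim1]) (intro exI[of _ 0] allI impI fin finite_sq_box)
  \<comment> \<open>Absorb the powers of \<open>x\<close> into the dissipation \<open>2 * \<kappa> * x\<^sup>2\<close>.\<close>
  have amgm: "p * q \<le> h * p\<^sup>2 / 2 + q\<^sup>2 / (2 * h)" if "0 < h" for p q h :: real
  proof -
    have "0 \<le> (h * p - q)\<^sup>2 / (2 * h)"
      using that by simp
    also have "\<dots> = h * p\<^sup>2 / 2 + q\<^sup>2 / (2 * h) - p * q"
      using that by (simp add: power2_eq_square field_simps)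
    finally show ?thesis by simp
  qed
  have 2: "2 * (x * sqrt g2) \<le> \<kappa> * x\<^sup>2 + g2 / \<kappa>"
    using amgm[OF kappa_pos, of x "sqrt g2"] g2_nonneg by (simp add: field_simps)
  have "2 * (c0 * (x * sqrt (192 * x * z))) = x * (2 * c0 * sqrt (192 * x * z))"
    by simp
  also have "\<dots> \<le> \<kappa> * x\<^sup>2 / 2 + (2 * c0 * sqrt (192 * x * z))\<^sup>2 / (2 * \<kappa>)"
    by (rule amgm[OF kappa_pos])
  also have "(2 * c0 * sqrt (192 * x * z))\<^sup>2 / (2 * \<kappa>) = x * (384 * c0\<^sup>2 / \<kappa> * z)"
    using xz kappa_pos by (simp add: power_mult_distrib field_simps)
  also have "\<dots> \<le> \<kappa> * x\<^sup>2 / 2 + (384 * c0\<^sup>2 / \<kappa> * z)\<^sup>2 / (2 * \<kappa>)"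
    by (rule amgm[OF kappa_pos])
  also have "(384 * c0\<^sup>2 / \<kappa> * z)\<^sup>2 / (2 * \<kappa>) = (384 * c0\<^sup>2 / \<kappa>)\<^sup>2 * M / (2 * \<kappa>) * (ens t * E)"
    unfolding power_mult_distrib[of _ z] xz(4) by simp
  finally have 3: "2 * (c0 * (x * sqrt (192 * x * z))) \<le> \<kappa> * x\<^sup>2 + (384 * c0\<^sup>2 / \<kappa>)\<^sup>2 * M / (2 * \<kappa>) * (ens t * E)"
    by simp
  have "infsum (pow w t) UNIV \<le> g2 / \<kappa> * 1 + (384 * c0\<^sup>2 / \<kappa>)\<^sup>2 * M / (2 * \<kappa>) * (ens t * E)"
    using 1 2 3 xz by simp
  also have "\<dots> \<le> g2 / \<kappa> * ((1 + ens t) * (1 + E)) + (384 * c0\<^sup>2 / \<kappa>)\<^sup>2 * M / (2 * \<kappa>) * ((1 + ens t) * (1 + E))"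
    using nn kappa_pos g2_nonneg M_nonneg by (intro add_mono mult_left_mono) (auto simp: algebra_simps)
  also have "\<dots> = cg * (1 + ens t) * (1 + E)"
    unfolding cg_def c0_def distrib_right mult.assoc ..
  finally show ?thesis
    unfolding E_def .
qed

end

section \<open>Boundedness in V\<close>

text \<open>\<open>\<beta>\<close> is merely integrable, so sublevels of its mass replace an
  integrating factor. Where that mass is at most 1/2, the maximum of \<open>v\<close> satisfies v r
  \<le> v s + v r / 2, so \<open>v\<close> at most doubles. The intermediate value theorem cuts the
  interval into at most \<open>m\<close> such pieces.\<close>

lemma integral_Gronwall:
  fixes v \<beta> :: "real \<Rightarrow> real"
  assumes "a \<le> b" and v: "continuous_on {a..b} v" "\<And>t. 0 \<le> v t"
    and \<beta>: "\<beta> integrable_on {a..b}" "\<And>t. 0 \<le> \<beta> t"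
    and step: "\<And>s t S. a \<le> s \<Longrightarrow> s \<le> t \<Longrightarrow> t \<le> b \<Longrightarrow> (\<And>r. r \<in> {s..t} \<Longrightarrow> v r \<le> S)
      \<Longrightarrow> v t \<le> v s + S * integral {s..t} \<beta>"
    and m: "integral {a..b} \<beta> \<le> real m / 2"
  shows "v b \<le> 2 ^ m * v a"
proof -
  have sub: "\<beta> integrable_on {s..t}" if "a \<le> s" "t \<le> b" for s t
    using \<beta>(1) that by (rule_tac integrable_on_subinterval) auto
  have half: "v t \<le> 2 * v s" if st: "a \<le> s" "s \<le> t" "t \<le> b" and I: "integral {s..t} \<beta> \<le> 1 / 2" for s t
  proof -
    have "continuous_on {s..t} v"
      using v(1) st by (rule_tac continuous_on_subset) auto
    then obtain r where r: "r \<in> {s..t}" "\<And>q. q \<in> {s..t} \<Longrightarrow> v q \<le> v r"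
      using continuous_attains_sup[of "{s..t}" v] st by auto
    have "v r \<le> v s + v r * integral {s..r} \<beta>"
      using r st by (intro step) auto
    moreover have "integral {s..r} \<beta> \<le> integral {s..t} \<beta>"
      using r st by (intro integral_subset_le sub) (auto simp: \<beta>(2))
    then have "v r * integral {s..r} \<beta> \<le> v r * (1 / 2)"
      using I by (intro mult_left_mono v(2)) linarith
    ultimately have "v r \<le> v s + v r * (1 / 2)"
      by linarith
    then show ?thesis
      using r(2)[of t] st by auto
  qed
  have "v t \<le> 2 ^ m * v a" if "a \<le> t" "t \<le> b" "integral {a..t} \<beta> \<le> real m / 2" for t m
    using that
  proof (induction m arbitrary: t)
    case 0
    have "continuous_on {a..t} v"
      using v(1) 0 by (rule_tac continuous_on_subset) auto
    then obtain r where r: "r \<in> {a..t}" "\<And>q. q \<in> {a..t} \<Longrightarrow> v q \<le> v r"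
      using continuous_attains_sup[of "{a..t}" v] 0 by auto
    have "v t \<le> v a + v r * integral {a..t} \<beta>"
      using r 0 by (intro step) auto
    moreover have "0 \<le> integral {a..t} \<beta>"
      using 0 by (intro Henstock_Kurzweil_Integration.integral_nonneg sub \<beta>(2)) auto
    then have "integral {a..t} \<beta> = 0"
      using 0 by simp
    ultimately show ?case
      by simp
  next
    case (Suc m)
    show ?case
    proof (cases "integral {a..t} \<beta> \<le> real m / 2")
      case True
      then have "v t \<le> 2 ^ m * v a"
        using Suc.prems by (intro Suc.IH)
      moreover have "0 \<le> 2 ^ m * v a"
        using v(2)[of a] by simp
      ultimately show ?thesis
        by simp
    next
      case False
      have "continuous_on {a..t} (\<lambda>x. integral {a..x} \<beta>)"
        using Suc.prems by (intro indefinite_integral_continuous_1 sub) auto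
      then obtain r where r: "a \<le> r" "r \<le> t" "integral {a..r} \<beta> = real m / 2"
        using IVT'[of "\<lambda>x. integral {a..x} \<beta>" a "real m / 2" t] False Suc.prems by auto
      have "integral {a..r} \<beta> + integral {r..t} \<beta> = integral {a..t} \<beta>"
        using r Suc.prems by (intro Henstock_Kurzweil_Integration.integral_combine sub) auto
      then have "integral {r..t} \<beta> \<le> 1 / 2"
        using r Suc.prems by simp
      then have "v t \<le> 2 * v r"
        using r Suc.prems by (intro half) auto
      also have "v r \<le> 2 ^ m * v a"
        using r Suc.prems by (intro Suc.IH) auto
      finally show ?thesis
        by simp
    qed
  qed
  from this[OF \<open>a \<le> b\<close> order_refl m] show ?thesis .
qed

section \<open>Integrability and growth of the enstrophy on short intervals\<close>

context bounded_solution
begin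

lemma ens_lim: "(\<lambda>n. \<Sum>k\<in>sq_box n. (kn k * norm (u t k))\<^sup>2) \<longlonglongrightarrow> ens t"
  unfolding ens_def by (intro has_sum_sq_box has_sum_infsum summable_ens)

lemma continuous_partial_ens: "continuous_on S (\<lambda>t. \<Sum>k\<in>F. (kn k * norm (u t k))\<^sup>2)"
  by (intro continuous_intros continuous_u)

lemma partial_ens_integrable: "(\<lambda>t. \<Sum>k\<in>F. (kn k * norm (u t k))\<^sup>2) integrable_on {a..b}"
  by (intro integrable_continuous_interval continuous_partial_ens)

text \<open>\<open>ens\<close> is the increasing limit of continuous partial sums, so monotone
  convergence needs just a bound on their integrals.\<close>

lemma ens_integrable:
  assumes "\<And>n. integral {a..b} (\<lambda>t. \<Sum>k\<in>sq_box n. (kn k * norm (u t k))\<^sup>2) \<le> K"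
  shows "ens integrable_on {a..b}"
proof -
  let ?f = "\<lambda>n t. \<Sum>k\<in>sq_box n. (kn k * norm (u t k))\<^sup>2"
  have "0 \<le> integral {a..b} (?f n)" for n
    by (intro Henstock_Kurzweil_Integration.integral_nonneg partial_ens_integrable sum_nonneg) auto
  then have "bounded (range (\<lambda>n. integral {a..b} (?f n)))"
    using assms by (intro boundedI[of _ K]) auto
  moreover have "sq_box n \<subseteq> sq_box (Suc n)" for n
    by (auto simp only: mem_sq_box subset_iff)
  then have "?f n t \<le> ?f (Suc n) t" for n t
    by (intro sum_mono2) auto
  ultimately show ?thesis
    using monotone_convergence_increasing[of ?f "{a..b}" ens] partial_ens_integrable ens_lim by blast
qed

definition "ke = (2 * M + g2) / (2 * \<kappa>)"

lemma integral_ens_le_ke: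
  assumes "ens integrable_on {s..t}" "s \<le> t" "t \<le> s + 1"
  shows "integral {s..t} ens \<le> ke"
proof -
  have "(M + g2) * (t - s) \<le> (M + g2) * 1"
    using assms M_nonneg g2_nonneg by (intro mult_left_mono) auto
  then have "2 * \<kappa> * integral {s..t} ens \<le> 2 * M + g2"
    using integral_ens_le[OF assms(1,2)] by (simp add: algebra_simps)
  then show ?thesis
    using kappa_pos by (simp add: ke_def field_simps)
qed

text \<open>The energy bound on compact subintervals does not depend on the subinterval, so it persists
  on the closed interval even though nothing is known about \<open>ens\<close> near the endpoints.\<close>

lemma ens_integrable_gap:
  assumes cd: "c < d" "d \<le> c + 1"
    and loc: "\<And>a b. c < a \<Longrightarrow> a \<le> b \<Longrightarrow> b < d \<Longrightarrow> \<exists>B. \<forall>t\<in>{a..b}. ens t \<le> B"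
  shows "ens integrable_on {c..d}"
proof (rule ens_integrable)
  fix n
  let ?f = "\<lambda>t. \<Sum>k\<in>sq_box n. (kn k * norm (u t k))\<^sup>2"
  have f0: "0 \<le> ?f t" for t
    by (intro sum_nonneg) auto
  have "{c..d} \<noteq> {}"
    using cd by simp
  from continuous_attains_sup[OF compact_Icc this continuous_partial_ens, of "sq_box n"]
  obtain r where r: "\<And>t. t \<in> {c..d} \<Longrightarrow> ?f t \<le> ?f r"
    by blast
  define B where "B = ?f r"
  have inner: "integral {a..b} ?f \<le> ke" if ab: "c < a" "a \<le> b" "b < d" for a b
  proof -
    obtain B' where B': "\<And>t. t \<in> {a..b} \<Longrightarrow> ens t \<le> B'"
      using loc[OF ab] by blast
    have "integral {a..b} (\<lambda>t. \<Sum>k\<in>sq_box m. (kn k * norm (u t k))\<^sup>2) \<le> integral {a..b} (\<lambda>t. B')" for m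
      using B' sum_le_ens[OF finite_sq_box]
      by (intro integral_le partial_ens_integrable integrable_const_ivl) (blast intro: order_trans)
    then have int: "ens integrable_on {a..b}"
      by (rule ens_integrable)
    have "integral {a..b} ?f \<le> integral {a..b} ens"
      by (intro integral_le partial_ens_integrable int sum_le_ens) auto
    also have "\<dots> \<le> ke"
      using ab cd by (intro integral_ens_le_ke int) auto
    finally show ?thesis .
  qed
  show "integral {c..d} ?f \<le> ke"
  proof (rule field_le_epsilon)
    fix \<epsilon> :: real assume \<epsilon>: "0 < \<epsilon>"
    \<comment> \<open>The two end pieces cost at most \<open>2 * B * h\<close>, with
      \<open>B\<close> the maximum of the fixed partial sum; a third of the length leaves room for
      the middle piece.\<close>
    define h where "h = min ((d - c) / 3) (\<epsilon> / (2 * (B + 1)))"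
    have B: "0 \<le> B"
      by (simp add: B_def f0)
    have h: "0 < h" "c + h \<le> d - h"
      using cd \<epsilon> B by (auto simp: h_def min_def field_simps)
    have "h \<le> \<epsilon> / (2 * (B + 1))"
      by (simp add: h_def)
    then have hB: "2 * (B * h) \<le> \<epsilon>"
      using B h by (simp add: field_simps)
    have end_le: "integral {a..b} ?f \<le> B * (b - a)" if "c \<le> a" "a \<le> b" "b \<le> d" for a b
    proof -
      have "integral {a..b} ?f \<le> integral {a..b} (\<lambda>t. B)"
        using r that by (intro integral_le partial_ens_integrable integrable_const_ivl) (auto simp: B_def)
      then show ?thesis
        using that by (simp add: mult.commute)
    qed
    have "integral {c..d} ?f = integral {c..c+h} ?f + (integral {c+h..d-h} ?f + integral {d-h..d} ?f)"
      using Henstock_Kurzweil_Integration.integral_combine[OF _ _ partial_ens_integrable, of c "c + h" d "sq_box n"]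
        Henstock_Kurzweil_Integration.integral_combine[OF _ _ partial_ens_integrable, of "c + h" "d - h" d "sq_box n"] h
      by simp
    also have "\<dots> \<le> B * h + (ke + B * h)"
      using h end_le[of c "c + h"] end_le[of "d - h" d] inner[of "c + h" "d - h"] by simp
    finally show "integral {c..d} ?f \<le> ke + \<epsilon>"
      using hB by simp
  qed
qed

text \<open>One doubling for each piece of mass 1/2 that \<open>integral_Gronwall\<close> cuts from
  a total mass of at most \<open>cg * (1 + ke)\<close>.\<close>

definition "kg = (2::real) ^ nat \<lceil>2 * (cg * (1 + ke))\<rceil>"

lemma kg_pos: "0 < kg"
  by (simp add: kg_def)

text \<open>Gronwall is run on the truncated enstrophies, with a factor that does not depend on the
  truncation. Any finite part of the enstrophy is already seen by a large enough
  \<open>R\<close>.\<close>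

lemma ens_growth:
  assumes int: "ens integrable_on {s..t}" and st: "s \<le> t" "t \<le> s + 1"
  shows "1 + ens t \<le> kg * (1 + ens s)"
proof -
  define \<beta> where "\<beta> r = cg * (1 + ens r)" for r
  have \<beta>: "\<beta> integrable_on {s..t}" "\<And>r. 0 \<le> \<beta> r"
    unfolding \<beta>_def using cg_nonneg ens_nonneg
    by (auto intro!: integrable_on_mult_right Henstock_Kurzweil_Integration.integrable_add
        integrable_const_ivl int)
  have "integral {s..t} \<beta> = cg * ((t - s) + integral {s..t} ens)"
    unfolding \<beta>_def using st int
    by (simp add: Henstock_Kurzweil_Integration.integral_add integrable_const_ivl)
  also have "\<dots> \<le> cg * (1 + ke)"
    using st integral_ens_le_ke[OF int st] by (intro mult_left_mono cg_nonneg) auto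
  also have "\<dots> \<le> real (nat \<lceil>2 * (cg * (1 + ke))\<rceil>) / 2"
    by linarith
  finally have m: "integral {s..t} \<beta> \<le> real (nat \<lceil>2 * (cg * (1 + ke))\<rceil>) / 2" .
  have trunc: "1 + wen (\<lambda>k. min (kn k) R) t \<le> kg * (1 + ens s)" if R: "0 \<le> R" for R
  proof -
    define w where "w = (\<lambda>k. min (kn k) R)"
    have w: "0 \<le> w k" "w k \<le> R" for k
      using R by (auto simp: w_def)
    let ?P = "\<lambda>r. infsum (pow w r) UNIV"
    have int': "ens integrable_on {a..b}" if "s \<le> a" "b \<le> t" for a b
      using int that by (rule_tac integrable_on_subinterval) auto
    have P: "(?P has_integral (wen w b - wen w a)) {a..b}" if "s \<le> a" "a \<le> b" "b \<le> t" for a b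
      using that int' by (intro energy_identity[OF w]) auto
    \<comment> \<open>The truncated enstrophy inherits continuity from being an indefinite
      integral.\<close>
    have "continuous_on {s..t} (\<lambda>r. 1 + wen w s + integral {s..r} ?P)"
      using P[of s t] st by (intro continuous_intros indefinite_integral_continuous_1) auto
    moreover have "1 + wen w s + integral {s..r} ?P = 1 + wen w r" if "r \<in> {s..t}" for r
      using integral_unique[OF P[of s r]] that by simp
    ultimately have cont: "continuous_on {s..t} (\<lambda>r. 1 + wen w r)"
      by (rule continuous_on_eq)
    have "1 + wen w t \<le> 2 ^ nat \<lceil>2 * (cg * (1 + ke))\<rceil> * (1 + wen w s)"
    proof (rule integral_Gronwall[OF st(1) cont _ \<beta> _ m])
      fix a b S assume ab: "s \<le> a" "a \<le> b" "b \<le> t" and S: "\<And>r. r \<in> {a..b} \<Longrightarrow> 1 + wen w r \<le> S"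
      have "wen w b - wen w a \<le> S * integral {a..b} \<beta>"
      proof (rule has_integral_le[OF P[OF ab]])
        have "\<beta> integrable_on {a..b}"
          using \<beta>(1) ab by (rule_tac integrable_on_subinterval) auto
        then show "((\<lambda>r. S * \<beta> r) has_integral S * integral {a..b} \<beta>) {a..b}"
          by (intro has_integral_mult_right integrable_integral)
        fix r assume r: "r \<in> {a..b}"
        have "?P r \<le> \<beta> r * (1 + wen w r)"
          using infsum_pow_min_le[OF R, of r] by (simp add: w_def \<beta>_def)
        also have "\<dots> \<le> \<beta> r * S"
          by (intro mult_left_mono S r \<beta>(2))
        finally show "?P r \<le> S * \<beta> r"
          by (simp add: mult.commute)
      qed
      then show "1 + wen w b \<le> 1 + wen w a + S * integral {a..b} \<beta>"
        by simp
    qed (simp add: wen_nonneg)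
    also have "wen w s \<le> ens s"
      unfolding wen_def ens_def
    proof (intro infsum_mono summable_wen[OF w] summable_ens)
      show "(w k * norm (u s k))\<^sup>2 \<le> (kn k * norm (u s k))\<^sup>2" for k
        using w[of k] by (intro power_mono mult_right_mono) (auto simp: w_def)
    qed
    finally show ?thesis
      by (simp add: kg_def w_def)
  qed
  have "ens t \<le> kg * (1 + ens s) - 1"
  proof (rule ens_le)
    fix F :: "(int \<times> int) set" assume F: "finite F"
    define R where "R = Max (insert 0 (kn ` F))"
    have R: "0 \<le> R" "\<And>k. k \<in> F \<Longrightarrow> kn k \<le> R"
      using F by (auto simp: R_def)
    have "(\<Sum>k\<in>F. (kn k * norm (u t k))\<^sup>2) = (\<Sum>k\<in>F. (min (kn k) R * norm (u t k))\<^sup>2)"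
      using R(2) by (intro sum.cong refl) (simp add: min_absorb1)
    also have "\<dots> \<le> wen (\<lambda>k. min (kn k) R) t"
      unfolding wen_def using R(1)
      by (intro finite_sum_le_infsum_UNIV summable_wen[of _ R] F) auto
    also have "\<dots> \<le> kg * (1 + ens s) - 1"
      using trunc[OF R(1)] by simp
    finally show "(\<Sum>k\<in>F. (kn k * norm (u t k))\<^sup>2) \<le> kg * (1 + ens s) - 1" .
  qed
  then show ?thesis
    by simp
qed

section \<open>Local boundedness of the enstrophy by a category argument\<close>

lemma closed_ens_le: "closed {t. ens t \<le> B}"
proof -
  \<comment> \<open>A supremum of continuous functions is lower semicontinuous.\<close>
  have "{t. ens t \<le> B} = (\<Inter>n. {t. (\<Sum>k\<in>sq_box n. (kn k * norm (u t k))\<^sup>2) \<le> B})"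
  proof (intro equalityI subsetI INT_I; clarsimp)
    fix t n assume "ens t \<le> B"
    then show "(\<Sum>k\<in>sq_box n. (kn k * norm (u t k))\<^sup>2) \<le> B"
      using sum_le_ens[OF finite_sq_box] order_trans by blast
  next
    fix t assume "\<forall>n. (\<Sum>k\<in>sq_box n. (kn k * norm (u t k))\<^sup>2) \<le> B"
    then show "ens t \<le> B"
      by (intro LIMSEQ_le_const2[OF ens_lim]) auto
  qed
  then show ?thesis
    by (auto intro!: closed_INT closed_Collect_le continuous_partial_ens)
qed

definition "locally_bounded_at t \<longleftrightarrow> (\<exists>\<epsilon>>0. \<exists>B. \<forall>s. \<bar>s - t\<bar> < \<epsilon> \<longrightarrow> ens s \<le> B)"

lemma open_locally_bounded: "open {t. locally_bounded_at t}"
  unfolding open_dist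
proof (intro ballI)
  fix t assume "t \<in> {t. locally_bounded_at t}"
  then obtain \<epsilon> B where \<epsilon>: "\<epsilon> > 0" "\<And>s. \<bar>s - t\<bar> < \<epsilon> \<Longrightarrow> ens s \<le> B"
    by (auto simp: locally_bounded_at_def)
  have "locally_bounded_at r" if r: "dist r t < \<epsilon> / 2" for r
    unfolding locally_bounded_at_def
  proof (intro exI conjI allI impI)
    fix s assume "\<bar>s - r\<bar> < \<epsilon> / 2"
    then have "\<bar>s - t\<bar> < \<epsilon>"
      using r unfolding dist_real_def by linarith
    then show "ens s \<le> B"
      by (rule \<epsilon>(2))
  qed (use \<epsilon>(1) in simp)
  then show "\<exists>e>0. \<forall>r. dist r t < e \<longrightarrow> r \<in> {t. locally_bounded_at t}"
    using \<epsilon>(1) by (intro exI[of _ "\<epsilon> / 2"]) auto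
qed

lemma ens_bounded_on_compact:
  assumes "\<And>t. t \<in> {a..b} \<Longrightarrow> locally_bounded_at t"
  shows "\<exists>B. \<forall>t\<in>{a..b}. ens t \<le> B"
proof -
  have "\<forall>t. \<exists>\<epsilon> B. t \<in> {a..b} \<longrightarrow> \<epsilon> > 0 \<and> (\<forall>s. \<bar>s - t\<bar> < \<epsilon> \<longrightarrow> ens s \<le> B)"
    using assms unfolding locally_bounded_at_def by blast
  then obtain \<epsilon> B where eB: "\<And>t. t \<in> {a..b} \<Longrightarrow> \<epsilon> t > 0 \<and> (\<forall>s. \<bar>s - t\<bar> < \<epsilon> t \<longrightarrow> ens s \<le> B t)"
    by metis
  have cover: "{a..b} \<subseteq> (\<Union>t\<in>{a..b}. ball t (\<epsilon> t))"
    using eB by force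
  obtain C where C: "C \<subseteq> {a..b}" "finite C" "{a..b} \<subseteq> (\<Union>t\<in>C. ball t (\<epsilon> t))"
    using compactE_image[OF compact_Icc _ cover] by auto
  have "ens t \<le> Max (insert 0 (B ` C))" if t: "t \<in> {a..b}" for t
  proof -
    obtain r where r: "r \<in> C" "t \<in> ball r (\<epsilon> r)"
      using C t by blast
    then have "ens t \<le> B r"
      using eB[of r] C by (auto simp: dist_real_def abs_minus_commute)
    also have "\<dots> \<le> Max (insert 0 (B ` C))"
      using r C by (intro Max_ge) auto
    finally show ?thesis .
  qed
  then show ?thesis by blast
qed

text \<open>A solution is only required to lie in \<open>V\<close> at each time. By Baire, \<open>ens\<close> would be bounded on a
  relatively open piece of the closed set of bad times; on the gaps of that set it is controlled by
  its value at the left end of the gap, so the times in question would not be bad.\<close>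

lemma ens_locally_bounded: "locally_bounded_at t"
proof (rule ccontr)
  assume bad: "\<not> locally_bounded_at t"
  define E where "E = {t. \<not> locally_bounded_at t}"
  have clE: "closed E"
    using open_locally_bounded unfolding E_def closed_def by (simp add: Collect_neg_eq)
  \<comment> \<open>These are relatively open in \<open>E\<close>, and their intersection is empty
    because \<open>ens\<close> is finite at every time. By Baire some \<open>T n\<close> is not
    dense in \<open>E\<close>, so all bad times near some bad \<open>t0\<close> share the bound
    \<open>n\<close>.\<close>
  define T where "T n = E - {t. ens t \<le> real n}" for n :: nat
  have opT: "openin (top_of_set E) (T n)" for n
    unfolding openin_open using closed_ens_le[of "real n"]
    by (intro exI[of _ "- {t. ens t \<le> real n}"]) (auto simp: T_def)
  have "(\<Inter>n. T n) = {}"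
  proof -
    have "\<exists>n. t \<notin> T n" for t
      using real_arch_simple[of "ens t"] by (auto simp: T_def)
    then show ?thesis by blast
  qed
  then have "\<not> E \<subseteq> closure (\<Inter>(range T))"
    using bad by (auto simp: E_def)
  then obtain n where "\<not> E \<subseteq> closure (T n)"
    using Baire[OF clE, of "range T"] opT by blast
  then obtain t0 where t0: "t0 \<in> E" "t0 \<notin> closure (T n)"
    by blast
  then obtain \<epsilon> where \<epsilon>: "\<epsilon> > 0" "\<And>s. \<bar>s - t0\<bar> < \<epsilon> \<Longrightarrow> s \<notin> T n"
    by (auto simp: closure_approachable dist_real_def)
  then have En: "ens s \<le> real n" if "\<bar>s - t0\<bar> < \<epsilon>" "s \<in> E" for s
    using that by (auto simp: T_def)
  \<comment> \<open>The window has length at most 1, so \<open>ens_growth\<close> applies on every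
    gap inside it.\<close>
  define h where "h = min (\<epsilon> / 2) (1 / 2)"
  have h: "0 < h" "h < \<epsilon>" "h \<le> 1 / 2"
    using \<epsilon>(1) by (auto simp: h_def)
  define a where "a = t0 - h"
  \<comment> \<open>The left end \<open>a\<close> of the window may be a good time, so its value is
    taken into the bound as well.\<close>
  define B0 where "B0 = max (real n) (ens a)"
  have bnd: "1 + ens r \<le> max 1 kg * (1 + B0)" if r: "a \<le> r" "r \<le> t0 + h" for r
  proof -
    \<comment> \<open>Its supremum is the last bad time up to \<open>r\<close>, or \<open>a\<close>
      if there is none; everything after it up to \<open>r\<close> is a gap.\<close>
    define C where "C = (E \<union> {a}) \<inter> {a..r}"
    have "closed C"
      unfolding C_def using clE by (intro closed_Int closed_Un) auto
    moreover have "C \<noteq> {}" "bdd_above C"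
      using r by (auto simp: C_def)
    ultimately have cC: "Sup C \<in> C" and Sup_ge: "\<And>x. x \<in> C \<Longrightarrow> x \<le> Sup C"
      by (auto intro: closed_contains_Sup cSup_upper)
    define c where "c = Sup C"
    have c: "a \<le> c" "c \<le> r" "c \<in> E \<or> c = a"
      using cC unfolding c_def[symmetric] by (auto simp: C_def)
    have ensc: "ens c \<le> B0"
    proof (cases "c = a")
      case False
      have "\<bar>c - t0\<bar> < \<epsilon>"
        using c(1,2) r h unfolding a_def by linarith
      then have "ens c \<le> real n"
        using False c(3) by (intro En) auto
      then show ?thesis
        by (simp add: B0_def)
    qed (simp add: B0_def)
    have good: "locally_bounded_at s" if "c < s" "s \<le> r" for s
    proof (rule ccontr)
      assume "\<not> locally_bounded_at s"
      then have "s \<in> C"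
        using that c by (auto simp: C_def E_def)
      then show False
        using Sup_ge[of s] that by (simp add: c_def)
    qed
    show ?thesis
    proof (cases "c = r")
      case True
      then have "1 + ens r \<le> 1 * (1 + B0)"
        using ensc by simp
      also have "\<dots> \<le> max 1 kg * (1 + B0)"
        by (intro mult_right_mono) (auto simp: B0_def)
      finally show ?thesis .
    next
      case False
      then have cr: "c < r" "r \<le> c + 1"
        using c r h by (auto simp: a_def)
      have "ens integrable_on {c..r}"
        using cr by (rule ens_integrable_gap) (auto intro!: ens_bounded_on_compact good)
      then have "1 + ens r \<le> kg * (1 + ens c)"
        using cr by (intro ens_growth) auto
      also have "\<dots> \<le> max 1 kg * (1 + B0)"
        using ensc kg_pos ens_nonneg[of c] by (intro mult_mono) (auto simp: B0_def)
      finally show ?thesis .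
    qed
  qed
  have "locally_bounded_at t0"
    unfolding locally_bounded_at_def
  proof (intro exI conjI allI impI)
    fix s assume "\<bar>s - t0\<bar> < h"
    then have "a \<le> s" "s \<le> t0 + h"
      unfolding a_def by linarith+
    from bnd[OF this] show "ens s \<le> max 1 kg * (1 + B0) - 1"
      by simp
  qed (rule h(1))
  then show False
    using t0 by (simp add: E_def)
qed

lemma ens_integrable_unit: "c < d \<Longrightarrow> d \<le> c + 1 \<Longrightarrow> ens integrable_on {c..d}"
  by (rule ens_integrable_gap) (auto intro!: ens_bounded_on_compact ens_locally_bounded)

text \<open>Uniform Gronwall: the value at \<open>t\<close> is at most \<open>kg\<close> times each
  value during the preceding unit of time. Averaging over that unit replaces the unknown initial
  value by the mean, which the energy controls.\<close>

lemma ens_uniformly_bounded: "1 + ens t \<le> kg * (1 + ke)"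
proof -
  have int: "ens integrable_on {t - 1..t}"
    by (rule ens_integrable_unit) auto
  have le: "1 + ens t \<le> kg * (1 + ens s)" if "s \<in> {t - 1..t}" for s
  proof (cases "s = t")
    case True
    have "1 * (1 + ens t) \<le> kg * (1 + ens t)"
      using ens_nonneg[of t] by (intro mult_right_mono) (auto simp: kg_def)
    then show ?thesis
      by (simp add: True)
  next
    case False
    then show ?thesis
      using that by (intro ens_growth ens_integrable_unit) auto
  qed
  have "integral {t - 1..t} (\<lambda>s. 1 + ens t) \<le> integral {t - 1..t} (\<lambda>s. kg * (1 + ens s))"
    by (rule integral_le) (auto intro!: le integrable_on_mult_right integrable_const_ivl int
        Henstock_Kurzweil_Integration.integrable_add)
  also have "\<dots> = kg * (1 + integral {t - 1..t} ens)"
    using int by (simp add: Henstock_Kurzweil_Integration.integral_add integrable_const_ivl)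
  also have "\<dots> \<le> kg * (1 + ke)"
    using int kg_pos by (intro mult_left_mono add_left_mono integral_ens_le_ke) auto
  finally show ?thesis
    by simp
qed

end

section \<open>Decay of the Fourier coefficients\<close>

text \<open>Starting at time \<open>t - r\<close>, the initial value contributes at most
  \<open>B * exp (- \<mu> * r)\<close>, which vanishes as \<open>r\<close> grows. Comparing the
  derivative of \<open>exp (\<mu> * x) *\<^sub>R z x\<close> with that of
  \<open>N / \<mu> * exp (\<mu> * x)\<close> replaces the integral in the variation of
  constants.\<close>

lemma norm_relaxation_le:
  fixes z n :: "real \<Rightarrow> 'a::real_normed_vector"
  assumes \<mu>: "0 < \<mu>" and z': "\<And>t. (z has_vector_derivative (- (\<mu> *\<^sub>R z t) - n t)) (at t)"
    and n: "\<And>t. norm (n t) \<le> N" and B: "\<And>t. norm (z t) \<le> B"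
  shows "norm (z t) \<le> N / \<mu>"
proof -
  have step: "norm (z t) \<le> N / \<mu> + B * exp (- \<mu> * r)" if r: "0 < r" for r
  proof -
    define s where "s = t - r"
    let ?f = "\<lambda>x. exp (\<mu> * x) *\<^sub>R z x" and ?\<phi> = "\<lambda>x. N / \<mu> * exp (\<mu> * x)"
    have f': "(?f has_vector_derivative - (exp (\<mu> * x) *\<^sub>R n x)) (at x)" for x
    proof -
      have "((\<lambda>x. exp (\<mu> * x)) has_real_derivative exp (\<mu> * x) * \<mu>) (at x)"
        by (auto intro!: derivative_eq_intros)
      from has_vector_derivative_scaleR[OF this z'[of x]] show ?thesis
        by (simp add: algebra_simps)
    qed
    have \<phi>': "(?\<phi> has_vector_derivative N * exp (\<mu> * x)) (at x)" for x
      unfolding has_real_derivative_iff_has_vector_derivative[symmetric]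
      using \<mu> by (auto intro!: derivative_eq_intros)
    have "norm (?f t - ?f s) \<le> ?\<phi> t - ?\<phi> s"
    proof (rule differentiable_bound_general)
      show "s < t" using r by (simp add: s_def)
      show "continuous_on {s..t} ?f" "continuous_on {s..t} ?\<phi>"
        using has_vector_derivative_continuous[OF f'] has_vector_derivative_continuous[OF \<phi>']
        by (auto intro!: continuous_at_imp_continuous_on)
      show "norm (- (exp (\<mu> * x) *\<^sub>R n x)) \<le> N * exp (\<mu> * x)" for x
        using n[of x] by (simp add: mult.commute mult_right_mono)
    qed (rule f' \<phi>')+
    moreover have "0 \<le> N / \<mu> * exp (\<mu> * s)"
      using order_trans[OF norm_ge_zero n] \<mu> by simp
    moreover have "norm (?f t) \<le> norm (?f t - ?f s) + norm (?f s)"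
      by (metis add.commute norm_triangle_sub)
    moreover have "norm (?f s) \<le> B * exp (\<mu> * s)"
      using B[of s] by (simp add: mult.commute mult_right_mono)
    ultimately have "norm (?f t) \<le> N / \<mu> * exp (\<mu> * t) + B * exp (\<mu> * s)"
      by linarith
    then have "norm (z t) * exp (\<mu> * t) \<le> N / \<mu> * exp (\<mu> * t) + B * exp (\<mu> * s)"
      by (simp add: mult.commute)
    also have "exp (\<mu> * s) = exp (- \<mu> * r) * exp (\<mu> * t)"
      by (simp add: s_def algebra_simps flip: exp_add)
    finally have "norm (z t) * exp (\<mu> * t) \<le> (N / \<mu> + B * exp (- \<mu> * r)) * exp (\<mu> * t)"
      by (simp add: distrib_right)
    then show ?thesis
      by simp
  qed
  have "((\<lambda>r. N / \<mu> + B * exp (- \<mu> * r)) \<longlongrightarrow> N / \<mu> + B * 0) at_top"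
  proof (intro tendsto_intros filterlim_compose[OF exp_at_bot])
    show "filterlim (\<lambda>r. - \<mu> * r) at_bot at_top"
      using \<mu> by (intro filterlim_tendsto_neg_mult_at_bot[OF tendsto_const _ filterlim_ident]) simp
  qed
  then have "norm (z t) \<le> N / \<mu> + B * 0"
    by (rule tendsto_lowerbound[OF _ eventually_mono[OF eventually_gt_at_top[of 0] step]]) auto
  then show ?thesis
    by simp
qed

definition rapid :: "(int \<times> int \<Rightarrow> complex ^ 2) \<Rightarrow> bool" where
  "rapid c \<longleftrightarrow> (\<forall>p. \<exists>A. \<forall>k. qn k ^ p * norm (c k) \<le> A)"

lemma of_real_smult_vec: "complex_of_real r *s v = r *\<^sub>R (v :: complex ^ 2)"
  unfolding vec_eq_iff vector_smult_component vector_scaleR_component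
  by (intro allI scaleR_conv_of_real[symmetric])

section \<open>Bootstrap of the decay rates\<close>

context bounded_solution
begin

abbreviation "nl t k \<equiv> nonlin L (u t) (u t) k"

text \<open>\<open>g k\<close> divided by \<open>\<mu>\<close> is the steady Stokes flow; the
  deviation from it relaxes at rate \<open>\<mu>\<close> under the nonlinear term.\<close>

lemma norm_u_diff_steady_le:
  assumes "k \<noteq> 0" "\<And>t. norm (nl t k) \<le> N"
  defines "\<mu> \<equiv> \<kappa> * ksq k"
  shows "norm (u t k - (1 / \<mu>) *\<^sub>R g k) \<le> N / \<mu>"
proof -
  have \<mu>: "0 < \<mu>"
    using kappa_pos kn_pos[OF assms(1)] by (simp add: \<mu>_def kn_sq[symmetric])
  show ?thesis
  proof (rule norm_relaxation_le[OF \<mu>, where n = "\<lambda>t. nl t k"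
        and z = "\<lambda>t. u t k - (1 / \<mu>) *\<^sub>R g k"])
    fix t
    have "rhs t k = - (\<mu> *\<^sub>R (u t k - (1 / \<mu>) *\<^sub>R g k)) - nl t k"
      using \<mu> unfolding rhs_def \<mu>_def[symmetric] of_real_smult_vec scaleR_diff_right by simp
    then show "((\<lambda>t. u t k - (1 / \<mu>) *\<^sub>R g k) has_vector_derivative
        - (\<mu> *\<^sub>R (u t k - (1 / \<mu>) *\<^sub>R g k)) - nl t k) (at t)"
      using has_vector_derivative_diff[OF deriv_u[of k t] has_vector_derivative_const] by simp
    show "norm (u t k - (1 / \<mu>) *\<^sub>R g k) \<le> sqrt M + norm ((1 / \<mu>) *\<^sub>R g k)"
      using norm_triangle_ineq4 norm_u_le[of t k] by (meson add_right_mono order_trans)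
  qed (rule assms)
qed

lemma
  assumes "\<And>t. norm (nl t k) \<le> N"
  shows ksq_norm_u_le: "ksq k * norm (u t k) \<le> (norm (g k) + N) / \<kappa>"
    and norm_g_le: "norm (g k) \<le> \<kappa> * (ksq k * norm (u t k)) + N"
proof -
  have N: "0 \<le> N"
    using order_trans[OF norm_ge_zero assms] .
  have "ksq k * norm (u t k) \<le> (norm (g k) + N) / \<kappa> \<and> norm (g k) \<le> \<kappa> * (ksq k * norm (u t k)) + N"
  proof (cases "k = 0")
    case True
    then show ?thesis
      using N kappa_pos by (simp add: in_H_0[OF g] kn_sq[symmetric])
  next
    case False
    define \<mu> where "\<mu> = \<kappa> * ksq k"
    have \<mu>: "0 < \<mu>"
      using kappa_pos kn_pos[OF False] by (simp add: \<mu>_def kn_sq[symmetric])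
    have "\<mu> *\<^sub>R (u t k - (1 / \<mu>) *\<^sub>R g k) = \<mu> *\<^sub>R u t k - g k"
      using \<mu> by (simp add: scaleR_diff_right)
    then have "norm (\<mu> *\<^sub>R u t k - g k) = \<mu> * norm (u t k - (1 / \<mu>) *\<^sub>R g k)"
      using \<mu> by (metis norm_scaleR abs_of_pos)
    also have "\<dots> \<le> N"
      using norm_u_diff_steady_le[OF False assms, of t] \<mu> by (simp add: \<mu>_def field_simps)
    finally have d: "norm (\<mu> *\<^sub>R u t k - g k) \<le> N" .
    have "\<mu> * norm (u t k) \<le> norm (g k) + N"
      using d norm_triangle_sub[of "\<mu> *\<^sub>R u t k" "g k"] \<mu> by simp
    moreover have "norm (g k) \<le> \<mu> * norm (u t k) + N"
      using d norm_triangle_sub[of "g k" "\<mu> *\<^sub>R u t k"] \<mu> by (simp add: norm_minus_commute)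
    ultimately show ?thesis
      using kappa_pos by (simp add: \<mu>_def field_simps)
  qed
  then show "ksq k * norm (u t k) \<le> (norm (g k) + N) / \<kappa>"
    "norm (g k) \<le> \<kappa> * (ksq k * norm (u t k)) + N" by auto
qed

definition "u_dec p \<longleftrightarrow> (\<exists>A. \<forall>t k. qn k ^ p * norm (u t k) \<le> A)"

definition "n_dec p \<longleftrightarrow> (\<exists>A. \<forall>t k. qn k ^ p * norm (nl t k) \<le> A)"

definition "g_dec p \<longleftrightarrow> (\<exists>A. \<forall>k. qn k ^ p * norm (g k) \<le> A)"

text \<open>The start of the bootstrap, where the uniform bound in V is spent.\<close>

lemma n_dec_0: "n_dec 0"
  unfolding n_dec_def
proof (intro exI allI)
  fix t k
  have "norm (nl t k) \<le> (4 * pi / L) * (kn k * conv (\<lambda>k. norm (u t k)) k)"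
    by (rule norm_nonlin_le[OF L u_in_H])
  also have "\<dots> \<le> (4 * pi / L) * (4 * sqrt (ens t) * sqrt M)"
    using L by (intro mult_left_mono kn_conv_le sum_sq_le sum_le_ens) auto
  also have "\<dots> \<le> (4 * pi / L) * (4 * sqrt (kg * (1 + ke)) * sqrt M)"
    using L ens_uniformly_bounded[of t] M_nonneg by (intro mult_left_mono mult_right_mono) auto
  finally show "qn k ^ 0 * norm (nl t k) \<le> (4 * pi / L) * (4 * sqrt (kg * (1 + ke)) * sqrt M)"
    by simp
qed

text \<open>Of the three half-orders lost, two pay for the derivative and one for the logarithm.
  With \<open>p\<close> at least 1, \<open>u\<close> decays with exponent at least 4, as
  \<open>conv_decay\<close> asks.\<close>

lemma n_dec_of_u_dec:
  assumes "u_dec (p + 3)" "1 \<le> p"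
  shows "n_dec p"
proof -
  obtain A where A: "\<And>t k. qn k ^ (p + 3) * norm (u t k) \<le> A"
    using assms(1) unfolding u_dec_def by blast
  obtain Z where Z: "\<forall>a p A k. (\<forall>k. 0 \<le> a k) \<longrightarrow> a 0 = 0 \<longrightarrow> 4 \<le> p \<longrightarrow> (\<forall>k. qn k ^ p * a k \<le> A)
      \<longrightarrow> qn k ^ (p - 1) * conv a k \<le> Z * 2 ^ p * A\<^sup>2"
    using conv_decay ..
  have "qn k ^ p * norm (nl t k) \<le> (4 * pi / L) * (Z * 2 ^ (p + 3) * A\<^sup>2)" for t k
  proof -
    have "qn k ^ p * norm (nl t k) \<le> qn k ^ p * ((4 * pi / L) * (kn k * conv (\<lambda>k. norm (u t k)) k))"
      by (intro mult_left_mono norm_nonlin_le[OF L u_in_H]) auto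
    also have "\<dots> = (4 * pi / L) * (qn k ^ (p + 3 - 1) * conv (\<lambda>k. norm (u t k)) k)"
      by (simp add: power_add qn_pow2 flip: power2_eq_square)
    also have "\<dots> \<le> (4 * pi / L) * (Z * 2 ^ (p + 3) * A\<^sup>2)"
      using L assms(2) A by (intro mult_left_mono Z[rule_format]) (simp_all add: in_H_0[OF u_in_H])
    finally show ?thesis .
  qed
  then show ?thesis
    unfolding n_dec_def by blast
qed

lemma u_dec_of_dec:
  assumes "g_dec p" "n_dec p"
  shows "u_dec (p + 4)"
proof -
  obtain A where A: "\<And>k. qn k ^ p * norm (g k) \<le> A"
    using assms(1) unfolding g_dec_def by blast
  obtain N where N: "\<And>t k. qn k ^ p * norm (nl t k) \<le> N"
    using assms(2) unfolding n_dec_def by blast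
  have "qn k ^ (p + 4) * norm (u t k) \<le> (A + N) / \<kappa>" for t k
  proof (cases "k = 0")
    case True
    then show ?thesis
      using order_trans[OF _ A[of 0]] order_trans[OF _ N[of 0]] kappa_pos
      by (simp add: in_H_0[OF g] in_H_0[OF u_in_H])
  next
    case False
    then have q: "0 < qn k ^ p"
      using qn_ge_1[of k] by (intro zero_less_power) linarith
    then have "norm (nl t k) \<le> N / qn k ^ p" for t
      using N[of k t] by (simp add: field_simps)
    from ksq_norm_u_le[OF this, of t]
    have "qn k ^ p * (ksq k * norm (u t k)) \<le> qn k ^ p * ((norm (g k) + N / qn k ^ p) / \<kappa>)"
      using q by (intro mult_left_mono) auto
    also have "\<dots> = (qn k ^ p * norm (g k) + N) / \<kappa>"
      unfolding times_divide_eq_right distrib_left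
      using nonzero_mult_div_cancel_left[OF less_imp_neq[OF q, symmetric], of N] by simp
    also have "\<dots> \<le> (A + N) / \<kappa>"
      using A[of k] kappa_pos by (intro divide_right_mono) auto
    finally show ?thesis
      by (simp add: power_add qn_pow4 mult_ac)
  qed
  then show ?thesis
    unfolding u_dec_def by blast
qed

text \<open>Decay of \<open>u\<close> at one time suffices, provided that the nonlinear term is
  controlled at all times.\<close>

lemma g_dec_of_dec:
  assumes "\<And>k. qn k ^ (p + 4) * norm (u t k) \<le> A" "n_dec p"
  shows "g_dec p"
proof -
  obtain N where N: "\<And>t k. qn k ^ p * norm (nl t k) \<le> N"
    using assms(2) unfolding n_dec_def by blast
  have "qn k ^ p * norm (g k) \<le> \<kappa> * A + N" for k
  proof (cases "k = 0")
    case True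
    then show ?thesis
      using order_trans[OF _ assms(1)[of 0]] order_trans[OF _ N[of 0]] kappa_pos
      by (simp add: in_H_0[OF g] in_H_0[OF u_in_H])
  next
    case False
    then have q: "0 < qn k ^ p"
      using qn_ge_1[of k] by (intro zero_less_power) linarith
    then have "norm (nl t k) \<le> N / qn k ^ p" for t
      using N[of k t] by (simp add: field_simps)
    from norm_g_le[OF this, of t]
    have "qn k ^ p * norm (g k) \<le> qn k ^ p * (\<kappa> * (ksq k * norm (u t k)) + N / qn k ^ p)"
      using q by (intro mult_left_mono) auto
    also have "\<dots> = \<kappa> * (qn k ^ (p + 4) * norm (u t k)) + N"
      unfolding times_divide_eq_right distrib_left
      using nonzero_mult_div_cancel_left[OF less_imp_neq[OF q, symmetric], of N]
      by (simp add: power_add qn_pow4 mult_ac)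
    also have "\<dots> \<le> \<kappa> * A + N"
      using assms(1)[of k] kappa_pos by simp
    finally show ?thesis .
  qed
  then show ?thesis
    unfolding g_dec_def by blast
qed

lemma g_dec_mono:
  assumes "g_dec p" "q \<le> p"
  shows "g_dec q"
proof -
  obtain A where A: "\<And>k. qn k ^ p * norm (g k) \<le> A"
    using assms(1) unfolding g_dec_def by blast
  have "qn k ^ q * norm (g k) \<le> A" for k
  proof (cases "k = 0")
    case True
    then show ?thesis
      using order_trans[OF _ A[of 0]] by (simp add: in_H_0[OF g])
  next
    case False
    then have "qn k ^ q * norm (g k) \<le> qn k ^ p * norm (g k)"
      using assms(2) qn_ge_1[of k] by (intro mult_right_mono power_increasing) auto
    then show ?thesis
      using A[of k] by linarith
  qed
  then show ?thesis
    unfolding g_dec_def by blast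
qed

text \<open>Exponent \<open>j + 4\<close> for \<open>u\<close> gives \<open>j + 1\<close> for the
  nonlinear term and then \<open>j + 5\<close> for \<open>u\<close>, as long as \<open>g\<close>
  keeps up, that is, up to \<open>p\<close>.\<close>

lemma u_dec_of_g_dec:
  assumes "g_dec p"
  shows "u_dec (p + 4)"
proof -
  have "u_dec (j + 4)" if "j \<le> p" for j
    using that
  proof (induction j)
    case 0
    then show ?case
      using u_dec_of_dec[OF g_dec_mono[OF assms] n_dec_0] by simp
  next
    case (Suc j)
    then have "n_dec (Suc j)"
      by (intro n_dec_of_u_dec) (auto simp: add.commute)
    then show ?case
      using Suc.prems by (intro u_dec_of_dec g_dec_mono[OF assms]) auto
  qed
  then show ?thesis by simp
qed

lemma rapid_u:
  assumes "rapid g"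
  shows "rapid (u t)"
  unfolding rapid_def
proof
  fix p
  have "g_dec p"
    using assms unfolding rapid_def g_dec_def by blast
  then have "u_dec (p + 4)"
    by (intro u_dec_of_g_dec)
  then obtain A where A: "\<And>t k. qn k ^ (p + 4) * norm (u t k) \<le> A"
    unfolding u_dec_def by blast
  have "qn k ^ p * norm (u t k) \<le> A" for k
  proof (cases "k = 0")
    case True
    then show ?thesis
      using order_trans[OF _ A[of 0]] by (simp add: in_H_0[OF u_in_H])
  next
    case False
    then have "qn k ^ p * norm (u t k) \<le> qn k ^ (p + 4) * norm (u t k)"
      using qn_ge_1[of k] by (intro mult_right_mono power_increasing) auto
    then show ?thesis
      using A[of k t] by linarith
  qed
  then show "\<exists>A. \<forall>k. qn k ^ p * norm (u t k) \<le> A"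
    by blast
qed

text \<open>If \<open>g\<close> is of order \<open>qn\<^sup>-\<^sup>p\<close>, the nonlinear term is of order \<open>qn\<^sup>-\<^sup>p\<^sup>-\<^sup>1\<close> uniformly in time, and \<open>g\<close>
  differs from the dissipation of the given smooth state by a time average of that term.\<close>

lemma rapid_g:
  assumes "rapid (u t)"
  shows "rapid g"
proof -
  have "g_dec p" for p
  proof (induction p)
    case 0
    have "norm (g k) \<le> sqrt g2" for k
      using sum_g_le[of "{k}"] by (simp add: real_le_rsqrt)
    then show ?case
      unfolding g_dec_def by auto
  next
    case (Suc p)
    have "u_dec (Suc p + 3)"
      using u_dec_of_g_dec[OF Suc] by (simp add: numeral_eq_Suc)
    then have "n_dec (Suc p)"
      by (rule n_dec_of_u_dec) simp
    moreover obtain A where "\<And>k. qn k ^ (Suc p + 4) * norm (u t k) \<le> A"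
      using assms unfolding rapid_def by blast
    ultimately show ?case
      by (intro g_dec_of_dec)
  qed
  then show ?thesis
    unfolding rapid_def g_dec_def by blast
qed

end

section \<open>Fourier coefficients of smooth functions\<close>

abbreviation period_box :: "real \<Rightarrow> (real ^ 2) set" where
  "period_box L \<equiv> cbox 0 (\<chi> i. L)"

lemma Basis_real_vec: "(Basis :: (real ^ 2) set) = range (\<lambda>i. axis i 1)"
  by (auto simp: Basis_vec_def)

lemma periodic_box_iff: "periodic_box L f \<longleftrightarrow> (\<forall>x i. f (x + L *\<^sub>R axis i 1) = f x)"
  unfolding periodic_box_def Basis_real_vec by auto

text \<open>The shifted box gives up the slab \<open>?B\<close> and acquires \<open>?C\<close>, its
  translate by one period; \<open>?A\<close> is common to both boxes.\<close>

lemma integral_periodic_shift: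
  fixes f :: "real ^ 2 \<Rightarrow> 'b::euclidean_space"
  assumes f: "continuous_on UNIV f" "periodic_box L f" and h: "0 \<le> h" "h \<le> L"
  shows "integral (period_box L) (\<lambda>x. f (x + h *\<^sub>R axis i 1)) = integral (period_box L) f"
proof -
  let ?b = "axis i (1::real) :: real ^ 2" and ?l = "(\<chi> i. L) :: real ^ 2"
  have int: "f integrable_on cbox a b" for a b
    using f(1) by (intro integrable_continuous) (auto intro: continuous_on_subset)
  have ii: "(f has_integral integral (cbox a b) f) (cbox a b)" for a b
    using int by (rule integrable_integral)
  have bB: "?b \<in> Basis"
    by (auto simp: Basis_real_vec)
  have in_b: "x \<bullet> ?b = x $ i" for x
    by (simp add: inner_axis)
  have shift: "integral (cbox a b) (\<lambda>x. f (x + c)) = integral (cbox (a + c) (b + c)) f" for a b c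
    using integral_shift_cbox_plus[of a b f c] by (simp add: o_def add.commute)
  let ?A = "cbox (h *\<^sub>R ?b) ?l" and ?B = "cbox 0 (?l + (h - L) *\<^sub>R ?b)"
    and ?C = "cbox (L *\<^sub>R ?b) (?l + h *\<^sub>R ?b)"
  have "period_box L \<inter> {x. x \<bullet> ?b \<le> h} = ?B" "period_box L \<inter> {x. x \<bullet> ?b \<ge> h} = ?A"
    unfolding in_b using h exhaust_2[of i] by (auto simp: mem_box_cart axis_def forall_2)
  then have 1: "integral (period_box L) f = integral ?B f + integral ?A f"
    using has_integral_split[of f _ 0 ?l ?b h, OF _ _ bB] ii integral_unique by metis
  have "cbox (h *\<^sub>R ?b) (?l + h *\<^sub>R ?b) \<inter> {x. x \<bullet> ?b \<le> L} = ?A"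
    "cbox (h *\<^sub>R ?b) (?l + h *\<^sub>R ?b) \<inter> {x. x \<bullet> ?b \<ge> L} = ?C"
    unfolding in_b using h exhaust_2[of i] by (auto simp: mem_box_cart axis_def forall_2)
  then have 2: "integral (cbox (h *\<^sub>R ?b) (?l + h *\<^sub>R ?b)) f = integral ?A f + integral ?C f"
    using has_integral_split[of f _ "h *\<^sub>R ?b" "?l + h *\<^sub>R ?b" ?b L, OF _ _ bB] ii integral_unique by metis
  have "integral ?B f = integral ?B (\<lambda>x. f (x + L *\<^sub>R ?b))"
    using f(2) by (simp add: periodic_box_iff)
  also have "\<dots> = integral (cbox (0 + L *\<^sub>R ?b) (?l + (h - L) *\<^sub>R ?b + L *\<^sub>R ?b)) f"
    by (rule shift)
  also have "?l + (h - L) *\<^sub>R ?b + L *\<^sub>R ?b = ?l + h *\<^sub>R ?b"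
    by (simp add: scaleR_diff_left)
  finally have 3: "integral ?B f = integral ?C f"
    by simp
  have "integral (period_box L) (\<lambda>x. f (x + h *\<^sub>R ?b)) = integral (cbox (h *\<^sub>R ?b) (?l + h *\<^sub>R ?b)) f"
    using shift[of 0 ?l "h *\<^sub>R ?b"] by simp
  then show ?thesis
    using 1 2 3 by simp
qed

lemma cmod_cis_Taylor_le: "cmod (cis z - 1 - \<i> * of_real z) \<le> z\<^sup>2"
  using Taylor_exp[of "\<i> * of_real z" 1]
  by (simp add: cis_conv_exp norm_mult diff_diff_eq power2_eq_square)

lemma has_vector_derivative_quotient_tendsto:
  fixes f :: "real \<Rightarrow> 'a::real_normed_vector"
  assumes "(f has_vector_derivative D) (at 0)"
  shows "((\<lambda>s. (f s - f 0) /\<^sub>R s) \<longlongrightarrow> D) (at 0)"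
proof (rule LIM_zero_cancel, rule tendsto_norm_zero_cancel)
  have "((\<lambda>s. norm (f s - f 0 - s *\<^sub>R D) / norm s) \<longlongrightarrow> 0) (at 0)"
    using assms by (simp add: has_vector_derivative_def has_derivative_at)
  then show "((\<lambda>s. norm ((f s - f 0) /\<^sub>R s - D)) \<longlongrightarrow> 0) (at 0)"
  proof (rule Lim_transform_eventually)
    show "\<forall>\<^sub>F s in at 0. norm (f s - f 0 - s *\<^sub>R D) / norm s = norm ((f s - f 0) /\<^sub>R s - D)"
      unfolding eventually_at_filter
    proof (intro always_eventually allI impI)
      fix s :: real assume "s \<noteq> 0"
      then have "(f s - f 0) /\<^sub>R s - D = (f s - f 0 - s *\<^sub>R D) /\<^sub>R s"
        by (simp add: scaleR_diff_right)
      then show "norm (f s - f 0 - s *\<^sub>R D) / norm s = norm ((f s - f 0) /\<^sub>R s - D)"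
        by (simp add: divide_inverse mult.commute)
    qed
  qed
qed

section \<open>Plane waves, shifts and derivatives\<close>

definition dotk :: "int \<times> int \<Rightarrow> real ^ 2 \<Rightarrow> real" where
  "dotk k x = x $ 1 * of_int (fst k) + x $ 2 * of_int (snd k)"

definition wave :: "real \<Rightarrow> int \<times> int \<Rightarrow> real ^ 2 \<Rightarrow> complex" where
  "wave L k x = cis ((2 * pi / L) * dotk k x)"

definition kcomp :: "int \<times> int \<Rightarrow> 2 \<Rightarrow> int" where
  "kcomp k i = (if i = 1 then fst k else snd k)"

definition complexify :: "real ^ 2 \<Rightarrow> complex ^ 2" where
  "complexify v = (\<chi> i. complex_of_real (v $ i))"

lemma dotk_add: "dotk k (x + y) = dotk k x + dotk k y"
  by (simp add: dotk_def algebra_simps)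

lemma dotk_axis: "dotk k (h *\<^sub>R axis i 1) = h * of_int (kcomp k i)"
  using exhaust_2[of i] by (auto simp: dotk_def kcomp_def axis_def)

lemma norm_wave [simp]: "cmod (wave L k x) = 1"
  by (simp add: wave_def)

lemma wave_add: "wave L k (x + y) = wave L k x * wave L k y"
  by (simp add: wave_def dotk_add cis_mult distrib_left)

lemma wave_axis: "wave L k (h *\<^sub>R axis i 1) = cis (2 * pi / L * h * of_int (kcomp k i))"
  by (simp add: wave_def dotk_axis mult.assoc)

lemma wave_mult: "wave L j x * wave L k x = wave L (j + k) x"
  by (simp add: wave_def dotk_def cis_mult algebra_simps)

lemma wave_0 [simp]: "wave L 0 x = 1"
  by (simp add: wave_def dotk_def)

lemma cnj_wave: "cnj (wave L k x) = wave L (- k) x"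
  by (simp add: wave_def dotk_def cis_cnj algebra_simps)

lemma continuous_wave: "continuous_on S (wave L k)"
  unfolding wave_def dotk_def by (intro continuous_intros)

lemma wave_period:
  assumes "L > 0"
  shows "wave L k (x + L *\<^sub>R axis i 1) = wave L k x"
proof -
  have "wave L k (L *\<^sub>R axis i 1) = cis (2 * pi * of_int (kcomp k i))"
    using assms by (simp add: wave_axis)
  also have "\<dots> = 1"
    by (simp add: cis_multiple_2pi)
  finally show ?thesis
    by (simp add: wave_add)
qed

lemma bounded_linear_complexify: "bounded_linear complexify"
  unfolding linear_conv_bounded_linear[symmetric]
  by (rule linearI) (simp_all add: complexify_def vec_eq_iff, simp add: scaleR_conv_of_real)

lemma norm_complexify: "norm (complexify v) = norm v"
  by (simp add: complexify_def norm_vec_def)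

lemma bounded_linear_smult: "bounded_linear (\<lambda>v :: complex ^ 2. c *s v)"
  unfolding linear_conv_bounded_linear[symmetric]
  by (rule linearI) (auto simp: vec_eq_iff algebra_simps)

lemma bounded_linear_smult_left: "bounded_linear (\<lambda>z. z *s (v :: complex ^ 2))"
  unfolding linear_conv_bounded_linear[symmetric]
  by (rule linearI) (auto simp: vec_eq_iff algebra_simps)

definition fourier_int :: "real \<Rightarrow> (real ^ 2 \<Rightarrow> complex ^ 2) \<Rightarrow> int \<times> int \<Rightarrow> complex ^ 2" where
  "fourier_int L F k = integral (period_box L) (\<lambda>x. wave L (- k) x *s F x)"

lemma fourier_coeff_eq: "fourier_coeff L \<phi> k = of_real (1 / L\<^sup>2) *s fourier_int L (\<lambda>x. complexify (\<phi> x)) k"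
proof -
  have "exp (- (\<i> * of_real (2 * pi / L)) * of_real (x $ 1 * of_int (fst k) + x $ 2 * of_int (snd k)))
      = wave L (- k) x" for x :: "real ^ 2"
    unfolding wave_def cis_conv_exp dotk_def by (simp add: algebra_simps)
  then show ?thesis
    by (simp add: fourier_coeff_def fourier_int_def complexify_def)
qed

lemma continuous_smult_wave:
  assumes "continuous_on S F"
  shows "continuous_on S (\<lambda>x. wave L k x *s (F x :: complex ^ 2))"
proof -
  have "continuous_on S (\<lambda>x. \<chi> i. wave L k x * F x $ i)"
    by (intro continuous_intros continuous_wave assms)
  then show ?thesis
    by (rule continuous_on_eq) (simp add: vec_eq_iff)
qed

lemma fourier_int_shift:
  assumes "L > 0" and F: "continuous_on UNIV F" "periodic_box L F" and h: "0 \<le> h" "h \<le> L"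
  shows "fourier_int L (\<lambda>x. F (x + h *\<^sub>R axis i 1)) k
    = cis (2 * pi / L * h * of_int (kcomp k i)) *s fourier_int L F k"
proof -
  let ?b = "axis i (1::real) :: real ^ 2" and ?c = "cis (2 * pi / L * h * of_int (kcomp k i))"
  let ?G = "\<lambda>x. wave L (- k) x *s F x"
  have "?c * wave L (- k) (h *\<^sub>R ?b) = 1"
    by (simp add: wave_axis cis_mult kcomp_def)
  then have "wave L (- k) x *s F (x + h *\<^sub>R ?b) = ?c *s ?G (x + h *\<^sub>R ?b)" for x
    by (simp add: wave_add vector_smult_assoc mult.left_commute mult.commute)
  then have "fourier_int L (\<lambda>x. F (x + h *\<^sub>R ?b)) k = integral (period_box L) (\<lambda>x. ?c *s ?G (x + h *\<^sub>R ?b))"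
    unfolding fourier_int_def by presburger
  also have "\<dots> = ?c *s integral (period_box L) (\<lambda>x. ?G (x + h *\<^sub>R ?b))"
  proof (rule integral_linear[OF _ bounded_linear_smult, unfolded o_def])
    have "continuous_on UNIV (\<lambda>x. F (x + h *\<^sub>R ?b))"
      by (rule continuous_on_compose2[OF F(1)]) (auto intro!: continuous_intros)
    then have "continuous_on UNIV (\<lambda>x. wave L (- k) (h *\<^sub>R ?b) *s (wave L (- k) x *s F (x + h *\<^sub>R ?b)))"
      by (intro bounded_linear.continuous_on[OF bounded_linear_smult] continuous_smult_wave)
    then show "(\<lambda>x. ?G (x + h *\<^sub>R ?b)) integrable_on period_box L"
      by (intro integrable_continuous)
         (auto simp: wave_add vector_smult_assoc mult.commute intro: continuous_on_subset)
  qed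
  also have "integral (period_box L) (\<lambda>x. ?G (x + h *\<^sub>R ?b)) = integral (period_box L) ?G"
  proof (rule integral_periodic_shift[OF _ _ h])
    show "periodic_box L ?G"
      using F(2) assms(1) by (simp add: periodic_box_iff wave_period)
  qed (intro continuous_smult_wave F)
  finally show ?thesis
    by (simp add: fourier_int_def)
qed

lemma content_period_box: "L \<ge> 0 \<Longrightarrow> measure lborel (period_box L) = L\<^sup>2"
proof -
  assume "L \<ge> 0"
  then have "period_box L \<noteq> {}"
    by (simp add: interval_ne_empty_cart)
  then show ?thesis
    by (simp add: content_cbox_cart prod_constant power2_eq_square)
qed

lemma norm_fourier_int_le:
  assumes "L > 0" "continuous_on UNIV F" "\<And>x. x \<in> period_box L \<Longrightarrow> norm (F x) \<le> B"
  shows "norm (fourier_int L F k) \<le> B * L\<^sup>2"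
proof -
  have "0 \<in> period_box L"
    using assms(1) by (auto simp: mem_box_cart)
  then have "0 \<le> B"
    using assms(3) norm_ge_zero order_trans by blast
  moreover have "(\<lambda>x. wave L (- k) x *s F x) integrable_on period_box L"
    by (intro integrable_continuous continuous_smult_wave continuous_on_subset[OF assms(2)]) simp
  ultimately have "norm (fourier_int L F k) \<le> B * measure lborel (period_box L)"
    unfolding fourier_int_def
    by (intro has_integral_bound[OF _ integrable_integral]) (auto simp: norm_smult_vec assms(3))
  then show ?thesis
    using assms(1) by (simp add: content_period_box)
qed

lemma Ck_continuous: "Ck n f \<Longrightarrow> continuous_on UNIV f"
  by (cases n) (auto intro!: continuous_at_imp_continuous_on differentiable_imp_continuous_within)

text \<open>Difference quotients take the place of integration by parts: a shift multiplies the
  coefficient by a phase, and (phase - 1) / h tends to the multiplier. On the side of the integral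
  the limit is dominated convergence, with a majorant from the mean value inequality.\<close>

lemma fourier_int_derivative:
  fixes \<phi> :: "real ^ 2 \<Rightarrow> real ^ 2" and i :: 2
  assumes L: "L > 0" and \<phi>: "\<And>x. \<phi> differentiable at x" "periodic_box L \<phi>"
  defines "D \<equiv> \<lambda>x. frechet_derivative \<phi> (at x) (axis i 1)"
  assumes D: "continuous_on UNIV D"
  shows "fourier_int L (\<lambda>x. complexify (D x)) k
    = (\<i> * of_real (2 * pi / L * of_int (kcomp k i))) *s fourier_int L (\<lambda>x. complexify (\<phi> x)) k"
proof -
  let ?b = "axis i (1::real) :: real ^ 2" and ?y = "2 * pi / L * of_int (kcomp k i)"
  define h where "h n = L / real (Suc n)" for n
  have h: "0 < h n" "h n \<le> L" for n
    using L by (auto simp: h_def field_simps)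
  have h0: "h \<longlonglongrightarrow> 0"
    unfolding h_def using tendsto_mult_right[OF LIMSEQ_inverse_real_of_nat, of L] by (simp add: divide_inverse mult.commute)
  have \<phi>c: "continuous_on UNIV \<phi>"
    using \<phi>(1) by (auto intro!: continuous_at_imp_continuous_on differentiable_imp_continuous_within)
  define Fc where "Fc x = complexify (\<phi> x)" for x
  have Fc: "continuous_on UNIV Fc" "periodic_box L Fc"
    using \<phi>(2) unfolding Fc_def
    by (auto intro!: bounded_linear.continuous_on[OF bounded_linear_complexify] \<phi>c simp: periodic_box_iff)
  have der: "((\<lambda>s. \<phi> (x + s *\<^sub>R ?b)) has_vector_derivative D (x + s *\<^sub>R ?b)) (at s)" for x s
  proof -
    have 1: "(\<phi> has_derivative frechet_derivative \<phi> (at (x + s *\<^sub>R ?b))) (at (x + s *\<^sub>R ?b))"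
      using \<phi>(1) frechet_derivative_works by blast
    have 2: "((\<lambda>s. x + s *\<^sub>R ?b) has_derivative (\<lambda>t. t *\<^sub>R ?b)) (at s)"
      by (auto intro!: derivative_eq_intros)
    have "((\<lambda>s. \<phi> (x + s *\<^sub>R ?b)) has_derivative (\<lambda>t. frechet_derivative \<phi> (at (x + s *\<^sub>R ?b)) (t *\<^sub>R ?b))) (at s)"
      using has_derivative_compose[OF 2 1] .
    moreover have "linear (frechet_derivative \<phi> (at (x + s *\<^sub>R ?b)))"
      using 1 has_derivative_linear by blast
    ultimately show ?thesis
      unfolding has_vector_derivative_def D_def by (simp add: linear_scale)
  qed
  \<comment> \<open>A point of the period box moved by at most \<open>L\<close> along an axis stays
    in this box of twice the side.\<close>
  let ?l = "(\<chi> i. 2 * L) :: real ^ 2"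
  have "compact (D ` cbox 0 ?l)"
    using D by (intro compact_continuous_image compact_cbox) (auto intro: continuous_on_subset)
  then obtain B where B: "\<And>x. x \<in> cbox 0 ?l \<Longrightarrow> norm (D x) \<le> B"
    using compact_imp_bounded bounded_iff by (metis imageI)
  have hlim: "filterlim h (at 0) sequentially"
    using h0 h(1) by (auto simp: filterlim_at less_imp_neq[symmetric])
  define Q where "Q n x = (1 / h n) *\<^sub>R (\<phi> (x + h n *\<^sub>R ?b) - \<phi> x)" for n x
  have Qlim: "(\<lambda>n. Q n x) \<longlonglongrightarrow> D x" for x
  proof -
    have "((\<lambda>s. (\<phi> (x + s *\<^sub>R ?b) - \<phi> x) /\<^sub>R s) \<longlongrightarrow> D x) (at 0)"
      using has_vector_derivative_quotient_tendsto[OF der[of x 0, simplified]] by simp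
    from filterlim_compose[OF this hlim] show ?thesis
      by (simp add: Q_def divide_inverse)
  qed
  have Qb: "norm (Q n x) \<le> B" if x: "x \<in> period_box L" for n x
  proof -
    have "norm (\<phi> (x + h n *\<^sub>R ?b) - \<phi> (x + 0 *\<^sub>R ?b)) \<le> B * h n - B * 0"
    proof (rule differentiable_bound_general[OF h(1), where f = "\<lambda>s. \<phi> (x + s *\<^sub>R ?b)" and \<phi> = "\<lambda>s. B * s"])
      show "continuous_on {0..h n} (\<lambda>s. \<phi> (x + s *\<^sub>R ?b))"
        using has_vector_derivative_continuous[OF der] by (intro continuous_at_imp_continuous_on) auto
      show "((\<lambda>s. B * s) has_vector_derivative B) (at s)" for s
        unfolding has_real_derivative_iff_has_vector_derivative[symmetric]
        by (auto intro!: derivative_eq_intros)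
      fix s assume s: "0 < s" "s < h n"
      have "x + s *\<^sub>R ?b \<in> cbox 0 ?l"
        using x s h(2)[of n] exhaust_2[of i] by (auto simp: mem_box_cart axis_def forall_2)
      then show "norm (D (x + s *\<^sub>R ?b)) \<le> B"
        by (rule B)
    qed (auto intro!: continuous_intros der)
    moreover have "norm (Q n x) = norm (\<phi> (x + h n *\<^sub>R ?b) - \<phi> x) / h n"
      using h(1)[of n] by (simp add: Q_def)
    ultimately show ?thesis
      using h(1)[of n] by (simp add: pos_divide_le_eq)
  qed
  let ?v = "fourier_int L Fc k"
  have Fs: "continuous_on UNIV (\<lambda>x. Fc (x + h n *\<^sub>R ?b))" for n
    by (rule continuous_on_compose2[OF Fc(1)]) (auto intro!: continuous_intros)
  have intg: "(\<lambda>x. wave L (- k) x *s G x) integrable_on period_box L"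
    if "continuous_on UNIV G" for G :: "real ^ 2 \<Rightarrow> complex ^ 2"
    by (intro integrable_continuous continuous_smult_wave continuous_on_subset[OF that]) simp
  have eq: "wave L (- k) x *s complexify (Q n x)
      = (1 / h n) *\<^sub>R (wave L (- k) x *s Fc (x + h n *\<^sub>R ?b) - wave L (- k) x *s Fc x)" for n x
    unfolding Q_def Fc_def
    by (simp add: linear_diff linear_scale bounded_linear.linear[OF bounded_linear_complexify]
        bounded_linear.linear[OF bounded_linear_smult])
  have int_eq: "((\<lambda>x. wave L (- k) x *s complexify (Q n x)) has_integral
      (1 / h n) *\<^sub>R ((cis (?y * h n) - 1) *s ?v)) (period_box L)" for n
  proof -
    have "fourier_int L (\<lambda>x. Fc (x + h n *\<^sub>R ?b)) k = cis (?y * h n) *s ?v"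
      using fourier_int_shift[OF L Fc less_imp_le[OF h(1)] h(2)] by (simp add: mult_ac)
    then have "((\<lambda>x. wave L (- k) x *s Fc (x + h n *\<^sub>R ?b)) has_integral cis (?y * h n) *s ?v) (period_box L)"
      using integrable_integral[OF intg[OF Fs[of n]]] unfolding fourier_int_def by metis
    moreover have "((\<lambda>x. wave L (- k) x *s Fc x) has_integral ?v) (period_box L)"
      unfolding fourier_int_def by (rule integrable_integral[OF intg[OF Fc(1)]])
    ultimately have "((\<lambda>x. wave L (- k) x *s complexify (Q n x)) has_integral
        (1 / h n) *\<^sub>R (cis (?y * h n) *s ?v - ?v)) (period_box L)"
      unfolding eq by (intro has_integral_cmul has_integral_diff)
    moreover have "cis (?y * h n) *s ?v - ?v = (cis (?y * h n) - 1) *s ?v"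
      by (simp add: vec_eq_iff algebra_simps)
    ultimately show ?thesis
      by simp
  qed
  have "(\<lambda>n. integral (period_box L) (\<lambda>x. wave L (- k) x *s complexify (Q n x)))
      \<longlonglongrightarrow> integral (period_box L) (\<lambda>x. wave L (- k) x *s complexify (D x))"
  proof (rule dominated_convergence(2)[where h = "\<lambda>_. B"])
    show "(\<lambda>x. wave L (- k) x *s complexify (Q n x)) integrable_on period_box L" for n
      using int_eq by blast
    show "norm (wave L (- k) x *s complexify (Q n x)) \<le> B" if "x \<in> period_box L" for n x
      using Qb[OF that] by (simp add: norm_smult_vec norm_complexify)
    show "(\<lambda>n. wave L (- k) x *s complexify (Q n x)) \<longlonglongrightarrow> wave L (- k) x *s complexify (D x)" for x
      by (intro bounded_linear.tendsto[OF bounded_linear_smult]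
          bounded_linear.tendsto[OF bounded_linear_complexify] Qlim)
  qed (rule integrable_const)
  then have lim1: "(\<lambda>n. (1 / h n) *\<^sub>R ((cis (?y * h n) - 1) *s ?v)) \<longlonglongrightarrow> fourier_int L (\<lambda>x. complexify (D x)) k"
    unfolding fourier_int_def[of L "\<lambda>x. complexify (D x)"] integral_unique[OF int_eq] .
  have "(\<lambda>n. (cis (?y * h n) - 1) /\<^sub>R h n) \<longlonglongrightarrow> \<i> * of_real ?y"
  proof (rule LIM_zero_cancel, rule Lim_null_comparison)
    show "(\<lambda>n. ?y\<^sup>2 * h n) \<longlonglongrightarrow> 0"
      using tendsto_mult_right_zero[OF h0] .
    have "norm ((cis (?y * h n) - 1) /\<^sub>R h n - \<i> * of_real ?y) \<le> ?y\<^sup>2 * h n" for n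
    proof -
      have "(cis (?y * h n) - 1) /\<^sub>R h n - \<i> * of_real ?y
          = (cis (?y * h n) - 1 - \<i> * of_real (?y * h n)) /\<^sub>R h n"
        using h(1)[of n] by (simp add: scaleR_conv_of_real field_simps)
      then have "norm ((cis (?y * h n) - 1) /\<^sub>R h n - \<i> * of_real ?y)
          = cmod (cis (?y * h n) - 1 - \<i> * of_real (?y * h n)) / h n"
        using h(1)[of n] by (simp add: divide_inverse mult.commute)
      also have "\<dots> \<le> (?y * h n)\<^sup>2 / h n"
        using h(1)[of n] by (intro divide_right_mono cmod_cis_Taylor_le) simp
      also have "\<dots> = ?y\<^sup>2 * h n"
        using h(1)[of n] by (simp add: power2_eq_square)
      finally show ?thesis .
    qed
    then show "\<forall>\<^sub>F n in sequentially. norm ((cis (?y * h n) - 1) /\<^sub>R h n - \<i> * of_real ?y) \<le> ?y\<^sup>2 * h n"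
      by (intro always_eventually allI)
  qed
  then have "(\<lambda>n. ((cis (?y * h n) - 1) /\<^sub>R h n) *s ?v) \<longlonglongrightarrow> (\<i> * of_real ?y) *s ?v"
    by (rule bounded_linear.tendsto[OF bounded_linear_smult_left])
  moreover have "(z /\<^sub>R a) *s ?v = (1 / a) *\<^sub>R (z *s ?v)" for z a
    by (simp add: vec_eq_iff divide_inverse)
  ultimately show ?thesis
    using LIMSEQ_unique[OF lim1] unfolding Fc_def by (simp only:)
qed

section \<open>Smoothness and rapid decay\<close>

lemma frechet_derivative_periodic:
  fixes \<phi> :: "real ^ 2 \<Rightarrow> real ^ 2"
  assumes "\<And>x. \<phi> differentiable at x" "periodic_box L \<phi>"
  shows "periodic_box L (\<lambda>x. frechet_derivative \<phi> (at x) v)"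
  unfolding periodic_box_iff
proof (intro allI)
  fix x i
  let ?c = "L *\<^sub>R axis i 1 :: real ^ 2"
  have 1: "(\<phi> has_derivative frechet_derivative \<phi> (at (x + ?c))) (at (x + ?c))"
    using assms(1) frechet_derivative_works by blast
  have 2: "((\<lambda>x. x + ?c) has_derivative (\<lambda>h. h)) (at x)"
    by (auto intro!: derivative_eq_intros)
  have "((\<lambda>x. \<phi> (x + ?c)) has_derivative frechet_derivative \<phi> (at (x + ?c))) (at x)"
    using has_derivative_compose[OF 2 1] .
  then have "(\<phi> has_derivative frechet_derivative \<phi> (at (x + ?c))) (at x)"
    using assms(2) by (simp add: periodic_box_iff)
  then show "frechet_derivative \<phi> (at (x + ?c)) v = frechet_derivative \<phi> (at x) v"
    by (simp add: frechet_derivative_at[symmetric])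
qed

text \<open>Only pure derivatives along axis \<open>i\<close> are taken; \<open>qn_power_le\<close>
  combines the two axes afterwards.\<close>

lemma Ck_fourier_decay:
  fixes \<phi> :: "real ^ 2 \<Rightarrow> real ^ 2"
  assumes "L > 0" "Ck p \<phi>" "periodic_box L \<phi>"
  shows "\<exists>A. \<forall>k. \<bar>real_of_int (kcomp k i)\<bar> ^ p * norm (fourier_int L (\<lambda>x. complexify (\<phi> x)) k) \<le> A"
  using assms(2,3)
proof (induction p arbitrary: \<phi>)
  case 0
  then have c: "continuous_on UNIV \<phi>"
    by simp
  then have "compact (\<phi> ` period_box L)"
    by (intro compact_continuous_image compact_cbox) (auto intro: continuous_on_subset)
  then obtain B where B: "\<And>x. x \<in> period_box L \<Longrightarrow> norm (\<phi> x) \<le> B"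
    using compact_imp_bounded bounded_iff by (metis imageI)
  have "norm (fourier_int L (\<lambda>x. complexify (\<phi> x)) k) \<le> B * L\<^sup>2" for k
    using assms(1) B c
    by (intro norm_fourier_int_le bounded_linear.continuous_on[OF bounded_linear_complexify])
       (auto simp: norm_complexify)
  then show ?case
    by auto
next
  case (Suc p)
  let ?D = "\<lambda>x. frechet_derivative \<phi> (at x) (axis i 1)"
  have diff: "\<phi> differentiable at x" for x
    using Suc.prems by simp
  have CkD: "Ck p ?D"
    using Suc.prems by (auto simp: Basis_real_vec)
  obtain A where A: "\<And>k. \<bar>real_of_int (kcomp k i)\<bar> ^ p * norm (fourier_int L (\<lambda>x. complexify (?D x)) k) \<le> A"
    using Suc.IH[OF CkD frechet_derivative_periodic[OF diff Suc.prems(2)]] by blast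
  have "\<bar>real_of_int (kcomp k i)\<bar> ^ Suc p * norm (fourier_int L (\<lambda>x. complexify (\<phi> x)) k) \<le> A * L / (2 * pi)" for k
  proof -
    have "fourier_int L (\<lambda>x. complexify (?D x)) k
        = (\<i> * of_real (2 * pi / L * of_int (kcomp k i))) *s fourier_int L (\<lambda>x. complexify (\<phi> x)) k"
      by (rule fourier_int_derivative[OF assms(1) diff Suc.prems(2) Ck_continuous[OF CkD]])
    then have "norm (fourier_int L (\<lambda>x. complexify (?D x)) k)
        = (2 * pi / L) * (\<bar>real_of_int (kcomp k i)\<bar> * norm (fourier_int L (\<lambda>x. complexify (\<phi> x)) k))"
      using assms(1) by (simp add: norm_smult_vec norm_mult norm_divide)
    then have "\<bar>real_of_int (kcomp k i)\<bar> ^ p * ((2 * pi / L) * (\<bar>real_of_int (kcomp k i)\<bar> * norm (fourier_int L (\<lambda>x. complexify (\<phi> x)) k))) \<le> A"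
      using A[of k] by simp
    then show ?thesis
      using assms(1) by (simp add: field_simps)
  qed
  then show ?case
    by blast
qed

lemma qn_power_le: "qn k ^ p \<le> 1 + 2 ^ p * (\<bar>real_of_int (kcomp k 1)\<bar> ^ p + \<bar>real_of_int (kcomp k 2)\<bar> ^ p)"
proof (cases "k = 0")
  case True
  then show ?thesis
    by (cases p) (auto simp: kcomp_def)
next
  case False
  let ?a = "\<bar>real_of_int (kcomp k 1)\<bar>" and ?b = "\<bar>real_of_int (kcomp k 2)\<bar>"
  have "kn k \<le> ?a + ?b"
    using sqrt_sum_squares_le_sum_abs[of "real_of_int (fst k)" "real_of_int (snd k)"]
    by (simp add: kn_def ksq_def kcomp_def)
  also have "\<dots> \<le> 2 * max ?a ?b"
    by simp
  finally have "kn k \<le> 2 * max ?a ?b" .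
  moreover have "qn k \<le> kn k"
    using kn_ge_1[OF False] unfolding qn_def by (intro real_le_lsqrt) (auto simp: power2_eq_square)
  ultimately have "qn k ^ p \<le> (2 * max ?a ?b) ^ p"
    by (intro power_mono) auto
  also have "\<dots> = 2 ^ p * max ?a ?b ^ p"
    by (rule power_mult_distrib)
  also have "max ?a ?b ^ p \<le> ?a ^ p + ?b ^ p"
    by (auto simp: max_def)
  finally show ?thesis
    by simp
qed

lemma smooth_H_imp_rapid:
  assumes "L > 0" "smooth_H L c"
  shows "rapid c"
  unfolding rapid_def
proof
  fix p
  obtain \<phi> :: "real ^ 2 \<Rightarrow> real ^ 2" where \<phi>: "\<And>n. Ck n \<phi>" "periodic_box L \<phi>"
    and c: "\<And>k. fourier_coeff L \<phi> k = c k"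
    using assms(2) unfolding smooth_H_def smooth_fn_def by blast
  let ?f = "\<lambda>k. norm (fourier_int L (\<lambda>x. complexify (\<phi> x)) k)"
  have nc: "norm (c k) = ?f k / L\<^sup>2" for k
    unfolding c[symmetric] fourier_coeff_eq by (simp add: norm_smult_vec norm_divide norm_power)
  obtain A0 where A0: "\<And>k. \<bar>real_of_int (kcomp k 1)\<bar> ^ 0 * ?f k \<le> A0"
    using Ck_fourier_decay[OF assms(1) \<phi>] by blast
  obtain A1 where A1: "\<And>k. \<bar>real_of_int (kcomp k 1)\<bar> ^ p * ?f k \<le> A1"
    using Ck_fourier_decay[OF assms(1) \<phi>] by blast
  obtain A2 where A2: "\<And>k. \<bar>real_of_int (kcomp k 2)\<bar> ^ p * ?f k \<le> A2"
    using Ck_fourier_decay[OF assms(1) \<phi>] by blast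
  have "qn k ^ p * norm (c k) \<le> (A0 + 2 ^ p * (A1 + A2)) / L\<^sup>2" for k
  proof -
    have "qn k ^ p * ?f k
        \<le> (1 + 2 ^ p * (\<bar>real_of_int (kcomp k 1)\<bar> ^ p + \<bar>real_of_int (kcomp k 2)\<bar> ^ p)) * ?f k"
      by (intro mult_right_mono qn_power_le) auto
    also have "\<dots> = ?f k + 2 ^ p * (\<bar>real_of_int (kcomp k 1)\<bar> ^ p * ?f k + \<bar>real_of_int (kcomp k 2)\<bar> ^ p * ?f k)"
      by (simp add: algebra_simps)
    also have "\<dots> \<le> A0 + 2 ^ p * (A1 + A2)"
      using A0[of k] A1[of k] A2[of k] by (intro add_mono mult_left_mono) auto
    finally show ?thesis
      unfolding nc using assms(1) by (simp add: divide_right_mono)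
  qed
  then show "\<exists>A. \<forall>k. qn k ^ p * norm (c k) \<le> A"
    by blast
qed

text \<open>Of the \<open>2 * m + 5\<close> half-orders, \<open>2 * m\<close> cancel the weight and
  five leave the summable 1 / \<open>qn k ^ 5\<close>.\<close>

lemma rapid_summable:
  assumes "rapid c"
  shows "(\<lambda>k. kn k ^ m * norm (c k)) summable_on UNIV"
proof -
  obtain A where A: "\<And>k. qn k ^ (2 * m + 5) * norm (c k) \<le> A"
    using assms unfolding rapid_def by blast
  obtain Z where Z: "0 \<le> Z" "\<And>F. finite F \<Longrightarrow> (\<Sum>l\<in>F. 1 / qn l ^ 5) \<le> Z"
    by (rule sum_inverse_qn_bounded) blast
  have A0: "0 \<le> A"
    using A[of 0] by (simp add: power_0_left)
  \<comment> \<open>Division by zero makes \<open>1 / qn 0 ^ 5\<close> equal to 0, so the zero mode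
    gets a term of its own.\<close>
  have bnd: "kn k ^ m * norm (c k) \<le> A * (1 / qn k ^ 5) + (if k = 0 then norm (c 0) else 0)" for k
  proof (cases "k = 0")
    case True
    then show ?thesis
      by (cases m) auto
  next
    case False
    then have "0 < qn k ^ 5"
      using qn_ge_1[of k] by (intro zero_less_power) linarith
    moreover have "kn k ^ m * norm (c k) * qn k ^ 5 \<le> A"
      using A[of k] unfolding power_add power_mult qn_pow2 by (simp add: mult_ac)
    ultimately show ?thesis
      using False by (simp add: pos_le_divide_eq)
  qed
  show ?thesis
  proof (rule infsum_le_finite(1))
    fix F :: "(int \<times> int) set" assume F: "finite F"
    have "(\<Sum>k\<in>F. kn k ^ m * norm (c k)) \<le> (\<Sum>k\<in>F. A * (1 / qn k ^ 5) + (if k = 0 then norm (c 0) else 0))"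
      by (intro sum_mono bnd)
    also have "\<dots> = A * (\<Sum>k\<in>F. 1 / qn k ^ 5) + (\<Sum>k\<in>F. if k = 0 then norm (c 0) else 0)"
      by (simp add: sum.distrib sum_distrib_left)
    also have "\<dots> \<le> A * Z + norm (c 0)"
      using F by (intro add_mono mult_left_mono Z A0) auto
    finally show "(\<Sum>k\<in>F. kn k ^ m * norm (c k)) \<le> A * Z + norm (c 0)" .
  qed simp
qed

lemma rapid_abs_summable: "rapid c \<Longrightarrow> (\<lambda>k. norm (c k)) summable_on UNIV"
  using rapid_summable[of c 0] by simp

section \<open>Smooth fields from rapidly decaying coefficients\<close>

definition fourier_series :: "real \<Rightarrow> (int \<times> int \<Rightarrow> complex ^ 2) \<Rightarrow> real ^ 2 \<Rightarrow> complex ^ 2" where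
  "fourier_series L c x = infsum (\<lambda>k. wave L k x *s c k) UNIV"

definition deriv_coeff :: "real \<Rightarrow> 2 \<Rightarrow> (int \<times> int \<Rightarrow> complex ^ 2) \<Rightarrow> int \<times> int \<Rightarrow> complex ^ 2" where
  "deriv_coeff L i c k = (\<i> * of_real (2 * pi / L * of_int (kcomp k i))) *s c k"

lemma abs_kcomp_le: "\<bar>real_of_int (kcomp k i)\<bar> \<le> kn k"
  using abs_Re_le_cmod[of "Complex (of_int (fst k)) (of_int (snd k))"]
    abs_Im_le_cmod[of "Complex (of_int (fst k)) (of_int (snd k))"]
  by (auto simp: kcomp_def kn_cmod)

lemma rapid_deriv_coeff:
  assumes "L > 0" "rapid c"
  shows "rapid (deriv_coeff L i c)"
  unfolding rapid_def
proof
  fix p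
  obtain A where A: "\<And>k. qn k ^ (p + 2) * norm (c k) \<le> A"
    using assms(2) unfolding rapid_def by blast
  have "qn k ^ p * norm (deriv_coeff L i c k) \<le> 2 * pi / L * A" for k
  proof -
    have "norm (deriv_coeff L i c k) = 2 * pi / L * \<bar>real_of_int (kcomp k i)\<bar> * norm (c k)"
      using assms(1) by (simp add: deriv_coeff_def norm_smult_vec norm_mult norm_divide)
    also have "\<dots> \<le> 2 * pi / L * kn k * norm (c k)"
      using assms(1) by (intro mult_right_mono mult_left_mono abs_kcomp_le) auto
    finally have "qn k ^ p * norm (deriv_coeff L i c k) \<le> qn k ^ p * (2 * pi / L * kn k * norm (c k))"
      by (intro mult_left_mono) auto
    also have "\<dots> = 2 * pi / L * (qn k ^ (p + 2) * norm (c k))"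
      unfolding power_add qn_pow2 by simp
    also have "\<dots> \<le> 2 * pi / L * A"
      using assms(1) by (intro mult_left_mono A) auto
    finally show ?thesis .
  qed
  then show "\<exists>A. \<forall>k. qn k ^ p * norm (deriv_coeff L i c k) \<le> A"
    by blast
qed

lemma abs_dotk_le: "\<bar>dotk k x\<bar> \<le> kn k * norm x"
proof -
  have "dotk k x = (\<chi> i. of_int (kcomp k i)) \<bullet> x"
    by (simp add: dotk_def inner_vec_def sum_2 kcomp_def mult.commute)
  moreover have "norm ((\<chi> i. of_int (kcomp k i)) :: real ^ 2) = kn k"
    by (simp add: norm_vec_def L2_set_def sum_2 kcomp_def kn_def ksq_def)
  ultimately show ?thesis
    using Cauchy_Schwarz_ineq2[of "(\<chi> i. of_int (kcomp k i)) :: real ^ 2" x] by simp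
qed

lemma has_sum_fourier_series:
  assumes "rapid c"
  shows "((\<lambda>k. wave L k x *s c k) has_sum fourier_series L c x) UNIV"
proof -
  have "(\<lambda>k. norm (wave L k x *s c k)) summable_on UNIV"
    using rapid_abs_summable[OF assms] by (simp add: norm_smult_vec)
  then show ?thesis
    unfolding fourier_series_def by (rule has_sum_infsum[OF abs_summable_summable])
qed

text \<open>The first-order Taylor remainder of each wave is at most (\<theta> |k| |h|)^2. Rapid
  decay sums this against the coefficients, so the remainder of the series is O(|h|^2).\<close>

lemma fourier_series_has_derivative:
  assumes L: "L > 0" and c: "rapid c"
  shows "(fourier_series L c has_derivative
    (\<lambda>h. h $ 1 *\<^sub>R fourier_series L (deriv_coeff L 1 c) x + h $ 2 *\<^sub>R fourier_series L (deriv_coeff L 2 c) x)) (at x)"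
    (is "(_ has_derivative ?D) _")
proof -
  define \<theta> where "\<theta> = 2 * pi / L"
  define K where "K = infsum (\<lambda>k. kn k ^ 2 * norm (c k)) UNIV"
  have bl: "bounded_linear ?D"
    unfolding linear_conv_bounded_linear[symmetric]
    by (rule linearI) (auto simp: algebra_simps)
  have main: "norm (fourier_series L c (x + h) - fourier_series L c x - ?D h) \<le> \<theta>\<^sup>2 * K * (norm h)\<^sup>2" for h
  proof -
    let ?t = "\<lambda>k. (wave L k (x + h) *s c k - wave L k x *s c k)
        - (h $ 1 *\<^sub>R (wave L k x *s deriv_coeff L 1 c k) + h $ 2 *\<^sub>R (wave L k x *s deriv_coeff L 2 c k))"
    have sum_diff: "((\<lambda>k. p k - q k) has_sum (a - b)) UNIV" if "(p has_sum a) UNIV" "(q has_sum b) UNIV"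
      for p q :: "int \<times> int \<Rightarrow> complex ^ 2" and a b
      using has_sum_add[OF that(1), of "\<lambda>k. - q k" "- b"] that(2) by (simp add: has_sum_uminus)
    have hs: "(?t has_sum (fourier_series L c (x + h) - fourier_series L c x - ?D h)) UNIV"
      by (intro sum_diff has_sum_add has_sum_scaleR has_sum_fourier_series rapid_deriv_coeff L c)
    have t_eq: "?t k = (wave L k x * (cis (\<theta> * dotk k h) - 1 - \<i> * of_real (\<theta> * dotk k h))) *s c k" for k
      unfolding of_real_smult_vec[symmetric] wave_add wave_def[of L k h] \<theta>_def[symmetric]
        deriv_coeff_def dotk_def kcomp_def
      by (simp add: vec_eq_iff algebra_simps)
    have t_le: "norm (?t k) \<le> \<theta>\<^sup>2 * (norm h)\<^sup>2 * (kn k ^ 2 * norm (c k))" for k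
    proof -
      have "norm (?t k) = cmod (cis (\<theta> * dotk k h) - 1 - \<i> * of_real (\<theta> * dotk k h)) * norm (c k)"
        unfolding t_eq norm_smult_vec norm_mult by simp
      also have "\<dots> \<le> (\<theta> * dotk k h)\<^sup>2 * norm (c k)"
        by (intro mult_right_mono cmod_cis_Taylor_le) auto
      also have "\<dots> \<le> (\<theta>\<^sup>2 * (kn k * norm h)\<^sup>2) * norm (c k)"
        unfolding power_mult_distrib[of \<theta>] using abs_dotk_le[of k h]
        by (intro mult_right_mono mult_left_mono power2_le_iff_abs_le[THEN iffD2]) auto
      finally show ?thesis
        by (simp add: power_mult_distrib mult_ac)
    qed
    have sm: "(\<lambda>k. \<theta>\<^sup>2 * (norm h)\<^sup>2 * (kn k ^ 2 * norm (c k))) summable_on UNIV"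
      by (intro summable_on_cmult_right rapid_summable c)
    have smt: "(\<lambda>k. norm (?t k)) summable_on UNIV"
      by (rule Infinite_Sum.abs_summable_on_comparison_test'[OF sm t_le])
    have "norm (infsum ?t UNIV) \<le> infsum (\<lambda>k. norm (?t k)) UNIV"
      by (rule norm_infsum_bound[OF smt])
    also have "\<dots> \<le> infsum (\<lambda>k. \<theta>\<^sup>2 * (norm h)\<^sup>2 * (kn k ^ 2 * norm (c k))) UNIV"
      by (intro infsum_mono smt sm t_le)
    also have "\<dots> = \<theta>\<^sup>2 * (norm h)\<^sup>2 * K"
      unfolding K_def by (rule infsum_cmult_right')
    finally show ?thesis
      unfolding infsumI[OF hs] by (simp add: mult_ac)
  qed
  show ?thesis
  proof (rule has_derivativeI_sandwich[OF zero_less_one bl, where H = "\<lambda>y. \<theta>\<^sup>2 * K * norm (y - x)"])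
    fix y assume "y \<noteq> x"
    then show "norm (fourier_series L c y - fourier_series L c x - ?D (y - x)) / norm (y - x) \<le> \<theta>\<^sup>2 * K * norm (y - x)"
      using main[of "y - x"] by (simp add: pos_divide_le_eq power2_eq_square)
  next
    have "((\<lambda>y. \<theta>\<^sup>2 * K * norm (y - x)) \<longlongrightarrow> \<theta>\<^sup>2 * K * norm (x - x)) (at x)"
      by (intro tendsto_intros)
    then show "((\<lambda>y. \<theta>\<^sup>2 * K * norm (y - x)) \<longlongrightarrow> 0) (at x)"
      by simp
  qed
qed

text \<open>Taking real parts yields a real field from any coefficients, so the induction over
  derivatives need not carry the symmetry under \<open>k\<close> to \<open>- k\<close>.\<close>

definition re_vec :: "complex ^ 2 \<Rightarrow> real ^ 2" where
  "re_vec v = (\<chi> i. Re (v $ i))"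

lemma bounded_linear_re_vec: "bounded_linear re_vec"
  unfolding linear_conv_bounded_linear[symmetric]
  by (rule linearI) (auto simp: re_vec_def vec_eq_iff)

lemma re_series_has_derivative:
  assumes "L > 0" "rapid c"
  shows "((\<lambda>x. re_vec (fourier_series L c x)) has_derivative
    (\<lambda>h. re_vec (h $ 1 *\<^sub>R fourier_series L (deriv_coeff L 1 c) x + h $ 2 *\<^sub>R fourier_series L (deriv_coeff L 2 c) x))) (at x)"
  using bounded_linear.has_derivative[OF bounded_linear_re_vec fourier_series_has_derivative[OF assms]] .

lemma Ck_re_series:
  assumes "L > 0" "rapid c"
  shows "Ck n (\<lambda>x. re_vec (fourier_series L c x))"
  using assms(2)
proof (induction n arbitrary: c)
  case 0
  have "continuous_on UNIV (\<lambda>x. re_vec (fourier_series L c x))"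
    using re_series_has_derivative[OF assms(1) 0] has_derivative_continuous
    by (intro continuous_at_imp_continuous_on) blast
  then show ?case
    by simp
next
  case (Suc n)
  note der = re_series_has_derivative[OF assms(1) Suc.prems]
  have "frechet_derivative (\<lambda>x. re_vec (fourier_series L c x)) (at x) (axis i 1)
      = re_vec (fourier_series L (deriv_coeff L i c) x)" for x i
    unfolding frechet_derivative_at[OF der, symmetric] using exhaust_2[of i] by (auto simp: axis_def)
  moreover have "Ck n (\<lambda>x. re_vec (fourier_series L (deriv_coeff L i c) x))" for i
    by (rule Suc.IH[OF rapid_deriv_coeff[OF assms(1) Suc.prems]])
  moreover have "(\<lambda>x. re_vec (fourier_series L c x)) differentiable at x" for x
    using der[of x] by (rule differentiableI)
  ultimately show ?case
    unfolding Ck.simps Basis_real_vec by auto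
qed

text \<open>Along an axis on which \<open>m\<close> has a nonzero component, a shift by half a
  wavelength reverses the sign of the wave but preserves its integral over the period box.\<close>

lemma integral_wave:
  assumes "L > 0"
  shows "integral (period_box L) (wave L m) = (if m = 0 then of_real (L\<^sup>2) else 0)"
proof (cases "m = 0")
  case True
  then have "wave L m = (\<lambda>x. 1)"
    by auto
  then show ?thesis
    using True assms by (simp add: content_period_box scaleR_conv_of_real)
next
  case False
  then obtain i where i: "kcomp m i \<noteq> 0"
  proof -
    have "kcomp m 1 \<noteq> 0 \<or> kcomp m 2 \<noteq> 0"
      using False by (auto simp: kcomp_def prod_eq_iff)
    then show thesis
      using that by blast
  qed
  define n where "n = \<bar>real_of_int (kcomp m i)\<bar>"
  have n: "1 \<le> n"
    using i by (simp add: n_def)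
  define h where "h = L / (2 * n)"
  have h: "0 \<le> h" "h \<le> L"
    using assms n by (auto simp: h_def field_simps)
  have "integral (period_box L) (\<lambda>x. wave L m (x + h *\<^sub>R axis i 1)) = integral (period_box L) (wave L m)"
    using assms by (intro integral_periodic_shift continuous_wave h) (auto simp: periodic_box_iff wave_period)
  moreover have "wave L m (h *\<^sub>R axis i 1) = -1"
  proof -
    have "wave L m (h *\<^sub>R axis i 1) = cis (pi * (of_int (kcomp m i) / n))"
      using assms n by (simp add: wave_axis h_def field_simps)
    moreover have "of_int (kcomp m i) / n = 1 \<or> of_int (kcomp m i) / n = -1"
      using i by (auto simp: n_def abs_if)
    moreover have "cis (pi * 1) = -1" "cis (pi * -1) = -1"
      by (auto simp: complex_eq_iff)
    ultimately show ?thesis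
      by metis
  qed
  ultimately have "integral (period_box L) (\<lambda>x. - wave L m x) = integral (period_box L) (wave L m)"
    by (simp add: wave_add)
  then show ?thesis
    using False by simp
qed

text \<open>By orthogonality, the integral of a partial sum is constant from the first box
  containing \<open>k\<close> on.\<close>

lemma fourier_int_series:
  assumes "L > 0" "rapid c"
  shows "fourier_int L (fourier_series L c) k = of_real (L\<^sup>2) *s c k"
proof -
  let ?g = "\<lambda>n x. \<Sum>j\<in>sq_box n. wave L (j - k) x *s c j"
  define K where "K = infsum (\<lambda>k. norm (c k)) UNIV"
  have hi: "((\<lambda>x. wave L m x *s v) has_integral (if m = 0 then of_real (L\<^sup>2) else 0) *s v) (period_box L)"
    for m and v :: "complex ^ 2"
  proof -
    have "wave L m integrable_on period_box L"
      by (intro integrable_continuous continuous_wave)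
    then have "(wave L m has_integral (if m = 0 then of_real (L\<^sup>2) else 0)) (period_box L)"
      unfolding integral_wave[OF assms(1), of m, symmetric] by (rule integrable_integral)
    from has_integral_linear[OF this bounded_linear_smult_left] show ?thesis
      unfolding o_def .
  qed
  have g_int: "(?g n has_integral (\<Sum>j\<in>sq_box n. (if j - k = 0 then of_real (L\<^sup>2) else 0) *s c j)) (period_box L)" for n
    by (intro has_integral_sum finite_sq_box hi)
  have "(\<lambda>n. integral (period_box L) (?g n)) \<longlonglongrightarrow> integral (period_box L) (\<lambda>x. wave L (- k) x *s fourier_series L c x)"
  proof (rule dominated_convergence(2)[where h = "\<lambda>_. K"])
    show "?g n integrable_on period_box L" for n
      using g_int by blast
    show "norm (?g n x) \<le> K" for n x
    proof -
      have "norm (?g n x) \<le> (\<Sum>j\<in>sq_box n. norm (wave L (j - k) x *s c j))"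
        by (rule norm_sum)
      also have "\<dots> = (\<Sum>j\<in>sq_box n. norm (c j))"
        by (simp add: norm_smult_vec)
      also have "\<dots> \<le> K"
        unfolding K_def by (intro finite_sum_le_infsum_UNIV rapid_abs_summable assms) auto
      finally show ?thesis .
    qed
    show "(\<lambda>n. ?g n x) \<longlonglongrightarrow> wave L (- k) x *s fourier_series L c x" for x
    proof -
      have "((\<lambda>j. wave L (- k) x *s (wave L j x *s c j)) has_sum wave L (- k) x *s fourier_series L c x) UNIV"
        by (rule has_sum_bounded_linear[OF bounded_linear_smult has_sum_fourier_series[OF assms(2)]])
      moreover have "(\<lambda>j. wave L (- k) x *s (wave L j x *s c j)) = (\<lambda>j. wave L (j - k) x *s c j)"
        by (simp add: vector_smult_assoc wave_mult)
      ultimately show ?thesis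
        unfolding has_sum_def by (intro filterlim_compose[OF _ sq_box_at_top]) (simp only:)
    qed
  qed (rule integrable_const)
  moreover have "\<forall>\<^sub>F n in sequentially. integral (period_box L) (?g n) = of_real (L\<^sup>2) *s c k"
  proof (rule eventually_sequentiallyI[of "mx k"])
    fix n assume "mx k \<le> n"
    then have k: "k \<in> sq_box n"
      by (simp add: mem_sq_box)
    have "integral (period_box L) (?g n) = (\<Sum>j\<in>sq_box n. if j = k then of_real (L\<^sup>2) *s c k else 0)"
      unfolding integral_unique[OF g_int] by (intro sum.cong) auto
    then show "integral (period_box L) (?g n) = of_real (L\<^sup>2) *s c k"
      using k by simp
  qed
  ultimately show ?thesis
    unfolding fourier_int_def by (intro LIMSEQ_unique[OF _ tendsto_eventually])
qed

lemma rapid_imp_smooth_H: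
  assumes "L > 0" "in_H c" "rapid c"
  shows "smooth_H L c"
proof -
  define \<phi> where "\<phi> x = re_vec (fourier_series L c x)" for x
  \<comment> \<open>The reality condition in \<open>in_H\<close> makes the series equal to its
    conjugate, so passing to real parts leaves the coefficients intact.\<close>
  have real: "complexify (\<phi> x) = fourier_series L c x" for x
  proof -
    let ?J = "\<lambda>v :: complex ^ 2. \<chi> i. cnj (v $ i)"
    have "bounded_linear ?J"
      unfolding linear_conv_bounded_linear[symmetric]
      by (rule linearI) (auto simp: vec_eq_iff)
    from has_sum_bounded_linear[OF this has_sum_fourier_series[OF assms(3), of L x]]
    have "((\<lambda>k. ?J (wave L k x *s c k)) has_sum ?J (fourier_series L c x)) UNIV" .
    moreover have "?J (wave L k x *s c k) = wave L (- k) x *s c (- k)" for k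
      by (simp add: vec_eq_iff cnj_wave in_H_uminus[OF assms(2)])
    ultimately have "((\<lambda>k. wave L (- k) x *s c (- k)) has_sum ?J (fourier_series L c x)) UNIV"
      by simp
    moreover have "bij_betw uminus (UNIV :: (int \<times> int) set) UNIV"
      by (rule bij_betw_byWitness[where f' = uminus]) auto
    ultimately have "((\<lambda>k. wave L k x *s c k) has_sum ?J (fourier_series L c x)) UNIV"
      using has_sum_reindex_bij_betw[of uminus UNIV UNIV "\<lambda>k. wave L k x *s c k"] by simp
    then have "?J (fourier_series L c x) = fourier_series L c x"
      by (rule has_sum_unique[OF _ has_sum_fourier_series[OF assms(3)]])
    then have "cnj (fourier_series L c x $ i) = fourier_series L c x $ i" for i
      by (metis vec_lambda_beta)
    then have "of_real (Re (fourier_series L c x $ i)) = fourier_series L c x $ i" for i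
      by (metis Reals_cnj_iff of_real_Re)
    then show ?thesis
      by (simp add: complexify_def \<phi>_def re_vec_def vec_eq_iff)
  qed
  have "smooth_fn \<phi>"
    unfolding smooth_fn_def \<phi>_def using Ck_re_series[OF assms(1,3)] by blast
  moreover have "periodic_box L \<phi>"
    using assms(1) by (simp add: periodic_box_iff \<phi>_def fourier_series_def wave_period)
  moreover have "fourier_coeff L \<phi> k = c k" for k
    unfolding fourier_coeff_eq real fourier_int_series[OF assms(1,3)]
    using assms(1) by (simp add: vector_smult_assoc flip: of_real_mult)
  ultimately show ?thesis
    unfolding smooth_H_def by blast
qed

section \<open>The attractor\<close>

lemma attractorE:
  assumes "u0 \<in> attractor \<nu> L g" "\<nu> > 0" "L > 0" "in_H g"
  obtains u M where "bounded_solution \<nu> L M g u" "u 0 = u0"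
  using assms unfolding attractor_def bounded_solution_def by blast

theorem theorem2p4:
  fixes \<nu> L :: real and g :: "int \<times> int \<Rightarrow> complex ^ 2"
  assumes "\<nu> > 0" and "L > 0" and "in_H g"
    and "\<exists>u0 \<in> attractor \<nu> L g. smooth_H L u0"
  shows "(\<forall>u0 \<in> attractor \<nu> L g. smooth_H L u0) \<and> smooth_H L g"
proof -
  obtain v0 where v0: "v0 \<in> attractor \<nu> L g" "smooth_H L v0"
    using assms(4) by blast
  obtain v M where v: "bounded_solution \<nu> L M g v" "v 0 = v0"
    by (rule attractorE[OF v0(1) assms(1-3)])
  have g: "rapid g"
    using bounded_solution.rapid_g[OF v(1), of 0] smooth_H_imp_rapid[OF assms(2) v0(2)] v(2) by simp
  have "smooth_H L u0" if u0: "u0 \<in> attractor \<nu> L g" for u0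
  proof -
    obtain u N where u: "bounded_solution \<nu> L N g u" "u 0 = u0"
      by (rule attractorE[OF u0 assms(1-3)])
    show ?thesis
      using rapid_imp_smooth_H[OF assms(2) bounded_solution.u_in_H[OF u(1)] bounded_solution.rapid_u[OF u(1) g], of 0]
        u(2) by simp
  qed
  moreover have "smooth_H L g"
    by (rule rapid_imp_smooth_H[OF assms(2,3) g])
  ultimately show ?thesis
    by blast
qed

end
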